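(* Let $g\in\mathcal{BV}$, $v=P[g]$ and $v_r(\theta)=v(re^{i\theta})$. (a) If $g\in\mathcal{NBV}$ then $v_r\to g$ weak* in $\mathcal{NBV}$ as $r\to1$. (b) For all $0\le r<1$, $\|v_r\|_\infty\le\inf|g|+Vg$. (c) If $g\in\mathcal{NBV}$ then $\|v_r\|_\infty\le Vg$ for all $0\le r<1$. (d) $Vv_r\le Vg$ for all $0\le r<1$. (e) There is $\sigma\in\mathcal{NBV}$ such that if $w_r(\theta)=P[\sigma](re^{i\theta})$ then $V[w_r-\sigma]\not\to0$ as $r\to1$. And there is $\tau\in\mathcal{BV}$ with $\tau(\theta)=[\tau(\theta+)+\tau(\theta-)]/2$ for all $\theta\in[-\pi,\pi]$ such that if $w_r(\theta)=P[\tau](re^{i\theta})$ then $V(w_r-\tau)\not\to0$ as $r\to1$. (f) Let $h^{\mathcal{BV}}:=\{u:D\to\mathbb{R}\mid\Delta u=0,\ \|u\|_{\mathcal{BV}}<\infty\}$, where $\|u\|_{\mathcal{BV}}:=\sup_{0\le r<1}Vu_r$ and $u_r(\theta)=u(re^{i\theta})$. The mapping $P:\mathcal{NBV}\to h^{\mathcal{BV}}$, $g\mapsto P[g]$, is an isometric isomorphism between the Banach spaces $\mathcal{NBV}$ and $h^{\mathcal{BV}}$.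
   Context: $D$ is the open unit disc in $\mathbb{R}^2$. For a $2\pi$-periodic $g:\mathbb{R}\to\mathbb{R}$, $Vg$ denotes the total variation of $g$ over one period. $\mathcal{BV}$ is the set of $2\pi$-periodic functions $g:\mathbb{R}\to\mathbb{R}$ with $Vg<\infty$. $\mathcal{NBV}:=\{g:\mathbb{R}\to\mathbb{R}\mid g\text{ is }2\pi\text{-periodic},\ Vg<\infty,\ g(-\pi)=0,\ g\text{ is right continuous}\}$, with the variation $Vg$ as norm. $\mathcal{HK}$ is the set of $2\pi$-periodic functions $f:\mathbb{R}\to\mathbb{R}$ that are Henstock--Kurzweil integrable over a period, with the Alexiewicz norm $\|f\|:=\sup_I|\int_I f|$, the supremum being over intervals $I\subset\mathbb{R}$ of length at most $2\pi$. The paper regards $\mathcal{NBV}$ as the dual of $\mathcal{HK}$ via the pairing $(f,g)\mapsto\int_{-\pi}^{\pi}fg$; weak* convergence $v_r\to g$ means $\int_{-\pi}^{\pi}f v_r\to\int_{-\pi}^{\pi}fg$ for every $f\in\mathcal{HK}$. The Poisson kernel is $\Phi_r(\theta)=\frac{1-r^2}{2\pi(1-2r\cos\theta+r^2)}$ and $P[g](re^{i\theta})=\int_{-\pi}^{\pi}g(\phi)\Phi_r(\phi-\theta)\,d\phi$. $\|\cdot\|_\infty$ is the supremum norm. Limits $r\to1$ are from below.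
   Formalization: In (f), h^BV is replaced by its quotient by the constant functions with the quotient norm: constants have BV-norm 0, so it is not a norm on h^BV, and the constant 1 is not P[g] for any g in NBV; the isomorphism is g ↦ class of P[g]. *)

theory Defs
  imports "HOL-Analysis.Analysis"
begin

definition periodic2pi :: "(real \<Rightarrow> real) \<Rightarrow> bool" where
  "periodic2pi g \<longleftrightarrow> (\<forall>\<theta>. g (\<theta> + 2 * pi) = g \<theta>)"

(* Total variation over the period [-pi, pi]: supremum over the partitions
   -pi = x 0 < ... < x n = pi. *)
definition variation :: "(real \<Rightarrow> real) \<Rightarrow> ennreal" where
  "variation g =
     (SUP (n, x) \<in> {(n :: nat, x :: nat \<Rightarrow> real).
                      x 0 = - pi \<and> x n = pi \<and> (\<forall>i<n. x i < x (Suc i))}.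
        \<Sum>i<n. ennreal \<bar>g (x (Suc i)) - g (x i)\<bar>)"

definition BV :: "(real \<Rightarrow> real) set" where
  "BV = {g. periodic2pi g \<and> variation g < \<infinity>}"

definition NBV :: "(real \<Rightarrow> real) set" where
  "NBV = {g. periodic2pi g \<and> variation g < \<infinity> \<and> g (- pi) = 0 \<and>
             (\<forall>\<theta>. continuous (at_right \<theta>) g)}"

(* integrable_on is the gauge (Henstock-Kurzweil) integral. *)
definition HK :: "(real \<Rightarrow> real) set" where
  "HK = {f. periodic2pi f \<and> f integrable_on {- pi..pi}}"

(* Weak* convergence v r -> g as r -> 1-, for the pairing of HK and NBV. The
   integrability conditions say that every pairing involved is a genuine integral, not
   the default value 0. The v r need not vanish at -pi. *)
definition weak_star_converges :: "(real \<Rightarrow> real \<Rightarrow> real) \<Rightarrow> (real \<Rightarrow> real) \<Rightarrow> bool" where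
  "weak_star_converges v g \<longleftrightarrow>
     (\<forall>f\<in>HK.
        (\<lambda>\<theta>. f \<theta> * g \<theta>) integrable_on {- pi..pi} \<and>
        (\<forall>r\<in>{0..<1}. (\<lambda>\<theta>. f \<theta> * v r \<theta>) integrable_on {- pi..pi}) \<and>
        ((\<lambda>r. integral {- pi..pi} (\<lambda>\<theta>. f \<theta> * v r \<theta>))
           \<longlongrightarrow> integral {- pi..pi} (\<lambda>\<theta>. f \<theta> * g \<theta>)) (at_left 1))"

definition sup_norm :: "(real \<Rightarrow> real) \<Rightarrow> ennreal" where
  "sup_norm f = (SUP \<theta>. ennreal \<bar>f \<theta>\<bar>)"

definition poisson_kernel :: "real \<Rightarrow> real \<Rightarrow> real" where
  "poisson_kernel r \<theta> = (1 - r\<^sup>2) / (2 * pi * (1 - 2 * r * cos \<theta> + r\<^sup>2))"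

(* A function on the unit disc is a total function on complex of which only the values
   on ball 0 1 are used. *)
definition poisson :: "(real \<Rightarrow> real) \<Rightarrow> complex \<Rightarrow> real" where
  "poisson g z =
     integral {- pi..pi} (\<lambda>\<phi>. g \<phi> * poisson_kernel (cmod z) (\<phi> - Arg z))"

lemma poisson_rcis:
  assumes "0 \<le> r"
  shows "poisson g (rcis r \<theta>) = integral {- pi..pi} (\<lambda>\<phi>. g \<phi> * poisson_kernel r (\<phi> - \<theta>))"
proof (cases "r = 0")
  case True
  then show ?thesis by (simp add: poisson_def poisson_kernel_def)
next
  case False
  have "cis (Arg (rcis r \<theta>)) = cis \<theta>"
    using assms False by (simp add: cis_Arg rcis_def sgn_mult sgn_of_real)
  then have "cos (Arg (rcis r \<theta>)) = cos \<theta>" "sin (Arg (rcis r \<theta>)) = sin \<theta>"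
    by (simp_all add: complex_eq_iff)
  with assms show ?thesis
    by (simp add: poisson_def poisson_kernel_def cos_diff)
qed

(* The restriction of u to the circle of radius r, as a function of the angle. *)
definition on_circle :: "(complex \<Rightarrow> real) \<Rightarrow> real \<Rightarrow> real \<Rightarrow> real" where
  "on_circle u r \<theta> = u (rcis r \<theta>)"

(* u is twice continuously differentiable on the open set S with zero Laplacian; ux, uy
   and uxx, uxy, uyx, uyy are its partial derivatives of first and second order. *)
definition harmonic_on :: "(complex \<Rightarrow> real) \<Rightarrow> complex set \<Rightarrow> bool" where
  "harmonic_on u S \<longleftrightarrow>
     (\<exists>ux uy uxx uxy uyx uyy :: complex \<Rightarrow> real.
        (\<forall>z\<in>S. (u has_derivative (\<lambda>h. ux z * Re h + uy z * Im h)) (at z) \<and>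
               (ux has_derivative (\<lambda>h. uxx z * Re h + uxy z * Im h)) (at z) \<and>
               (uy has_derivative (\<lambda>h. uyx z * Re h + uyy z * Im h)) (at z)) \<and>
        continuous_on S uxx \<and> continuous_on S uxy \<and>
        continuous_on S uyx \<and> continuous_on S uyy \<and>
        (\<forall>z\<in>S. uxx z + uyy z = 0))"

definition hBV_norm :: "(complex \<Rightarrow> real) \<Rightarrow> ennreal" where
  "hBV_norm u = (SUP r\<in>{0..<1}. variation (on_circle u r))"

definition hBV :: "(complex \<Rightarrow> real) set" where
  "hBV = {u. harmonic_on u (ball 0 1) \<and> hBV_norm u < \<infinity>}"

(* hBV_norm vanishes on the constants, so it is a norm only after functions differing by a
   constant on the disc have been identified. The same identification absorbs the
   irrelevant values outside the disc. *)
definition hBV_rel :: "((complex \<Rightarrow> real) \<times> (complex \<Rightarrow> real)) set" where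
  "hBV_rel = {(u, w). u \<in> hBV \<and> w \<in> hBV \<and> (\<exists>c. \<forall>z\<in>ball 0 1. u z = w z + c)}"

record 'a normed_structure =
  ns_carrier :: "'a set"
  ns_add :: "'a \<Rightarrow> 'a \<Rightarrow> 'a"
  ns_zero :: 'a
  ns_scale :: "real \<Rightarrow> 'a \<Rightarrow> 'a"
  ns_norm :: "'a \<Rightarrow> real"

definition real_vector_structure :: "'a normed_structure \<Rightarrow> bool" where
  "real_vector_structure X \<longleftrightarrow>
     ns_zero X \<in> ns_carrier X \<and>
     (\<forall>x\<in>ns_carrier X. \<forall>y\<in>ns_carrier X. ns_add X x y \<in> ns_carrier X) \<and>
     (\<forall>a. \<forall>x\<in>ns_carrier X. ns_scale X a x \<in> ns_carrier X) \<and>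
     (\<forall>x\<in>ns_carrier X. \<forall>y\<in>ns_carrier X. \<forall>z\<in>ns_carrier X.
        ns_add X (ns_add X x y) z = ns_add X x (ns_add X y z)) \<and>
     (\<forall>x\<in>ns_carrier X. \<forall>y\<in>ns_carrier X. ns_add X x y = ns_add X y x) \<and>
     (\<forall>x\<in>ns_carrier X. ns_add X (ns_zero X) x = x) \<and>
     (\<forall>x\<in>ns_carrier X. ns_add X (ns_scale X (- 1) x) x = ns_zero X) \<and>
     (\<forall>a. \<forall>x\<in>ns_carrier X. \<forall>y\<in>ns_carrier X.
        ns_scale X a (ns_add X x y) = ns_add X (ns_scale X a x) (ns_scale X a y)) \<and>
     (\<forall>a b. \<forall>x\<in>ns_carrier X.
        ns_scale X (a + b) x = ns_add X (ns_scale X a x) (ns_scale X b x)) \<and>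
     (\<forall>a b. \<forall>x\<in>ns_carrier X. ns_scale X a (ns_scale X b x) = ns_scale X (a * b) x) \<and>
     (\<forall>x\<in>ns_carrier X. ns_scale X 1 x = x)"

definition banach_structure :: "'a normed_structure \<Rightarrow> bool" where
  "banach_structure X \<longleftrightarrow>
     real_vector_structure X \<and>
     (\<forall>x\<in>ns_carrier X. 0 \<le> ns_norm X x) \<and>
     (\<forall>x\<in>ns_carrier X. ns_norm X x = 0 \<longleftrightarrow> x = ns_zero X) \<and>
     (\<forall>a. \<forall>x\<in>ns_carrier X. ns_norm X (ns_scale X a x) = \<bar>a\<bar> * ns_norm X x) \<and>
     (\<forall>x\<in>ns_carrier X. \<forall>y\<in>ns_carrier X.
        ns_norm X (ns_add X x y) \<le> ns_norm X x + ns_norm X y) \<and>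
     Metric_space.mcomplete (ns_carrier X) (\<lambda>x y. ns_norm X (ns_add X x (ns_scale X (- 1) y)))"

definition isometric_isomorphism ::
    "('a \<Rightarrow> 'b) \<Rightarrow> 'a normed_structure \<Rightarrow> 'b normed_structure \<Rightarrow> bool" where
  "isometric_isomorphism T X Y \<longleftrightarrow>
     bij_betw T (ns_carrier X) (ns_carrier Y) \<and>
     (\<forall>x\<in>ns_carrier X. \<forall>y\<in>ns_carrier X. T (ns_add X x y) = ns_add Y (T x) (T y)) \<and>
     (\<forall>a. \<forall>x\<in>ns_carrier X. T (ns_scale X a x) = ns_scale Y a (T x)) \<and>
     (\<forall>x\<in>ns_carrier X. ns_norm Y (T x) = ns_norm X x)"

definition NBV_space :: "(real \<Rightarrow> real) normed_structure" where
  "NBV_space =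
     \<lparr>ns_carrier = NBV,
      ns_add = (\<lambda>f g \<theta>. f \<theta> + g \<theta>),
      ns_zero = (\<lambda>\<theta>. 0),
      ns_scale = (\<lambda>a g \<theta>. a * g \<theta>),
      ns_norm = (\<lambda>g. enn2real (variation g))\<rparr>"

(* The quotient of hBV by the constants, with the quotient norm. *)
definition hBV_space :: "(complex \<Rightarrow> real) set normed_structure" where
  "hBV_space =
     \<lparr>ns_carrier = hBV // hBV_rel,
      ns_add = (\<lambda>A B. \<Union>u\<in>A. \<Union>w\<in>B. hBV_rel `` {\<lambda>z. u z + w z}),
      ns_zero = hBV_rel `` {\<lambda>z. 0},
      ns_scale = (\<lambda>a A. \<Union>u\<in>A. hBV_rel `` {\<lambda>z. a * u z}),
      ns_norm = (\<lambda>A. enn2real (INF u\<in>A. hBV_norm u))\<rparr>"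

end

theory Submission
  imports Defs "HOL-Complex_Analysis.Complex_Analysis" "HOL-Probability.Helly_Selection"
begin

text \<open>
  After the substitution \<open>\<phi> = \<theta> + t\<close> the function \<open>v\<^sub>r\<close> is an average of translates of \<open>g\<close> with respect to the
  probability density \<open>\<Phi>\<^sub>r\<close>, which gives the bounds on the supremum norm and on the variation. Since
  \<open>v\<^sub>r \<rightarrow> g\<close> at the continuity points of \<open>g\<close>, the variation of a right continuous \<open>g\<close> is at most the supremum
  of the variations of the \<open>v\<^sub>r\<close>, so the Poisson integral is an isometry. Conversely, a harmonic function \<open>u\<close> of
  bounded \<open>hBV\<close> norm satisfies \<open>u (\<rho> z) = P[u\<^sub>\<rho>] z\<close>; splitting \<open>u\<^sub>\<rho>\<close> into monotone parts, Helly's theorem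
  yields a boundary function as \<open>\<rho> \<rightarrow> 1\<close>. Completeness is proved for \<open>NBV\<close> and transported along the
  isometry.
\<close>


subsection \<open>Total variation on an interval\<close>

text \<open>Functions in \<open>HK\<close> need not be absolutely integrable, so products with them
  cannot be controlled through absolute values; integrability and bounds of pairings come from the
  second mean value theorem, applied to the monotone parts of the BV factor. The norm of
  \<open>hBV\<close> sees only oscillation. A bounded family is therefore compact only after
  constants have been subtracted, and Poisson integrals exhaust \<open>hBV\<close> only up to a
  constant, which the quotient absorbs. The laws of the quotient are obtained through the bijection
  with \<open>NBV\<close> rather than from representatives. Right continuity is what makes the map
  isometric: a stray value at one point raises the variation but leaves the Poisson integral
  unchanged. Harmonicity is stated with partial derivatives, and equality of the mixed ones is not
  part of the definition. The passage to holomorphic functions, where Cauchy's formula is available,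
  thus begins with Schwarz's theorem.\<close>

text \<open>Repeated points are allowed in a chain, so that a chain can be split at a point \<open>b\<close> by taking
  \<open>min\<close> and \<open>max\<close> with \<open>b\<close>.\<close>

definition chains_between :: "real \<Rightarrow> real \<Rightarrow> (nat \<times> (nat \<Rightarrow> real)) set" where
  "chains_between a b = {(n, x). x 0 = a \<and> x n = b \<and> (\<forall>i<n. x i \<le> x (Suc i))}"

definition chain_sum :: "(real \<Rightarrow> real) \<Rightarrow> nat \<Rightarrow> (nat \<Rightarrow> real) \<Rightarrow> real" where
  "chain_sum g n x = (\<Sum>i<n. \<bar>g (x (Suc i)) - g (x i)\<bar>)"

text \<open>Arbitrary endpoints are allowed because translating a periodic function leads to the
  variation over a shifted interval. With values in \<open>ennreal\<close> the supremum exists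
  before finiteness is known.\<close>

definition tv :: "(real \<Rightarrow> real) \<Rightarrow> real \<Rightarrow> real \<Rightarrow> ennreal" where
  "tv g a b = (SUP (n, x) \<in> chains_between a b. ennreal (chain_sum g n x))"

lemma chain_sum_nonneg [simp]: "0 \<le> chain_sum g n x"
  by (simp add: chain_sum_def sum_nonneg)

lemma chain_sum_Suc: "chain_sum g (Suc n) x = chain_sum g n x + \<bar>g (x (Suc n)) - g (x n)\<bar>"
  by (simp add: chain_sum_def)

lemma chain_bounds:
  assumes "(n, x) \<in> chains_between a b" "i \<le> n"
  shows "a \<le> x i" "x i \<le> b"
proof -
  have "x j \<le> x k" if "j \<le> k" "k \<le> n" for j k
    using that
  proof (induction k)
    case (Suc k)
    show ?case
    proof (cases "j = Suc k")
      case False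
      have "x k \<le> x (Suc k)"
        using assms(1) Suc.prems by (simp add: chains_between_def)
      then show ?thesis using Suc False by (auto intro: order_trans)
    qed simp
  qed simp
  from this[of 0 i] this[of i n] assms show "a \<le> x i" "x i \<le> b"
    by (auto simp: chains_between_def)
qed

lemma chain_sum_le_tv: "(n, x) \<in> chains_between a b \<Longrightarrow> ennreal (chain_sum g n x) \<le> tv g a b"
  unfolding tv_def by (rule SUP_upper2[where i = "(n, x)"]) auto

lemma tv_least:
  assumes "\<And>n x. (n, x) \<in> chains_between a b \<Longrightarrow> ennreal (chain_sum g n x) \<le> B"
  shows "tv g a b \<le> B"
  unfolding tv_def by (rule SUP_least) (use assms in auto)

text \<open>A step between equal points contributes nothing to the sum and is dropped; a proper step
  is appended.\<close>

lemma strict_chain_exists: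
  assumes "x 0 = a" "\<forall>i<n. x i \<le> x (Suc i)"
  shows "\<exists>m y. y 0 = a \<and> y m = x n \<and> (\<forall>i<m. y i < y (Suc i)) \<and> chain_sum g m y = chain_sum g n x"
  using assms(2)
proof (induction n)
  case 0
  show ?case
    by (rule exI[where x = 0], rule exI[where x = x]) (use assms in \<open>simp add: chain_sum_def\<close>)
next
  case (Suc n)
  then obtain m y where y: "y 0 = a" "y m = x n" "\<forall>i<m. y i < y (Suc i)"
      "chain_sum g m y = chain_sum g n x"
    by auto
  show ?case
  proof (cases "x n = x (Suc n)")
    case True
    with y show ?thesis
      by (intro exI[where x = m] exI[where x = y]) (simp add: chain_sum_Suc)
  next
    case False
    with Suc.prems have "x n < x (Suc n)" by (simp add: less_le)
    define z where "z = y(Suc m := x (Suc n))"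
    have "chain_sum g m z = chain_sum g m y"
      by (auto simp: chain_sum_def z_def intro!: sum.cong)
    then show ?thesis
      using y \<open>x n < x (Suc n)\<close>
      by (intro exI[where x = "Suc m"] exI[where x = z])
        (auto simp: chain_sum_Suc less_Suc_eq, auto simp: z_def)
  qed
qed

text \<open>\<open>variation\<close> uses strictly increasing partitions, whereas the chains of
  \<open>tv\<close> may stand still; the direction with content removes the repetitions.\<close>

lemma variation_eq_tv: "variation g = tv g (- pi) pi"
proof (rule antisym)
  show "variation g \<le> tv g (- pi) pi"
    unfolding variation_def
  proof (rule SUP_least, clarify)
    fix n :: nat and x :: "nat \<Rightarrow> real"
    assume "x 0 = - pi" "x n = pi" "\<forall>i<n. x i < x (Suc i)"
    then have "(n, x) \<in> chains_between (- pi) pi"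
      by (auto simp: chains_between_def less_imp_le)
    from chain_sum_le_tv[OF this, of g]
    show "(\<Sum>i<n. ennreal \<bar>g (x (Suc i)) - g (x i)\<bar>) \<le> tv g (- pi) pi"
      by (simp add: chain_sum_def)
  qed
  show "tv g (- pi) pi \<le> variation g"
  proof (rule tv_least)
    fix n x assume nx: "(n, x) \<in> chains_between (- pi) pi"
    obtain m y where y: "y 0 = - pi" "y m = x n" "\<forall>i<m. y i < y (Suc i)"
      "chain_sum g m y = chain_sum g n x"
      using strict_chain_exists[of x "- pi" n g] nx by (auto simp: chains_between_def)
    have "(\<Sum>i<m. ennreal \<bar>g (y (Suc i)) - g (y i)\<bar>) \<le> variation g"
      unfolding variation_def
      by (rule SUP_upper2[where i = "(m, y)"]) (use y nx in \<open>auto simp: chains_between_def\<close>)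
    then show "ennreal (chain_sum g n x) \<le> variation g"
      using y by (simp add: chain_sum_def)
  qed
qed

lemma abs_diff_le_tv:
  assumes "a \<le> b"
  shows "ennreal \<bar>g b - g a\<bar> \<le> tv g a b"
proof -
  have "(1, \<lambda>i. if i = 0 then a else b) \<in> chains_between a b"
    using assms by (auto simp: chains_between_def)
  from chain_sum_le_tv[OF this, of g] show ?thesis
    by (simp add: chain_sum_def)
qed

lemma chains_between_nonempty: "a \<le> b \<Longrightarrow> chains_between a b \<noteq> {}"
  by (auto simp: chains_between_def intro!: exI[where x = 1] exI[where x = "\<lambda>i. if i = 0 then a else b"])

lemma chain_append:
  assumes x: "(n, x) \<in> chains_between a b" and y: "(m, y) \<in> chains_between b c"
  obtains z where "(n + m, z) \<in> chains_between a c" "chain_sum g (n + m) z = chain_sum g n x + chain_sum g m y"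
proof -
  define z where "z = (\<lambda>i. if i \<le> n then x i else y (i - n))"
  have zy: "z (n + j) = y j" for j
    using x y by (cases j) (auto simp: z_def chains_between_def)
  have *: "z i \<le> z (Suc i)" if "i < n + m" for i
  proof (cases "i < n")
    case True
    then show ?thesis using x by (simp add: z_def chains_between_def)
  next
    case False
    then obtain j where j: "i = n + j" using le_Suc_ex not_less by blast
    with that have "y j \<le> y (Suc j)" using y by (simp add: chains_between_def)
    then show ?thesis using zy[of j] zy[of "Suc j"] j by simp
  qed
  have "(n + m, z) \<in> chains_between a c"
    using * x y zy[of m] by (auto simp: chains_between_def z_def)
  moreover have "chain_sum g (n + k) z = chain_sum g n x + chain_sum g k y" for k
  proof (induction k)
    case 0
    show ?case by (auto simp: chain_sum_def z_def intro!: sum.cong)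
  next
    case (Suc k)
    then show ?case
      using zy[of k] zy[of "Suc k"] by (simp add: chain_sum_Suc)
  qed
  ultimately show ?thesis using that by blast
qed

text \<open>For one inequality a chain is cut at \<open>b\<close> by \<open>min\<close> and
  \<open>max\<close>: a step on one side of \<open>b\<close> survives in one part only, and a step
  across \<open>b\<close> is split by the triangle inequality. The other inequality concatenates
  chains.\<close>

lemma tv_add:
  assumes "a \<le> b" "b \<le> c"
  shows "tv g a c = tv g a b + tv g b c"
proof (rule antisym)
  show "tv g a c \<le> tv g a b + tv g b c"
  proof (rule tv_least)
    fix n x assume nx: "(n, x) \<in> chains_between a c"
    have 1: "(n, \<lambda>i. min (x i) b) \<in> chains_between a b" "(n, \<lambda>i. max (x i) b) \<in> chains_between b c"
      using nx assms by (fastforce simp: chains_between_def min_def max_def)+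
    have "chain_sum g n x \<le> chain_sum g n (\<lambda>i. min (x i) b) + chain_sum g n (\<lambda>i. max (x i) b)"
      unfolding chain_sum_def sum.distrib[symmetric]
    proof (rule sum_mono)
      fix i assume "i \<in> {..<n}"
      then have "x i \<le> x (Suc i)" using nx by (auto simp: chains_between_def)
      then show "\<bar>g (x (Suc i)) - g (x i)\<bar>
          \<le> \<bar>g (min (x (Suc i)) b) - g (min (x i) b)\<bar> + \<bar>g (max (x (Suc i)) b) - g (max (x i) b)\<bar>"
        by (auto simp: min_def max_def)
    qed
    then have "ennreal (chain_sum g n x)
        \<le> ennreal (chain_sum g n (\<lambda>i. min (x i) b)) + ennreal (chain_sum g n (\<lambda>i. max (x i) b))"
      by (simp flip: ennreal_plus add: ennreal_leI)
    also have "\<dots> \<le> tv g a b + tv g b c"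
      by (intro add_mono chain_sum_le_tv 1)
    finally show "ennreal (chain_sum g n x) \<le> tv g a b + tv g b c" .
  qed
  have "ennreal (chain_sum g n x) + tv g b c \<le> tv g a c" if x: "(n, x) \<in> chains_between a b" for n x
  proof -
    have "ennreal (chain_sum g n x) + tv g b c
        = (SUP p \<in> chains_between b c. ennreal (chain_sum g n x) + ennreal (chain_sum g (fst p) (snd p)))"
      unfolding tv_def case_prod_beta
      by (rule ennreal_SUP_add_right) (rule chains_between_nonempty[OF assms(2)])
    also have "\<dots> \<le> tv g a c"
    proof (rule SUP_least)
      fix p assume p: "p \<in> chains_between b c"
      obtain m y where py: "p = (m, y)" by (cases p)
      obtain z where "(n + m, z) \<in> chains_between a c"
          "chain_sum g (n + m) z = chain_sum g n x + chain_sum g m y"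
        using chain_append[OF x p[unfolded py]] by blast
      with chain_sum_le_tv[of "n + m" z a c g] py
      show "ennreal (chain_sum g n x) + ennreal (chain_sum g (fst p) (snd p)) \<le> tv g a c"
        by simp
    qed
    finally show ?thesis .
  qed
  then have "(SUP p \<in> chains_between a b. ennreal (chain_sum g (fst p) (snd p)) + tv g b c) \<le> tv g a c"
    by (intro SUP_least) auto
  then show "tv g a b + tv g b c \<le> tv g a c"
    unfolding tv_def[of g a b] case_prod_beta
    by (subst (asm) ennreal_SUP_add_left[OF chains_between_nonempty[OF assms(1)]])
qed

lemma tv_mono_interval:
  assumes "a \<le> c" "c \<le> d" "d \<le> b"
  shows "tv g c d \<le> tv g a b"
  using tv_add[of a c b g] tv_add[of c d b g] assms
  by (metis add_increasing add_increasing2 dual_order.trans order_refl zero_le)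

text \<open>Applied to the translated function with \<open>- s\<close>, the same inequality becomes
  its own converse.\<close>

lemma tv_shift_le: "tv g (a + s) (b + s) \<le> tv (\<lambda>t. g (t + s)) a b"
proof (rule tv_least)
  fix n x assume "(n, x) \<in> chains_between (a + s) (b + s)"
  then have "(n, \<lambda>i. x i - s) \<in> chains_between a b"
    by (auto simp: chains_between_def)
  from chain_sum_le_tv[OF this, of "\<lambda>t. g (t + s)"]
  show "ennreal (chain_sum g n x) \<le> tv (\<lambda>t. g (t + s)) a b"
    by (simp add: chain_sum_def)
qed

lemma tv_shift: "tv (\<lambda>t. g (t + s)) a b = tv g (a + s) (b + s)"
  using tv_shift_le[of g a s b] tv_shift_le[of "\<lambda>t. g (t + s)" "a + s" "- s" "b + s"]
  by simp

lemma tv_cong: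
  assumes "\<And>t. t \<in> {a..b} \<Longrightarrow> f t = g t"
  shows "tv f a b = tv g a b"
proof -
  have "chain_sum f n x = chain_sum g n x" if "(n, x) \<in> chains_between a b" for n x
    using that assms chain_bounds[OF that] by (auto simp: chain_sum_def intro!: sum.cong)
  then show ?thesis
    unfolding tv_def by (intro SUP_cong) auto
qed

lemma tv_triangle: "tv (\<lambda>t. f t + g t) a b \<le> tv f a b + tv g a b"
proof (rule tv_least)
  fix n x assume nx: "(n, x) \<in> chains_between a b"
  have "chain_sum (\<lambda>t. f t + g t) n x \<le> chain_sum f n x + chain_sum g n x"
    unfolding chain_sum_def sum.distrib[symmetric] by (rule sum_mono) auto
  then have "ennreal (chain_sum (\<lambda>t. f t + g t) n x)
      \<le> ennreal (chain_sum f n x) + ennreal (chain_sum g n x)"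
    by (simp flip: ennreal_plus add: ennreal_leI)
  also have "\<dots> \<le> tv f a b + tv g a b"
    by (intro add_mono chain_sum_le_tv nx)
  finally show "ennreal (chain_sum (\<lambda>t. f t + g t) n x) \<le> tv f a b + tv g a b" .
qed

lemma tv_scale: "tv (\<lambda>t. c * g t) a b = ennreal \<bar>c\<bar> * tv g a b"
proof -
  have "chain_sum (\<lambda>t. c * g t) n x = \<bar>c\<bar> * chain_sum g n x" for n x
    by (simp add: chain_sum_def sum_distrib_left abs_mult flip: right_diff_distrib)
  then show ?thesis
    by (simp add: tv_def SUP_mult_left_ennreal case_prod_beta ennreal_mult)
qed

lemma tv_minus: "tv (\<lambda>t. - g t) a b = tv g a b"
  using tv_scale[of "-1" g a b] by simp

lemma tv_diff: "tv (\<lambda>t. f t - g t) a b \<le> tv f a b + tv g a b"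
  using tv_triangle[of f "\<lambda>t. - g t" a b] by (simp add: tv_minus)

lemma tv_add_const: "tv (\<lambda>t. g t + c) a b = tv g a b"
  by (simp add: tv_def chain_sum_def)

lemma tv_const [simp]: "tv (\<lambda>t. c) a b = 0"
proof -
  have "tv (\<lambda>t. c) a b \<le> 0"
    by (rule tv_least) (simp add: chain_sum_def)
  then show ?thesis by simp
qed

lemma tv_mono_on:
  assumes "mono_on {a..b} g"
  shows "tv g a b \<le> ennreal (g b - g a)"
proof (rule tv_least)
  fix n x assume nx: "(n, x) \<in> chains_between a b"
  have "g (x i) \<le> g (x (Suc i))" if "i < n" for i
    using that nx chain_bounds[OF nx, of i] chain_bounds[OF nx, of "Suc i"]
    by (intro mono_onD[OF assms]) (auto simp: chains_between_def)
  then have "chain_sum g n x = (\<Sum>i<n. g (x (Suc i)) - g (x i))"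
    unfolding chain_sum_def by (intro sum.cong) auto
  also have "\<dots> = g (x n) - g (x 0)"
    by (rule sum_lessThan_telescope)
  finally show "ennreal (chain_sum g n x) \<le> ennreal (g b - g a)"
    using nx by (simp add: chains_between_def)
qed

lemma tv_lipschitz:
  assumes "0 \<le> L" "\<And>s t. s \<in> {a..b} \<Longrightarrow> t \<in> {a..b} \<Longrightarrow> \<bar>g t - g s\<bar> \<le> L * \<bar>t - s\<bar>"
  shows "tv g a b \<le> ennreal (L * (b - a))"
proof (rule tv_least)
  fix n x assume nx: "(n, x) \<in> chains_between a b"
  have "chain_sum g n x \<le> (\<Sum>i<n. L * (x (Suc i) - x i))"
    unfolding chain_sum_def
  proof (rule sum_mono)
    fix i assume i: "i \<in> {..<n}"
    then have "x i \<le> x (Suc i)" using nx by (auto simp: chains_between_def)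
    moreover have "\<bar>g (x (Suc i)) - g (x i)\<bar> \<le> L * \<bar>x (Suc i) - x i\<bar>"
      using i chain_bounds[OF nx, of i] chain_bounds[OF nx, of "Suc i"] by (intro assms) auto
    ultimately show "\<bar>g (x (Suc i)) - g (x i)\<bar> \<le> L * (x (Suc i) - x i)" by simp
  qed
  also have "\<dots> = L * (b - a)"
    using nx by (simp add: chains_between_def flip: sum_distrib_left) (simp add: sum_lessThan_telescope)
  finally show "ennreal (chain_sum g n x) \<le> ennreal (L * (b - a))"
    by (rule ennreal_leI)
qed

text \<open>For a fixed chain the sum is finite and passes to the pointwise limit; the supremum is
  taken only afterwards. Completeness of \<open>NBV\<close> rests on this.\<close>

lemma tv_lower_semicontinuous:
  assumes F: "F \<noteq> bot" and lim: "\<And>t. t \<in> {a..b} \<Longrightarrow> ((\<lambda>k. f k t) \<longlongrightarrow> g t) F"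
    and le: "\<forall>\<^sub>F k in F. tv (f k) a b \<le> B"
  shows "tv g a b \<le> B"
proof (rule tv_least)
  fix n x assume nx: "(n, x) \<in> chains_between a b"
  have "((\<lambda>k. chain_sum (f k) n x) \<longlongrightarrow> chain_sum g n x) F"
    unfolding chain_sum_def using chain_bounds[OF nx]
    by (intro tendsto_sum tendsto_rabs tendsto_diff lim) auto
  then have "((\<lambda>k. ennreal (chain_sum (f k) n x)) \<longlongrightarrow> ennreal (chain_sum g n x)) F"
    by (rule tendsto_ennrealI)
  moreover have "\<forall>\<^sub>F k in F. ennreal (chain_sum (f k) n x) \<le> B"
    using le by eventually_elim (use chain_sum_le_tv[OF nx] order_trans in blast)
  ultimately show "ennreal (chain_sum g n x) \<le> B"
    using F tendsto_upperbound by blast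
qed

text \<open>Jordan decomposition, with \<open>p\<close> the variation counted from \<open>a\<close>.
  The exact formula for the increments of \<open>p\<close> is kept because it later carries a
  Lipschitz bound over from \<open>g\<close> to \<open>p\<close>; the bounds on \<open>p\<close>
  become the uniform bounds for Helly's theorem.\<close>

lemma bv_decomposition:
  assumes fin: "tv g a b < \<infinity>"
  obtains p where "mono_on {a..b} p" "mono_on {a..b} (\<lambda>t. p t - g t)"
    "\<And>s t. a \<le> s \<Longrightarrow> s \<le> t \<Longrightarrow> t \<le> b \<Longrightarrow> p t - p s = enn2real (tv g s t)"
    "\<And>t. t \<in> {a..b} \<Longrightarrow> 0 \<le> p t \<and> p t \<le> enn2real (tv g a b)"
proof -
  define p where "p = (\<lambda>t. enn2real (tv g a t))"
  have tvfin: "tv g s t < \<infinity>" if "a \<le> s" "s \<le> t" "t \<le> b" for s t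
    using tv_mono_interval[OF that, of g] fin by (rule le_less_trans)
  have diff: "p t - p s = enn2real (tv g s t)" if "a \<le> s" "s \<le> t" "t \<le> b" for s t
    using tv_add[of a s t g] that tvfin[of a s] tvfin[of s t]
    by (simp add: p_def enn2real_plus)
  show ?thesis
  proof (rule that[of p])
    show "mono_on {a..b} p"
      using diff by (intro mono_onI) (smt (verit) atLeastAtMost_iff enn2real_nonneg)
    show "mono_on {a..b} (\<lambda>t. p t - g t)"
    proof (rule mono_onI)
      fix s t assume st: "s \<in> {a..b}" "t \<in> {a..b}" "s \<le> t"
      have "ennreal \<bar>g t - g s\<bar> \<le> tv g s t" by (rule abs_diff_le_tv) fact
      then have "\<bar>g t - g s\<bar> \<le> enn2real (tv g s t)"
        using tvfin[of s t] st enn2real_mono by fastforce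
      then show "p s - g s \<le> p t - g t"
        using diff[of s t] st by auto
    qed
    show "0 \<le> p t \<and> p t \<le> enn2real (tv g a b)" if "t \<in> {a..b}" for t
      using that fin tv_mono_interval[of a a t b g] by (auto simp: p_def intro!: enn2real_mono)
  qed (use diff in auto)
qed

section \<open>Periodic functions and the choice of the period interval\<close>

lemma periodic2pi_add_int:
  assumes "periodic2pi g"
  shows "g (t + 2 * pi * of_int k) = g t"
proof -
  have nat: "g (t + 2 * pi * real n) = g t" for n t
  proof (induction n)
    case (Suc n)
    have "g (t + 2 * pi * real (Suc n)) = g ((t + 2 * pi * real n) + 2 * pi)"
      by (simp add: algebra_simps)
    then show ?case using assms Suc by (simp add: periodic2pi_def)
  qed simp
  show ?thesis
  proof (cases "0 \<le> k")
    case True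
    then show ?thesis using nat[of t "nat k"] by simp
  next
    case False
    then show ?thesis using nat[of "t + 2 * pi * of_int k" "nat (- k)"] by simp
  qed
qed

lemma reduce_mod_2pi:
  obtains k :: int where "c \<le> t + 2 * pi * of_int k" "t + 2 * pi * of_int k < c + 2 * pi"
proof
  define k where "k = - \<lfloor>(t - c) / (2 * pi)\<rfloor>"
  have "of_int (- k) \<le> (t - c) / (2 * pi)" "(t - c) / (2 * pi) < of_int (- k) + 1"
    unfolding k_def by linarith+
  then show "c \<le> t + 2 * pi * of_int k" "t + 2 * pi * of_int k < c + 2 * pi"
    by (simp_all add: field_simps)
qed

text \<open>Modulo a period the shift is some \<open>r\<close> in \<open>[0, 2 * pi)\<close>. The
  interval from \<open>- pi + r\<close> to \<open>pi + r\<close> is cut at \<open>pi\<close>, and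
  the piece beyond \<open>pi\<close> is moved back by a period to complete
  \<open>{- pi..pi}\<close>.\<close>

lemma variation_shift:
  assumes "periodic2pi g"
  shows "variation (\<lambda>t. g (t + s)) = variation g"
proof -
  obtain k :: int where k: "0 \<le> s + 2 * pi * of_int k" "s + 2 * pi * of_int k < 0 + 2 * pi"
    by (rule reduce_mod_2pi)
  define r where "r = s + 2 * pi * of_int k"
  have "g (t + s) = g (t + r)" for t
    using periodic2pi_add_int[OF assms, of "t + s" k] by (simp add: r_def add.assoc)
  then have "variation (\<lambda>t. g (t + s)) = tv g (- pi + r) (pi + r)"
    by (simp add: variation_eq_tv tv_shift)
  also have "\<dots> = tv g (- pi + r) pi + tv g pi (pi + r)"
    using k by (intro tv_add) (auto simp: r_def)
  also have "tv g pi (pi + r) = tv (\<lambda>t. g (t + 2 * pi)) (- pi) (- pi + r)"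
    by (simp add: tv_shift)
  also have "(\<lambda>t. g (t + 2 * pi)) = g"
    using assms by (auto simp: periodic2pi_def)
  also have "tv g (- pi + r) pi + tv g (- pi) (- pi + r) = tv g (- pi) pi"
    using tv_add[of "- pi" "- pi + r" pi g] k by (simp add: r_def add.commute)
  finally show ?thesis by (simp add: variation_eq_tv)
qed

text \<open>The points are arbitrary reals: \<open>s\<close> is moved by periods into the window of
  length \<open>2 * pi\<close> starting at \<open>t\<close>, and the variation over that window is
  again \<open>variation g\<close>.\<close>

lemma abs_diff_le_variation:
  assumes "periodic2pi g"
  shows "ennreal \<bar>g s - g t\<bar> \<le> variation g"
proof -
  obtain k :: int where k: "t \<le> s + 2 * pi * of_int k" "s + 2 * pi * of_int k < t + 2 * pi"
    by (rule reduce_mod_2pi)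
  define u where "u = s + 2 * pi * of_int k"
  have "ennreal \<bar>g s - g t\<bar> = ennreal \<bar>g u - g t\<bar>"
    unfolding u_def by (simp add: periodic2pi_add_int[OF assms])
  also have "\<dots> \<le> tv g t u"
    using k by (intro abs_diff_le_tv) (simp add: u_def)
  also have "\<dots> \<le> tv g t (t + 2 * pi)"
    using k by (intro tv_mono_interval) (auto simp: u_def)
  also have "\<dots> = variation (\<lambda>x. g (x + (t + pi)))"
    by (simp add: variation_eq_tv tv_shift add.commute)
  finally show ?thesis using variation_shift[OF assms] by (simp add: add.commute)
qed


subsection \<open>Harmonic functions on the disc\<close>

text \<open>The mean value theorem is used in direction \<open>a\<close> and then in direction
  \<open>b\<close>. The left side is symmetric in the two vectors while the right side
  differentiates in the order \<open>a\<close>, \<open>b\<close>; exchanging the vectors therefore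
  compares the two mixed derivatives.\<close>

lemma second_difference_mvt:
  fixes u :: "complex \<Rightarrow> real"
  assumes u: "\<And>w. w \<in> ball z e \<Longrightarrow> (u has_derivative D w) (at w)"
    and D: "\<And>w. w \<in> ball z e \<Longrightarrow> ((\<lambda>w. D w a) has_derivative E w) (at w)"
    and h: "0 < h" "h * (norm a + norm b) < e"
  shows "\<exists>s t. 0 < s \<and> s < h \<and> 0 < t \<and> t < h \<and>
    u (z + h *\<^sub>R a + h *\<^sub>R b) - u (z + h *\<^sub>R a) - u (z + h *\<^sub>R b) + u z
      = h * h * E (z + s *\<^sub>R a + t *\<^sub>R b) b"
proof -
  have inball: "z + s *\<^sub>R a + t *\<^sub>R b \<in> ball z e" if "0 \<le> s" "s \<le> h" "0 \<le> t" "t \<le> h" for s t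
  proof -
    have "norm (s *\<^sub>R a + t *\<^sub>R b) \<le> s * norm a + t * norm b"
      using that norm_triangle_ineq[of "s *\<^sub>R a" "t *\<^sub>R b"] by simp
    also have "\<dots> \<le> h * norm a + h * norm b"
      using that by (intro add_mono mult_right_mono) auto
    finally have "norm (s *\<^sub>R a + t *\<^sub>R b) < e" using h by (simp add: distrib_left)
    moreover have "dist z (z + s *\<^sub>R a + t *\<^sub>R b) = norm (s *\<^sub>R a + t *\<^sub>R b)"
      unfolding dist_norm by (subst norm_minus_commute) (simp add: add.assoc)
    ultimately show ?thesis by simp
  qed
  have du: "((\<lambda>s. u (z + s *\<^sub>R a + t *\<^sub>R b)) has_real_derivative D (z + s *\<^sub>R a + t *\<^sub>R b) a) (at s)"
    if "0 \<le> s" "s \<le> h" "0 \<le> t" "t \<le> h" for s t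
  proof -
    note u' = u[OF inball[OF that]]
    have "((\<lambda>s. u (z + s *\<^sub>R a + t *\<^sub>R b)) has_derivative
        (\<lambda>k. D (z + s *\<^sub>R a + t *\<^sub>R b) (k *\<^sub>R a))) (at s)"
      by (rule has_derivative_compose[where f = "\<lambda>s. z + s *\<^sub>R a + t *\<^sub>R b" and g = u and g' = "D (z + s *\<^sub>R a + t *\<^sub>R b)" and f' = "\<lambda>k. k *\<^sub>R a", OF _ u']) (auto intro!: derivative_eq_intros)
    then show ?thesis
      using linear_scale[OF has_derivative_linear[OF u']]
      by (simp add: has_field_derivative_def mult.commute[of _ "D _ _"])
  qed
  have dD: "((\<lambda>t. D (z + s *\<^sub>R a + t *\<^sub>R b) a) has_real_derivative E (z + s *\<^sub>R a + t *\<^sub>R b) b) (at t)"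
    if "0 \<le> s" "s \<le> h" "0 \<le> t" "t \<le> h" for s t
  proof -
    note D' = D[OF inball[OF that]]
    have "((\<lambda>t. D (z + s *\<^sub>R a + t *\<^sub>R b) a) has_derivative
        (\<lambda>k. E (z + s *\<^sub>R a + t *\<^sub>R b) (k *\<^sub>R b))) (at t)"
      by (rule has_derivative_compose[where f = "\<lambda>t. z + s *\<^sub>R a + t *\<^sub>R b" and g = "\<lambda>w. D w a" and g' = "E (z + s *\<^sub>R a + t *\<^sub>R b)" and f' = "\<lambda>k. k *\<^sub>R b", OF _ D']) (auto intro!: derivative_eq_intros)
    then show ?thesis
      using linear_scale[OF has_derivative_linear[OF D']]
      by (simp add: has_field_derivative_def mult.commute[of _ "E _ _"])
  qed
  define \<phi> where "\<phi> = (\<lambda>s. u (z + s *\<^sub>R a + h *\<^sub>R b) - u (z + s *\<^sub>R a))"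
  have d\<phi>: "(\<phi> has_real_derivative D (z + s *\<^sub>R a + h *\<^sub>R b) a - D (z + s *\<^sub>R a) a) (at s)"
    if "0 \<le> s" "s \<le> h" for s
    unfolding \<phi>_def using du[of s h] du[of s 0] that h
    by (intro DERIV_diff) auto
  obtain s where s: "0 < s" "s < h"
    "\<phi> h - \<phi> 0 = (h - 0) * (D (z + s *\<^sub>R a + h *\<^sub>R b) a - D (z + s *\<^sub>R a) a)"
    using MVT2[OF h(1) d\<phi>] by blast
  obtain t where t: "0 < t" "t < h"
    "D (z + s *\<^sub>R a + h *\<^sub>R b) a - D (z + s *\<^sub>R a + 0 *\<^sub>R b) a = (h - 0) * E (z + s *\<^sub>R a + t *\<^sub>R b) b"
    using MVT2[OF h(1) dD[OF less_imp_le less_imp_le, OF s(1,2)]] by blast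
  show ?thesis
    by (rule exI[of _ s], rule exI[of _ t]) (use s t in \<open>simp add: \<phi>_def algebra_simps\<close>)
qed

text \<open>Schwarz's theorem. One and the same second difference equals \<open>h * h\<close> times
  a value of \<open>uxy\<close> and \<open>h * h\<close> times a value of \<open>uyx\<close> near
  \<open>z\<close>; by continuity this is impossible if the two functions differ at
  \<open>z\<close>.\<close>

lemma mixed_partials_eq:
  fixes u :: "complex \<Rightarrow> real"
  assumes S: "open S" "z \<in> S"
    and u: "\<And>w. w \<in> S \<Longrightarrow> (u has_derivative (\<lambda>h. ux w * Re h + uy w * Im h)) (at w)"
    and ux: "\<And>w. w \<in> S \<Longrightarrow> (ux has_derivative (\<lambda>h. uxx w * Re h + uxy w * Im h)) (at w)"
    and uy: "\<And>w. w \<in> S \<Longrightarrow> (uy has_derivative (\<lambda>h. uyx w * Re h + uyy w * Im h)) (at w)"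
    and cont: "continuous_on S uxy" "continuous_on S uyx"
  shows "uxy z = uyx z"
proof (rule ccontr)
  assume "uxy z \<noteq> uyx z"
  define d where "d = \<bar>uxy z - uyx z\<bar> / 2"
  have "d > 0" using \<open>uxy z \<noteq> uyx z\<close> by (simp add: d_def)
  have "isCont uxy z" "isCont uyx z"
    using cont S continuous_on_eq_continuous_at by blast+
  obtain e1 where e1: "e1 > 0" "\<And>w. dist w z < e1 \<Longrightarrow> \<bar>uxy w - uxy z\<bar> < d"
    using \<open>isCont uxy z\<close> \<open>d > 0\<close> unfolding continuous_at_eps_delta by (auto simp: dist_real_def)
  obtain e2 where e2: "e2 > 0" "\<And>w. dist w z < e2 \<Longrightarrow> \<bar>uyx w - uyx z\<bar> < d"
    using \<open>isCont uyx z\<close> \<open>d > 0\<close> unfolding continuous_at_eps_delta by (auto simp: dist_real_def)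
  obtain e3 where e3: "e3 > 0" "ball z e3 \<subseteq> S"
    using S openE by blast
  define e where "e = min e1 (min e2 e3)"
  have "e > 0" using e1 e2 e3 by (simp add: e_def)
  \<comment> \<open>The directions \<open>1\<close> and \<open>\<i>\<close> have norm 1, so all
    intermediate points lie within \<open>2 * h < e\<close> of \<open>z\<close>.\<close>
  define h where "h = e / 3"
  have h: "0 < h" "h * (norm (1::complex) + norm \<i>) < e" "h * (norm \<i> + norm (1::complex)) < e"
    using \<open>e > 0\<close> by (auto simp: h_def)
  have sub: "w \<in> S" if "w \<in> ball z e" for w using that e3 by (auto simp: e_def)
  obtain s t where st: "0 < s" "s < h" "0 < t" "t < h"
    "u (z + h *\<^sub>R 1 + h *\<^sub>R \<i>) - u (z + h *\<^sub>R 1) - u (z + h *\<^sub>R \<i>) + u z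
      = h * h * uxy (z + s *\<^sub>R 1 + t *\<^sub>R \<i>)"
    using second_difference_mvt[of z e u "\<lambda>w h. ux w * Re h + uy w * Im h" 1
      "\<lambda>w h. uxx w * Re h + uxy w * Im h" h \<i>] u ux sub h by auto
  obtain s' t' where st': "0 < s'" "s' < h" "0 < t'" "t' < h"
    "u (z + h *\<^sub>R \<i> + h *\<^sub>R 1) - u (z + h *\<^sub>R \<i>) - u (z + h *\<^sub>R 1) + u z
      = h * h * uyx (z + s' *\<^sub>R \<i> + t' *\<^sub>R 1)"
    using second_difference_mvt[of z e u "\<lambda>w h. ux w * Re h + uy w * Im h" \<i>
      "\<lambda>w h. uyx w * Re h + uyy w * Im h" h 1] u uy sub h by auto
  have com: "z + h *\<^sub>R \<i> + h *\<^sub>R 1 = z + h *\<^sub>R 1 + h *\<^sub>R \<i>" by simp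
  have "h * h * uxy (z + s *\<^sub>R 1 + t *\<^sub>R \<i>) = h * h * uyx (z + s' *\<^sub>R \<i> + t' *\<^sub>R 1)"
    using st(5) st'(5) unfolding com by linarith
  then have eq: "uxy (z + s *\<^sub>R 1 + t *\<^sub>R \<i>) = uyx (z + s' *\<^sub>R \<i> + t' *\<^sub>R 1)"
    using h(1) by (metis mult_cancel_left mult_eq_0_iff less_irrefl)
  have dist1: "dist (z + p *\<^sub>R 1 + q *\<^sub>R \<i>) z < e" if "0 < p" "p < h" "0 < q" "q < h" for p q
  proof -
    have "dist (z + p *\<^sub>R 1 + q *\<^sub>R \<i>) z = norm (p *\<^sub>R 1 + q *\<^sub>R \<i>)"
      by (simp add: dist_norm add.assoc)
    also have "\<dots> \<le> p + q" using that norm_triangle_ineq[of "p *\<^sub>R 1" "q *\<^sub>R \<i>"] by simp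
    also have "\<dots> < e" using that \<open>e > 0\<close> by (simp add: h_def)
    finally show ?thesis .
  qed
  have "\<bar>uxy (z + s *\<^sub>R 1 + t *\<^sub>R \<i>) - uxy z\<bar> < d"
    using dist1[OF st(1-4)] by (intro e1) (simp add: e_def)
  moreover have "\<bar>uyx (z + s' *\<^sub>R \<i> + t' *\<^sub>R 1) - uyx z\<bar> < d"
    using dist1[OF st'(3,4) st'(1,2)] by (intro e2) (simp add: e_def algebra_simps)
  moreover have "\<bar>uxy z - uyx z\<bar> \<le> \<bar>uxy (z + s *\<^sub>R 1 + t *\<^sub>R \<i>) - uxy z\<bar>
      + \<bar>uyx (z + s' *\<^sub>R \<i> + t' *\<^sub>R 1) - uyx z\<bar>"
    using eq by linarith
  ultimately show False by (simp add: d_def)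
qed

text \<open>By the Cauchy-Riemann equations the partial derivatives of \<open>Re F\<close> are
  \<open>Re F'\<close> and \<open>- Im F'\<close>. The same rule for \<open>F'\<close> gives the
  second order witnesses, and the Laplacian is \<open>Re F'' - Re F''\<close>.\<close>

lemma harmonic_on_Re_holomorphic:
  assumes "open S" "F holomorphic_on S" "\<And>z. z \<in> S \<Longrightarrow> u z = Re (F z)"
  shows "harmonic_on u S"
proof -
  let ?F1 = "deriv F" and ?F2 = "deriv (deriv F)"
  have h1: "?F1 holomorphic_on S" "?F2 holomorphic_on S"
    using assms holomorphic_deriv by blast+
  have d0: "(F has_derivative (\<lambda>h. ?F1 z * h)) (at z)" if "z \<in> S" for z
    using holomorphic_derivI[OF assms(2,1) that] by (simp add: has_field_derivative_def)
  have d1: "(?F1 has_derivative (\<lambda>h. ?F2 z * h)) (at z)" if "z \<in> S" for z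
    using holomorphic_derivI[OF h1(1) assms(1) that] by (simp add: has_field_derivative_def)
  have c: "continuous_on S ?F2" by (rule holomorphic_on_imp_continuous_on) fact
  have "(u has_derivative (\<lambda>h. Re (?F1 z) * Re h + (- Im (?F1 z)) * Im h)) (at z)" if "z \<in> S" for z
  proof (rule has_derivative_transform_within_open[OF _ assms(1) that])
    show "((\<lambda>z. Re (F z)) has_derivative (\<lambda>h. Re (?F1 z) * Re h + (- Im (?F1 z)) * Im h)) (at z)"
      using has_derivative_Re[OF d0[OF that]] by simp
  qed (use assms in auto)
  moreover have "((\<lambda>z. Re (?F1 z)) has_derivative (\<lambda>h. Re (?F2 z) * Re h + (- Im (?F2 z)) * Im h)) (at z)"
    if "z \<in> S" for z
    using has_derivative_Re[OF d1[OF that]] by simp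
  moreover have "((\<lambda>z. - Im (?F1 z)) has_derivative (\<lambda>h. (- Im (?F2 z)) * Re h + (- Re (?F2 z)) * Im h)) (at z)"
    if "z \<in> S" for z
    using has_derivative_minus[OF has_derivative_Im[OF d1[OF that]]] by (simp add: algebra_simps)
  ultimately show ?thesis
    unfolding harmonic_on_def using c
    by (rule_tac x = "\<lambda>z. Re (?F1 z)" in exI, rule_tac x = "\<lambda>z. - Im (?F1 z)" in exI,
        rule_tac x = "\<lambda>z. Re (?F2 z)" in exI, rule_tac x = "\<lambda>z. - Im (?F2 z)" in exI,
        rule_tac x = "\<lambda>z. - Im (?F2 z)" in exI, rule_tac x = "\<lambda>z. - Re (?F2 z)" in exI)
      (intro conjI ballI continuous_on_Re continuous_on_minus continuous_on_Im; (assumption | simp))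
qed

text \<open>If \<open>u = Re F\<close>, then \<open>F'\<close> must be
  \<open>ux - \<i> * uy\<close>, which is \<open>f\<close>. Laplace's equation and the symmetry of
  the second derivatives are the Cauchy-Riemann equations for \<open>f\<close>; convexity gives a
  primitive, whose real part has the gradient of \<open>u\<close> and so differs from it by a
  constant.\<close>

lemma harmonic_on_imp_Re_holomorphic:
  assumes S: "open S" "convex S" and harm: "harmonic_on u S"
  obtains F where "F holomorphic_on S" "\<And>z. z \<in> S \<Longrightarrow> u z = Re (F z)"
proof -
  obtain ux uy uxx uxy uyx uyy where
    u: "\<And>w. w \<in> S \<Longrightarrow> (u has_derivative (\<lambda>h. ux w * Re h + uy w * Im h)) (at w)"
    and ux: "\<And>w. w \<in> S \<Longrightarrow> (ux has_derivative (\<lambda>h. uxx w * Re h + uxy w * Im h)) (at w)"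
    and uy: "\<And>w. w \<in> S \<Longrightarrow> (uy has_derivative (\<lambda>h. uyx w * Re h + uyy w * Im h)) (at w)"
    and cont: "continuous_on S uxy" "continuous_on S uyx"
    and lap: "\<And>w. w \<in> S \<Longrightarrow> uxx w + uyy w = 0"
    using harm unfolding harmonic_on_def by blast
  define f where "f = (\<lambda>z. of_real (ux z) - \<i> * of_real (uy z))"
  have f': "(f has_field_derivative (of_real (uxx z) - \<i> * of_real (uyx z))) (at z)" if z: "z \<in> S" for z
  proof -
    have sym: "uxy z = uyx z" by (rule mixed_partials_eq[OF S(1) z u ux uy cont])
    have "(f has_derivative (\<lambda>h. of_real (uxx z * Re h + uxy z * Im h)
        - \<i> * of_real (uyx z * Re h + uyy z * Im h))) (at z)"
      unfolding f_def
      by (intro has_derivative_diff has_derivative_mult_right has_derivative_of_real ux uy z)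
    moreover have "(\<lambda>h. of_real (uxx z * Re h + uxy z * Im h) - \<i> * of_real (uyx z * Re h + uyy z * Im h))
        = (*) (of_real (uxx z) - \<i> * of_real (uyx z))"
    proof
      fix h
      have "uyy z = - uxx z" using lap[OF z] by linarith
      then show "of_real (uxx z * Re h + uxy z * Im h) - \<i> * of_real (uyx z * Re h + uyy z * Im h)
        = (of_real (uxx z) - \<i> * of_real (uyx z)) * h"
        by (simp add: complex_eq_iff sym)
    qed
    ultimately show ?thesis by (simp add: has_field_derivative_def)
  qed
  then have "f holomorphic_on S"
    using S(1) by (auto simp: holomorphic_on_open)
  then obtain F where F: "\<And>z. z \<in> S \<Longrightarrow> (F has_field_derivative f z) (at z within S)"
    using holomorphic_convex_primitive'[OF S(2,1)] by blast
  have F': "(F has_field_derivative f z) (at z)" if "z \<in> S" for z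
    using F[OF that] at_within_open[OF that S(1)] by simp
  have zero: "((\<lambda>z. u z - Re (F z)) has_derivative (\<lambda>h. 0)) (at z within S)" if z: "z \<in> S" for z
  proof -
    have "((\<lambda>z. u z - Re (F z)) has_derivative
        (\<lambda>h. (ux z * Re h + uy z * Im h) - Re (f z * h))) (at z)"
      using u[OF z] F'[OF z] by (intro has_derivative_diff has_derivative_Re)
        (auto simp: has_field_derivative_def)
    moreover have "(\<lambda>h. (ux z * Re h + uy z * Im h) - Re (f z * h)) = (\<lambda>h. 0)"
      by (auto simp: f_def)
    ultimately show ?thesis by (simp add: has_derivative_at_withinI)
  qed
  obtain c where c: "\<And>z. z \<in> S \<Longrightarrow> u z - Re (F z) = c"
    using has_derivative_zero_constant[OF S(2) zero] by blast
  show ?thesis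
  proof (rule that[of "\<lambda>z. F z + of_real c"])
    show "(\<lambda>z. F z + of_real c) holomorphic_on S"
      using F by (intro holomorphic_intros) (auto simp: holomorphic_on_def field_differentiable_def)
    show "u z = Re (F z + of_real c)" if "z \<in> S" for z
      using c[OF that] by simp
  qed
qed

section \<open>The Poisson kernel and the Poisson formula\<close>

lemma norm_cis_diff_square:
  "(cmod (cis \<phi> - z))\<^sup>2 = 1 - 2 * cmod z * cos (\<phi> - Arg z) + (cmod z)\<^sup>2"
proof -
  have "z = rcis (cmod z) (Arg z)" by (simp add: rcis_cmod_Arg)
  then have z: "Re z = cmod z * cos (Arg z)" "Im z = cmod z * sin (Arg z)"
    by (metis Re_rcis, metis Im_rcis)
  have *: "(cos \<phi> - r * cos a)\<^sup>2 + (sin \<phi> - r * sin a)\<^sup>2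
      = 1 - 2 * r * cos (\<phi> - a) + r\<^sup>2" for r a :: real
    using sin_cos_squared_add[of \<phi>] sin_cos_squared_add[of a] unfolding cos_diff by algebra
  show ?thesis
    using *[of "cmod z" "Arg z"] z by (simp add: cmod_power2)
qed

lemma poisson_kernel_cmod_Arg:
  "poisson_kernel (cmod z) (\<phi> - Arg z) = (1 - (cmod z)\<^sup>2) / (2 * pi * (cmod (cis \<phi> - z))\<^sup>2)"
  by (simp add: poisson_kernel_def norm_cis_diff_square)

lemma cis_ne_of_cmod_less_1: "cmod z < 1 \<Longrightarrow> cis \<phi> \<noteq> z"
  using norm_cis[of \<phi>] by auto

text \<open>With \<open>w = cis \<phi>\<close> the bracket is the Schwarz kernel
  \<open>(w + z) / (w - z)\<close>. Writing it through \<open>1 / (1 - z * cis (- \<phi>))\<close>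
  prepares the expansion into a geometric series in \<open>z\<close>.\<close>

lemma poisson_kernel_eq_Re:
  assumes "cmod z < 1"
  shows "poisson_kernel (cmod z) (\<phi> - Arg z) = Re ((2 / (1 - z * cis (- \<phi>)) - 1) / (2 * pi))"
proof -
  let ?w = "cis \<phi>"
  have ne: "?w - z \<noteq> 0" using cis_ne_of_cmod_less_1[OF assms] by auto
  have "2 / (1 - z * cis (- \<phi>)) - 1 = 2 * ?w / (?w - z) - 1"
  proof -
    have "?w * (1 - z * cis (- \<phi>)) = ?w - z"
      by (simp add: algebra_simps cis_mult flip: mult.assoc)
    then show ?thesis using ne
      by (metis (no_types, lifting) cis_neq_zero mult_divide_mult_cancel_left mult.commute)
  qed
  also have "\<dots> = (?w + z) / (?w - z)"
    using ne by (simp add: field_simps)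
  also have "\<dots> = (?w + z) * cnj (?w - z) / of_real ((cmod (?w - z))\<^sup>2)"
    using ne by (subst complex_div_cnj) simp
  finally have "Re (2 / (1 - z * cis (- \<phi>)) - 1) = Re ((?w + z) * cnj (?w - z)) / (cmod (?w - z))\<^sup>2"
    by (simp only: Re_divide_of_real)
  also have "Re ((?w + z) * cnj (?w - z)) = 1 - (cmod z)\<^sup>2"
  proof -
    have "Re ((?w + z) * cnj (?w - z)) = ((cos \<phi>)\<^sup>2 + (sin \<phi>)\<^sup>2) - ((Re z)\<^sup>2 + (Im z)\<^sup>2)"
      by (simp add: algebra_simps power2_eq_square)
    then show ?thesis by (simp add: cmod_power2)
  qed
  finally show ?thesis
    by (simp add: poisson_kernel_cmod_Arg Re_divide_of_real[of _ "2 * pi", simplified] field_simps)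
qed

text \<open>Cauchy's formula for the function \<open>w \<mapsto> F (\<rho> w) (1 - \<bar>z\<bar>\<^sup>2) / (1 - cnj z w)\<close>, which is again
  holomorphic in the disc and takes the value \<open>F (\<rho> z)\<close> at \<open>z\<close>.\<close>

lemma poisson_formula_holomorphic:
  assumes F: "F holomorphic_on ball 0 1" and \<rho>: "0 \<le> \<rho>" "\<rho> < 1" and z: "cmod z < 1"
  shows "((\<lambda>\<phi>. F (rcis \<rho> \<phi>) * of_real (poisson_kernel (cmod z) (\<phi> - Arg z)))
           has_integral F (of_real \<rho> * z)) {- pi..pi}"
proof -
  define G where "G = (\<lambda>w. F (of_real \<rho> * w) * of_real (1 - (cmod z)\<^sup>2) / (1 - cnj z * w))"
  have rho_ball: "of_real \<rho> * w \<in> ball 0 1" if "cmod w \<le> 1" for w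
  proof -
    have "\<rho> * cmod w \<le> \<rho> * 1" using that \<rho> by (intro mult_left_mono)
    then show ?thesis using \<rho> by (simp add: norm_mult)
  qed
  have ne: "1 - cnj z * w \<noteq> 0" if "cmod w \<le> 1" for w
  proof
    assume "1 - cnj z * w = 0"
    then have "cmod (cnj z * w) = 1" by simp
    moreover have "cmod (cnj z * w) \<le> cmod z * 1" 
      unfolding norm_mult complex_mod_cnj using that by (intro mult_left_mono) auto
    ultimately show False using z by simp
  qed
  have "(\<lambda>w. complex_of_real \<rho> * w) ` ball 0 1 \<subseteq> ball 0 1"
    using rho_ball by (metis image_subsetI less_imp_le mem_ball_0)
  then have FG: "(\<lambda>w. F (of_real \<rho> * w)) holomorphic_on ball 0 1"
    using holomorphic_on_compose_gen[OF _ F, of "\<lambda>w. of_real \<rho> * w" "ball 0 1"]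
    by (auto intro!: holomorphic_intros simp: o_def)
  have cF: "continuous_on (cball 0 1) (\<lambda>w. F (of_real \<rho> * w))"
    by (rule continuous_on_compose2[OF holomorphic_on_imp_continuous_on[OF F]])
      (use rho_ball in \<open>auto intro!: continuous_intros\<close>)
  \<comment> \<open>The circle is parametrised over \<open>{0..2 * pi}\<close>, the Poisson integral
    over \<open>{- pi..pi}\<close>. Cauchy's formula for \<open>G (- w)\<close> at the point
    \<open>- z\<close> compensates for moving the parameter by \<open>pi\<close>.\<close>
  have Gneg: "continuous_on (cball 0 1) (\<lambda>w. G (- w))" "(\<lambda>w. G (- w)) holomorphic_on ball 0 1"
  proof -
    have cG: "continuous_on (cball 0 1) G" "G holomorphic_on ball 0 1"
      unfolding G_def using ne cF FG by (auto intro!: continuous_intros holomorphic_intros)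
    show "continuous_on (cball 0 1) (\<lambda>w. G (- w))"
      by (rule continuous_on_compose2[OF cG(1)]) (auto intro!: continuous_intros)
    have "(\<lambda>w. - w) ` ball 0 1 \<subseteq> ball (0::complex) 1" by auto
    then show "(\<lambda>w. G (- w)) holomorphic_on ball 0 1"
      using holomorphic_on_compose_gen[OF holomorphic_on_minus[OF holomorphic_on_ident] cG(2)]
      by (simp add: o_def)
  qed
  have "((\<lambda>w. G (- w) / (w - (- z))) has_contour_integral (2 * of_real pi * \<i> * G (- (- z)))) (circlepath 0 1)"
    by (rule Cauchy_integral_circlepath[OF Gneg]) (use z in simp)
  then have 1: "((\<lambda>t. G (- cis t) / (cis t + z) * \<i> * cis t) has_integral (2 * of_real pi * \<i> * G z)) {0..2 * pi}"
    by (simp add: circlepath_def has_contour_integral_part_circlepath_iff)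
  have "((\<lambda>\<phi>. G (cis \<phi>) / (cis \<phi> - z) * \<i> * cis \<phi>) has_integral (2 * of_real pi * \<i> * G z)) {- pi..pi}"
  proof -
    have "(((\<lambda>t. G (- cis t) / (cis t + z) * \<i> * cis t) \<circ> (+) pi) has_integral (2 * of_real pi * \<i> * G z)) {- pi..pi}"
      using 1 by (subst has_integral_shift_Icc_real) simp
    moreover have "cis (pi + \<phi>) = - cis \<phi>" for \<phi>
      by (simp flip: cis_mult)
    moreover have "G (cis \<phi>) / (- cis \<phi> + z) * \<i> * (- cis \<phi>) = G (cis \<phi>) / (cis \<phi> - z) * \<i> * cis \<phi>" for \<phi>
    proof -
      have "- cis \<phi> + z = - (cis \<phi> - z)" by simp
      then show ?thesis by (metis (no_types, lifting) divide_minus_right minus_mult_minus mult_minus_left)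
    qed
    ultimately show ?thesis by (simp add: o_def)
  qed
  from has_integral_mult_right[OF this, of "inverse (2 * of_real pi * \<i>)"]
  have 2: "((\<lambda>\<phi>. inverse (2 * of_real pi * \<i>) * (G (cis \<phi>) / (cis \<phi> - z) * \<i> * cis \<phi>)) has_integral G z) {- pi..pi}"
    by (simp add: field_simps)
  have Gz: "G z = F (of_real \<rho> * z)"
  proof -
    have "1 - cnj z * z = of_real (1 - (cmod z)\<^sup>2)"
      using complex_norm_square[of z] by (simp add: mult.commute)
    then show ?thesis using ne[of z] z by (simp add: G_def)
  qed
  have "inverse (2 * of_real pi * \<i>) * (G (cis \<phi>) / (cis \<phi> - z) * \<i> * cis \<phi>)
      = F (rcis \<rho> \<phi>) * of_real (poisson_kernel (cmod z) (\<phi> - Arg z))" for \<phi>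
  proof -
    let ?w = "cis \<phi>"
    \<comment> \<open>Replacing 1 by \<open>cnj ?w * ?w\<close> turns the product of the two
      denominators into \<open>?w\<close> times \<open>|?w - z|^2\<close>; this factor
      \<open>?w\<close> cancels the one coming from the derivative of \<open>cis\<close>. What
      remains is the Poisson kernel.\<close>
    have "cnj ?w * ?w = 1" by (simp add: cis_cnj cis_mult)
    then have "(1 - cnj z * ?w) = ?w * cnj (?w - z)" by (simp add: algebra_simps)
    then have "(1 - cnj z * ?w) * (?w - z) = ?w * ((?w - z) * cnj (?w - z))" by simp
    also have "(?w - z) * cnj (?w - z) = of_real ((cmod (?w - z))\<^sup>2)"
      using complex_norm_square[of "?w - z"] by simp
    finally have e: "(1 - cnj z * ?w) * (?w - z) = ?w * of_real ((cmod (?w - z))\<^sup>2)" .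
    have "inverse (2 * of_real pi * \<i>) * (G ?w / (?w - z) * \<i> * ?w)
        = F (of_real \<rho> * ?w) * of_real (1 - (cmod z)\<^sup>2) * ?w / (2 * of_real pi * ((1 - cnj z * ?w) * (?w - z)))"
    proof -
      have "inverse (2 * p * \<i>) * (X / A / B * \<i> * w) = (inverse \<i> * \<i>) * (X * w / (2 * p * (A * B)))"
        for p X A B w :: complex
        by (simp only: divide_inverse inverse_mult_distrib mult_ac)
      moreover have "inverse \<i> * \<i> = 1" by simp
      ultimately show ?thesis unfolding G_def by (simp only: mult_1_left)
    qed
    also have "\<dots> = F (of_real \<rho> * ?w) * of_real (1 - (cmod z)\<^sup>2) / (2 * of_real pi * of_real ((cmod (?w - z))\<^sup>2))"
      unfolding e by simp
    also have "\<dots> = F (of_real \<rho> * ?w) * of_real (poisson_kernel (cmod z) (\<phi> - Arg z))"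
      by (simp add: poisson_kernel_cmod_Arg)
    finally show ?thesis by (simp add: rcis_def)
  qed
  with 2 Gz show ?thesis by simp
qed

text \<open>The dilate of \<open>u\<close> by \<open>\<rho>\<close> is harmonic across the closed
  unit disc, so the boundary behaviour of \<open>u\<close> does not enter. The formula is the real
  part of the one for a holomorphic \<open>F\<close> with \<open>u = Re F\<close>.\<close>

lemma poisson_formula_harmonic:
  assumes u: "harmonic_on u (ball 0 1)" and \<rho>: "0 \<le> \<rho>" "\<rho> < 1" and z: "cmod z < 1"
  shows "poisson (on_circle u \<rho>) z = u (of_real \<rho> * z)"
proof -
  obtain F where F: "F holomorphic_on ball 0 1" "\<And>w. w \<in> ball 0 1 \<Longrightarrow> u w = Re (F w)"
    using harmonic_on_imp_Re_holomorphic[OF open_ball convex_ball u] by blast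
  have "cmod (of_real \<rho> * z) \<le> \<rho> * 1"
    unfolding norm_mult using \<rho> z by (intro mult_mono) auto
  then have "u (of_real \<rho> * z) = Re (F (of_real \<rho> * z))"
    using \<rho> by (intro F) simp
  moreover have "((\<lambda>\<phi>. Re (F (rcis \<rho> \<phi>) * of_real (poisson_kernel (cmod z) (\<phi> - Arg z))))
           has_integral Re (F (of_real \<rho> * z))) {- pi..pi}"
    using has_integral_linear[OF poisson_formula_holomorphic[OF F(1) \<rho> z] bounded_linear_Re]
    by (simp add: o_def)
  moreover have "Re (F (rcis \<rho> \<phi>)) = on_circle u \<rho> \<phi>" for \<phi>
    using \<rho> F(2)[of "rcis \<rho> \<phi>"] by (simp add: on_circle_def)
  ultimately show ?thesis
    by (simp add: poisson_def integral_unique)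
qed

text \<open>This is the Poisson formula for the constant 1 at the real point \<open>r\<close>, whose
  argument is 0.\<close>

lemma has_integral_poisson_kernel:
  assumes "0 \<le> r" "r < 1"
  shows "(poisson_kernel r has_integral 1) {- pi..pi}"
proof -
  have "cmod (of_real r) < 1" using assms by simp
  from poisson_formula_holomorphic[OF holomorphic_on_const[of 1] order_refl zero_less_one this]
  have "((\<lambda>\<phi>. of_real (poisson_kernel (cmod (of_real r)) (\<phi> - Arg (of_real r)))) has_integral (1::complex)) {- pi..pi}"
    by simp
  from has_integral_linear[OF this bounded_linear_Re] show ?thesis
    using assms by (cases "r = 0") (simp_all add: o_def Arg_of_real poisson_kernel_def[abs_def])
qed


subsection \<open>Poisson integrals of functions of bounded variation\<close>

text \<open>With the shift reduced to \<open>r\<close> in \<open>[0, 2 * pi]\<close>, the period is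
  cut at \<open>- pi + r\<close>; the left piece is moved one period to the right and glued to the
  right piece.\<close>

lemma has_integral_periodic_shift:
  assumes "periodic2pi f" and I: "(f has_integral I) {- pi..pi}"
  shows "((\<lambda>t. f (t + s)) has_integral I) {- pi..pi}"
proof -
  obtain k :: int where k: "0 \<le> s + 2 * pi * of_int k" "s + 2 * pi * of_int k < 0 + 2 * pi"
    by (rule reduce_mod_2pi)
  define r where "r = s + 2 * pi * of_int k"
  have r: "0 \<le> r" "r \<le> 2 * pi" using k by (auto simp: r_def)
  have fr: "f (t + s) = f (r + t)" for t
    using periodic2pi_add_int[OF assms(1), of "t + s" k] by (simp add: r_def add_ac)
  have int: "f integrable_on {- pi..pi}" using I by blast
  define J where "J = integral {- pi..- pi + r} f"
  define K where "K = integral {- pi + r..pi} f"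
  have JK: "J + K = I"
    unfolding J_def K_def using Henstock_Kurzweil_Integration.integral_combine[OF _ _ int, of "- pi + r"] r integral_unique[OF I] by simp
  have J: "(f has_integral J) {- pi..- pi + r}" and K: "(f has_integral K) {- pi + r..pi}"
    unfolding J_def K_def
    by (rule integrable_integral, rule integrable_subinterval_real[OF int], use r in auto)+
  have "f \<circ> (+) (2 * pi) = f"
    using assms(1) by (auto simp: periodic2pi_def add.commute)
  then have "(f has_integral J) {- pi + 2 * pi..- pi + r + 2 * pi}"
    using J by (subst has_integral_shift_Icc_real[symmetric]) simp
  then have "(f has_integral J) {pi..pi + r}" by (simp add: algebra_simps)
  then have "(f has_integral (K + J)) {- pi + r..pi + r}"
    using has_integral_combine[OF _ _ K] r by simp
  then have "((f \<circ> (+) r) has_integral I) {- pi..pi}"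
    by (subst has_integral_shift_Icc_real) (use JK in \<open>simp add: add.commute\<close>)
  then show ?thesis by (simp add: o_def fr)
qed

lemma negligible_countable:
  fixes S :: "'a::euclidean_space set"
  assumes "countable S" shows "negligible S"
  by (simp add: negligible_iff_null_sets null_sets_completionI countable_imp_null_set_lborel assms)

text \<open>For a gauge integrable \<open>f\<close>, boundedness of the other factor does not
  suffice. The second mean value theorem yields integrability of the product with a monotone
  function, and \<open>h\<close> is a difference of two such functions.\<close>

lemma bv_mult_integrable:
  assumes fin: "tv h a b < \<infinity>" and f: "f integrable_on {a..b}"
  shows "(\<lambda>x. h x * f x) integrable_on {a..b}"
proof (cases "a \<le> b")
  case True
  obtain p where p: "mono_on {a..b} p" "mono_on {a..b} (\<lambda>t. p t - h t)"
    using bv_decomposition[OF fin] by metis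
  have "(\<lambda>x. q x * f x) integrable_on {a..b}" if "mono_on {a..b} q" for q
  proof (rule second_mean_value_theorem_full[OF f True, of q])
    show "q x \<le> q y" if "a \<le> x" "x \<le> y" "y \<le> b" for x y
      using that by (intro mono_onD[OF \<open>mono_on {a..b} q\<close>]) auto
  qed (rule has_integral_integrable)
  from integrable_diff[OF this[OF p(1)] this[OF p(2)]] show ?thesis by (simp add: algebra_simps)
qed auto

text \<open>For monotone \<open>q\<close> bounded by \<open>B\<close>, the second mean value theorem
  gives at most \<open>B * d + B * (2 * d)\<close>, since the integral over \<open>{c..b}\<close> is
  a difference of two initial ones. With \<open>B = V\<close> for \<open>p\<close> and
  \<open>B = V + M\<close> for \<open>p - h\<close> the sum is \<open>(6 * V + 3 * M) * d\<close>.
  Only the primitive of \<open>f\<close> enters, so the bound is one in the Alexiewicz norm.\<close>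

lemma bv_pairing_bound:
  assumes fin: "tv h a b < \<infinity>" and f: "f integrable_on {a..b}" and ab: "a \<le> b"
    and M: "\<And>x. x \<in> {a..b} \<Longrightarrow> \<bar>h x\<bar> \<le> M"
    and d: "\<And>c. c \<in> {a..b} \<Longrightarrow> \<bar>integral {a..c} f\<bar> \<le> d"
  shows "\<bar>integral {a..b} (\<lambda>x. h x * f x)\<bar> \<le> (6 * enn2real (tv h a b) + 3 * M) * d"
proof -
  define V where "V = enn2real (tv h a b)"
  obtain p where p: "mono_on {a..b} p" "mono_on {a..b} (\<lambda>t. p t - h t)"
      "\<And>t. t \<in> {a..b} \<Longrightarrow> 0 \<le> p t \<and> p t \<le> V"
    using bv_decomposition[OF fin] unfolding V_def by metis
  have "0 \<le> M" using M[of a] ab by (meson abs_ge_zero atLeastAtMost_iff order_refl order_trans)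
  have "0 \<le> d" using d[of a] ab by simp
  have mono: "(\<lambda>x. q x * f x) integrable_on {a..b} \<and> \<bar>integral {a..b} (\<lambda>x. q x * f x)\<bar> \<le> 3 * B * d"
    if q: "mono_on {a..b} q" and B: "\<And>x. x \<in> {a..b} \<Longrightarrow> \<bar>q x\<bar> \<le> B" for q B
  proof -
    obtain c where c: "c \<in> {a..b}"
      "((\<lambda>x. q x * f x) has_integral (q a * integral {a..c} f + q b * integral {c..b} f)) {a..b}"
    proof (rule second_mean_value_theorem_full[OF f ab, of q])
      show "q x \<le> q y" if "a \<le> x" "x \<le> y" "y \<le> b" for x y
        using that by (intro mono_onD[OF q]) auto
    qed
    have "integral {c..b} f = integral {a..b} f - integral {a..c} f"
      using Henstock_Kurzweil_Integration.integral_combine[of a c b f] c f by simp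
    then have "\<bar>integral {c..b} f\<bar> \<le> d + d"
      using d[of b] d[of c] c ab by simp
    moreover have "\<bar>integral {a..c} f\<bar> \<le> d" by (rule d) fact
    moreover have "\<bar>q a\<bar> \<le> B" "\<bar>q b\<bar> \<le> B" using B ab by auto
    ultimately have "\<bar>q a * integral {a..c} f\<bar> \<le> B * d" "\<bar>q b * integral {c..b} f\<bar> \<le> B * (d + d)"
      unfolding abs_mult using \<open>0 \<le> d\<close> by (smt (verit) mult_mono abs_ge_zero)+
    then have "\<bar>q a * integral {a..c} f + q b * integral {c..b} f\<bar> \<le> 3 * B * d"
      by (simp add: algebra_simps)
    then show ?thesis
      using has_integral_integrable[OF c(2)] by (simp add: integral_unique[OF c(2)])
  qed
  have 1: "(\<lambda>x. p x * f x) integrable_on {a..b} \<and> \<bar>integral {a..b} (\<lambda>x. p x * f x)\<bar> \<le> 3 * V * d"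
    by (rule mono[OF p(1)]) (use p(3) in auto)
  have 2: "(\<lambda>x. (p x - h x) * f x) integrable_on {a..b} \<and> \<bar>integral {a..b} (\<lambda>x. (p x - h x) * f x)\<bar> \<le> 3 * (V + M) * d"
    by (rule mono[OF p(2)]) (use p(3) M in \<open>smt (verit)\<close>)
  have "integral {a..b} (\<lambda>x. h x * f x) = integral {a..b} (\<lambda>x. p x * f x - (p x - h x) * f x)"
    by (simp add: algebra_simps)
  also have "\<dots> = integral {a..b} (\<lambda>x. p x * f x) - integral {a..b} (\<lambda>x. (p x - h x) * f x)"
    using 1 2 by (intro integral_diff) auto
  finally have "\<bar>integral {a..b} (\<lambda>x. h x * f x)\<bar> \<le> 3 * V * d + 3 * (V + M) * d"
    using 1 2 by linarith
  then show ?thesis by (simp add: V_def algebra_simps)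
qed

section \<open>Estimates for Poisson integrals and convergence at continuity points\<close>

lemma poisson_denominator_pos:
  fixes r :: real
  assumes "0 \<le> r" "r < 1"
  shows "0 < 1 - 2 * r * cos \<theta> + r\<^sup>2"
proof -
  have "1 - 2 * r * cos \<theta> + r\<^sup>2 = (1 - r)\<^sup>2 + 2 * r * (1 - cos \<theta>)"
    by (simp add: power2_eq_square algebra_simps)
  moreover have "0 < (1 - r)\<^sup>2" using assms by simp
  moreover have "0 \<le> 2 * r * (1 - cos \<theta>)" using assms by simp
  ultimately show ?thesis by linarith
qed

lemma poisson_kernel_nonneg:
  assumes "0 \<le> r" "r < 1"
  shows "0 \<le> poisson_kernel r \<theta>"
proof -
  have "r\<^sup>2 \<le> 1" using assms by (simp add: power_le_one)
  then show ?thesis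
    using poisson_denominator_pos[OF assms, of \<theta>] by (simp add: poisson_kernel_def)
qed

lemma continuous_on_poisson_kernel:
  assumes "0 \<le> r" "r < 1"
  shows "continuous_on S (\<lambda>\<phi>. poisson_kernel r (\<phi> - \<theta>))"
  unfolding poisson_kernel_def using poisson_denominator_pos[OF assms]
  by (intro continuous_intros) (simp_all add: less_imp_neq[symmetric])

lemma poisson_kernel_periodic [simp]: "poisson_kernel r (\<theta> + 2 * pi) = poisson_kernel r \<theta>"
  by (simp add: poisson_kernel_def)

lemma BV_D:
  assumes "g \<in> BV"
  shows "periodic2pi g" "variation g < \<infinity>" "tv g (- pi) pi < \<infinity>"
  using assms by (auto simp: BV_def variation_eq_tv)

lemma NBV_imp_BV: "g \<in> NBV \<Longrightarrow> g \<in> BV"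
  by (auto simp: NBV_def BV_def)

lemma BV_abs_diff_le:
  assumes "g \<in> BV"
  shows "\<bar>g s - g t\<bar> \<le> enn2real (variation g)"
  using abs_diff_le_variation[OF BV_D(1)[OF assms], of s t] BV_D(2)[OF assms]
  by (metis abs_ge_zero enn2real_ennreal enn2real_mono infinity_ennreal_def)

lemma BV_bounded:
  assumes "g \<in> BV"
  shows "\<bar>g s\<bar> \<le> \<bar>g t\<bar> + enn2real (variation g)"
  using BV_abs_diff_le[OF assms, of s t] by linarith

lemma bv_mult_continuous_integrable:
  assumes "g \<in> BV" "continuous_on {- pi..pi} f"
  shows "(\<lambda>x. g x * f x) integrable_on {- pi..pi}"
  using assms by (intro bv_mult_integrable BV_D integrable_continuous_real)

lemma has_integral_poisson_rcis:
  assumes g: "g \<in> BV" and r: "0 \<le> r" "r < 1"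
  shows "((\<lambda>\<phi>. g \<phi> * poisson_kernel r (\<phi> - \<theta>)) has_integral on_circle (poisson g) r \<theta>) {- pi..pi}"
  unfolding on_circle_def poisson_rcis[OF r(1)]
  by (intro integrable_integral bv_mult_continuous_integrable g continuous_on_poisson_kernel r)

text \<open>The angle moves from the kernel to \<open>g\<close>. Values at several angles are then
  integrals against one common density, and their linear combinations can be estimated under the
  integral sign.\<close>

lemma has_integral_poisson_translate:
  assumes g: "g \<in> BV" and r: "0 \<le> r" "r < 1"
  shows "((\<lambda>t. g (t + \<theta>) * poisson_kernel r t) has_integral on_circle (poisson g) r \<theta>) {- pi..pi}"
proof -
  have "periodic2pi (\<lambda>\<phi>. g \<phi> * poisson_kernel r (\<phi> - \<theta>))"
    using BV_D(1)[OF g] poisson_kernel_periodic[of r "\<phi> - \<theta>" for \<phi>]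
    by (simp add: periodic2pi_def algebra_simps)
  from has_integral_periodic_shift[OF this has_integral_poisson_rcis[OF assms], of \<theta>]
  show ?thesis by simp
qed

lemma periodic2pi_on_circle: "periodic2pi (on_circle u r)"
proof -
  have "rcis r (\<theta> + 2 * pi) = rcis r \<theta>" for \<theta>
    by (simp add: rcis_def flip: cis_mult)
  then show ?thesis by (simp add: periodic2pi_def on_circle_def)
qed

lemma abs_poisson_le:
  assumes g: "g \<in> BV" and r: "0 \<le> r" "r < 1" and M: "\<And>t. \<bar>g t\<bar> \<le> M"
  shows "\<bar>on_circle (poisson g) r \<theta>\<bar> \<le> M"
proof -
  note I = has_integral_poisson_translate[OF g r, of \<theta>]
  have K: "((\<lambda>t. c * poisson_kernel r t) has_integral c) {- pi..pi}" for c
    using has_integral_mult_right[OF has_integral_poisson_kernel[OF r], of c] by simp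
  have "on_circle (poisson g) r \<theta> \<le> M"
    by (rule has_integral_le[OF I K])
      (use M in \<open>auto intro!: mult_right_mono poisson_kernel_nonneg r simp: abs_le_iff\<close>)
  moreover have "- M \<le> on_circle (poisson g) r \<theta>"
    by (rule has_integral_le[OF K I], rule mult_right_mono)
      (use M in \<open>auto intro!: poisson_kernel_nonneg r simp: abs_le_iff minus_le_iff\<close>)
  ultimately show ?thesis by linarith
qed

text \<open>For each \<open>t\<close> the chain sum of the translate of \<open>g\<close> by
  \<open>t\<close> is at most \<open>V\<close>, independently of \<open>t\<close>; averaging this
  against the kernel, which has integral 1, keeps the bound.\<close>

lemma variation_poisson_le:
  assumes g: "g \<in> BV" and r: "0 \<le> r" "r < 1"
  shows "variation (on_circle (poisson g) r) \<le> variation g"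
  unfolding variation_eq_tv[of "on_circle (poisson g) r"]
proof (rule tv_least)
  fix n x assume nx: "(n, x) \<in> chains_between (- pi) pi"
  define v where "v = on_circle (poisson g) r"
  \<comment> \<open>Multiplication by these signs makes the chain sum of \<open>v\<close> a linear
    expression, hence a single integral; for the translates of \<open>g\<close> the same signs give
    at most the chain sum.\<close>
  define s where "s = (\<lambda>i. sgn (v (x (Suc i)) - v (x i)))"
  define V where "V = enn2real (variation g)"
  have "((\<lambda>t. \<Sum>i<n. s i * (g (t + x (Suc i)) * poisson_kernel r t - g (t + x i) * poisson_kernel r t))
      has_integral (\<Sum>i<n. s i * (v (x (Suc i)) - v (x i)))) {- pi..pi}"
    unfolding v_def
    by (intro has_integral_sum has_integral_mult_right has_integral_diff has_integral_poisson_translate g r) auto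
  moreover have "((\<lambda>t. V * poisson_kernel r t) has_integral V) {- pi..pi}"
    using has_integral_mult_right[OF has_integral_poisson_kernel[OF r], of V] by simp
  moreover have "(\<Sum>i<n. s i * (g (t + x (Suc i)) * poisson_kernel r t - g (t + x i) * poisson_kernel r t))
      \<le> V * poisson_kernel r t" for t
  proof -
    have "ennreal (chain_sum (\<lambda>y. g (y + t)) n x) \<le> variation (\<lambda>y. g (y + t))"
      unfolding variation_eq_tv by (rule chain_sum_le_tv[OF nx])
    then have "chain_sum (\<lambda>y. g (y + t)) n x \<le> V"
      using variation_shift[OF BV_D(1)[OF g], of t] BV_D(2)[OF g] enn2real_mono[of "ennreal _" "variation g"]
      by (fastforce simp: V_def)
    moreover have "(\<Sum>i<n. s i * (g (t + x (Suc i)) - g (t + x i))) \<le> chain_sum (\<lambda>y. g (y + t)) n x"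
      unfolding chain_sum_def
    proof (rule sum_mono)
      fix i
      have "s i * (g (t + x (Suc i)) - g (t + x i)) \<le> \<bar>s i\<bar> * \<bar>g (t + x (Suc i)) - g (t + x i)\<bar>"
        by (metis abs_ge_self abs_mult)
      also have "\<dots> \<le> 1 * \<bar>g (t + x (Suc i)) - g (t + x i)\<bar>"
        by (intro mult_right_mono) (auto simp: s_def sgn_real_def)
      finally show "s i * (g (t + x (Suc i)) - g (t + x i)) \<le> \<bar>g (x (Suc i) + t) - g (x i + t)\<bar>"
        by (simp add: add.commute)
    qed
    ultimately have "(\<Sum>i<n. s i * (g (t + x (Suc i)) - g (t + x i))) * poisson_kernel r t \<le> V * poisson_kernel r t"
      by (intro mult_right_mono poisson_kernel_nonneg r) linarith
    moreover have "(\<Sum>i<n. s i * (g (t + x (Suc i)) * poisson_kernel r t - g (t + x i) * poisson_kernel r t))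
        = (\<Sum>i<n. s i * (g (t + x (Suc i)) - g (t + x i))) * poisson_kernel r t"
      by (simp add: sum_distrib_right left_diff_distrib mult.assoc)
    ultimately show ?thesis by simp
  qed
  ultimately have "(\<Sum>i<n. s i * (v (x (Suc i)) - v (x i))) \<le> V"
    by (rule has_integral_le)
  moreover have "(\<Sum>i<n. s i * (v (x (Suc i)) - v (x i))) = chain_sum v n x"
    unfolding chain_sum_def s_def by (simp add: abs_sgn mult.commute)
  ultimately have "ennreal (chain_sum v n x) \<le> ennreal V"
    by (simp add: ennreal_leI)
  also have "\<dots> = variation g"
    using BV_D(2)[OF g] by (simp add: V_def)
  finally show "ennreal (chain_sum (on_circle (poisson g) r) n x) \<le> variation g"
    by (simp add: v_def)
qed

lemma on_circle_poisson_BV: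
  assumes "g \<in> BV" "0 \<le> r" "r < 1"
  shows "on_circle (poisson g) r \<in> BV"
  using variation_poisson_le[OF assms] BV_D(2)[OF assms(1)]
  by (auto simp: BV_def periodic2pi_on_circle)

text \<open>The reference point \<open>s\<close> is free: varying it leads to the bound with the
  infimum, and \<open>s = - pi\<close> to the one for \<open>NBV\<close>.\<close>

lemma sup_norm_poisson_le:
  assumes g: "g \<in> BV" and r: "0 \<le> r" "r < 1"
  shows "sup_norm (on_circle (poisson g) r) \<le> ennreal \<bar>g s\<bar> + variation g"
  unfolding sup_norm_def
proof (rule SUP_least)
  fix \<theta>
  have "\<bar>on_circle (poisson g) r \<theta>\<bar> \<le> \<bar>g s\<bar> + enn2real (variation g)"
    by (rule abs_poisson_le[OF g r BV_bounded[OF g]])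
  then have "ennreal \<bar>on_circle (poisson g) r \<theta>\<bar> \<le> ennreal (\<bar>g s\<bar> + enn2real (variation g))"
    by (rule ennreal_leI)
  also have "\<dots> = ennreal \<bar>g s\<bar> + variation g"
    using BV_D(2)[OF g] by (simp add: ennreal_plus)
  finally show "ennreal \<bar>on_circle (poisson g) r \<theta>\<bar> \<le> ennreal \<bar>g s\<bar> + variation g" .
qed

lemma sup_norm_poisson_le_INF:
  assumes g: "g \<in> BV" and r: "0 \<le> r" "r < 1"
  shows "sup_norm (on_circle (poisson g) r) \<le> (INF \<theta>. ennreal \<bar>g \<theta>\<bar>) + variation g"
proof (rule ennreal_le_epsilon)
  fix e :: real assume e: "0 < e"
  \<comment> \<open>The infimum need not be attained. Being finite, it increases strictly when
    \<open>e\<close> is added, which provides a nearly minimal \<open>s\<close>.\<close>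
  have "(INF \<theta>. ennreal \<bar>g \<theta>\<bar>) \<le> ennreal \<bar>g 0\<bar>" by (rule INF_lower) simp
  then have fin: "(INF \<theta>. ennreal \<bar>g \<theta>\<bar>) < top" by (rule le_less_trans) simp
  then have "(INF \<theta>. ennreal \<bar>g \<theta>\<bar>) < (INF \<theta>. ennreal \<bar>g \<theta>\<bar>) + ennreal e"
    using e ennreal_add_left_cancel_less[of _ 0 "ennreal e"] by (simp add: less_top)
  then obtain s where "ennreal \<bar>g s\<bar> < (INF \<theta>. ennreal \<bar>g \<theta>\<bar>) + ennreal e"
    unfolding INF_less_iff by blast
  then have "ennreal \<bar>g s\<bar> + variation g \<le> (INF \<theta>. ennreal \<bar>g \<theta>\<bar>) + ennreal e + variation g"
    by (intro add_right_mono less_imp_le)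
  from order_trans[OF sup_norm_poisson_le[OF g r, of s] this]
  show "sup_norm (on_circle (poisson g) r) \<le> (INF \<theta>. ennreal \<bar>g \<theta>\<bar>) + variation g + ennreal e"
    by (simp add: add_ac)
qed

text \<open>Approximate identity: for \<open>|t| \<le> d\<close> continuity of \<open>g\<close>
  contributes at most \<open>e / 2\<close>, and for larger \<open>t\<close> the kernel is at most
  its value at the angle \<open>d\<close>, which tends to 0.\<close>

lemma poisson_tendsto:
  assumes g: "g \<in> BV" and cont: "isCont g \<theta>"
  shows "((\<lambda>r. on_circle (poisson g) r \<theta>) \<longlongrightarrow> g \<theta>) (at_left 1)"
proof (rule tendstoI)
  fix e :: real assume "0 < e"
  define M where "M = \<bar>g 0\<bar> + enn2real (variation g)"
  have M: "\<bar>g t\<bar> \<le> M" for t unfolding M_def by (rule BV_bounded[OF g])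
  obtain d0 where d0: "d0 > 0" "\<And>t. \<bar>t - \<theta>\<bar> < d0 \<Longrightarrow> \<bar>g t - g \<theta>\<bar> < e / 2"
    using cont \<open>0 < e\<close> unfolding continuous_at_eps_delta dist_real_def by (meson half_gt_zero)
  \<comment> \<open>Halving keeps \<open>d\<close> strictly below \<open>d0\<close>, and the bound 1
    keeps it below \<open>pi\<close>, inside the interval on which cosine decreases.\<close>
  define d where "d = min (d0 / 2) 1"
  have d: "0 < d" "d \<le> 1" "d < d0" using d0 by (auto simp: d_def)
  have "d < pi" using d pi_gt3 by simp
  \<comment> \<open>\<open>\<kappa> r\<close> is \<open>poisson_kernel r d\<close>. Its numerator
    vanishes at \<open>r = 1\<close>, while \<open>cos d < 1\<close> keeps the denominator away from
    0.\<close>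
  define \<kappa> where "\<kappa> = (\<lambda>r::real. (1 - r\<^sup>2) / (2 * pi * (1 - 2 * r * cos d + r\<^sup>2)))"
  have "cos d < 1" using cos_monotone_0_pi[of 0 d] d \<open>d < pi\<close> by simp
  have "((\<lambda>r. e / 2 + 2 * M * (\<kappa> r * (2 * pi))) \<longlongrightarrow> e / 2 + 2 * M * (0 * (2 * pi))) (at_left 1)"
  proof (intro tendsto_intros)
    have "(\<kappa> \<longlongrightarrow> (1 - 1\<^sup>2) / (2 * pi * (1 - 2 * 1 * cos d + 1\<^sup>2))) (at_left 1)"
      unfolding \<kappa>_def using \<open>cos d < 1\<close> by (intro tendsto_intros) auto
    then show "(\<kappa> \<longlongrightarrow> 0) (at_left 1)" by simp
  qed
  from order_tendstoD(2)[OF this, of e]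
  have "\<forall>\<^sub>F r in at_left 1. e / 2 + 2 * M * (\<kappa> r * (2 * pi)) < e"
    using \<open>0 < e\<close> by simp
  moreover have "\<forall>\<^sub>F r in at_left 1. (0::real) \<le> r \<and> r < 1"
    unfolding eventually_at_left_field by (intro exI[of _ 0]) auto
  ultimately show "\<forall>\<^sub>F r in at_left 1. dist (on_circle (poisson g) r \<theta>) (g \<theta>) < e"
  proof eventually_elim
    case (elim r)
    then have r: "0 \<le> r" "r < 1" by auto
    let ?K = "poisson_kernel r"
    have I: "((\<lambda>t. g (t + \<theta>) * ?K t - g \<theta> * ?K t) has_integral (on_circle (poisson g) r \<theta> - g \<theta>)) {- pi..pi}"
      using has_integral_diff[OF has_integral_poisson_translate[OF g r]
          has_integral_mult_right[OF has_integral_poisson_kernel[OF r], of "g \<theta>"]] by simp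
    \<comment> \<open>The majorant adds the near and the far estimate, so that it holds on the whole
      period and the integral is not split at \<open>d\<close>.\<close>
    have B: "((\<lambda>t. (e / 2) * ?K t + 2 * M * \<kappa> r) has_integral (e / 2 + 2 * M * (\<kappa> r * (2 * pi)))) {- pi..pi}"
      using has_integral_add[OF has_integral_mult_right[OF has_integral_poisson_kernel[OF r], of "e / 2"]
          has_integral_const_real[of "2 * M * \<kappa> r" "- pi" pi]]
      by (simp add: algebra_simps)
    have bound: "\<bar>g (t + \<theta>) * ?K t - g \<theta> * ?K t\<bar> \<le> (e / 2) * ?K t + 2 * M * \<kappa> r" if t: "t \<in> {- pi..pi}" for t
    proof -
      have Kn: "0 \<le> ?K t" by (rule poisson_kernel_nonneg[OF r])
      have kn: "0 \<le> \<kappa> r" using poisson_kernel_nonneg[OF r, of d] by (simp add: \<kappa>_def poisson_kernel_def)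
      have "0 \<le> M" using M[of 0] by linarith
      have eq: "\<bar>g (t + \<theta>) * ?K t - g \<theta> * ?K t\<bar> = \<bar>g (t + \<theta>) - g \<theta>\<bar> * ?K t"
        using Kn by (simp add: abs_mult flip: left_diff_distrib)
      show ?thesis
      proof (cases "\<bar>t\<bar> \<le> d")
        case True
        then have "\<bar>g (t + \<theta>) - g \<theta>\<bar> \<le> e / 2" using d0(2)[of "t + \<theta>"] d by simp
        then have "\<bar>g (t + \<theta>) - g \<theta>\<bar> * ?K t \<le> (e / 2) * ?K t" using Kn by (rule mult_right_mono)
        moreover have "0 \<le> 2 * M * \<kappa> r" using kn \<open>0 \<le> M\<close> by simp
        ultimately show ?thesis unfolding eq by linarith
      next
        case False
        then have "cos \<bar>t\<bar> \<le> cos d"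
          using t d by (intro cos_monotone_0_pi_le) auto
        then have "cos t \<le> cos d" by simp
        then have "?K t \<le> \<kappa> r"
          unfolding poisson_kernel_def \<kappa>_def
          using poisson_denominator_pos[OF r, of d] r
          by (intro divide_left_mono mult_left_mono mult_pos_pos)
            (auto simp: power_le_one poisson_denominator_pos mult_left_mono)
        moreover have "\<bar>g (t + \<theta>) - g \<theta>\<bar> \<le> 2 * M" using M[of "t + \<theta>"] M[of \<theta>] by linarith
        ultimately have "\<bar>g (t + \<theta>) - g \<theta>\<bar> * ?K t \<le> 2 * M * \<kappa> r"
          using Kn \<open>0 \<le> M\<close> by (intro mult_mono) auto
        moreover have "0 \<le> (e / 2) * ?K t" using Kn \<open>0 < e\<close> by simp
        ultimately show ?thesis unfolding eq by linarith
      qed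
    qed
    have "on_circle (poisson g) r \<theta> - g \<theta> \<le> e / 2 + 2 * M * (\<kappa> r * (2 * pi))"
      by (rule has_integral_le[OF I B]) (use bound in \<open>auto simp: abs_le_iff\<close>)
    moreover have "- (on_circle (poisson g) r \<theta> - g \<theta>) \<le> e / 2 + 2 * M * (\<kappa> r * (2 * pi))"
      by (rule has_integral_le[OF has_integral_neg[OF I] B]) (use bound in \<open>auto simp: abs_le_iff\<close>)
    ultimately show ?case using elim by (simp add: dist_real_def)
  qed
qed

text \<open>Monotone functions on an open interval have countably many discontinuities; the two
  monotone parts settle one open period, and integer translates settle the line.\<close>

lemma countable_discontinuities:
  assumes g: "g \<in> BV"
  shows "countable {t. \<not> isCont g t}"
proof -
  obtain p where p: "mono_on {- pi..pi} p" "mono_on {- pi..pi} (\<lambda>t. p t - g t)"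
    using bv_decomposition[OF BV_D(3)[OF g]] by metis
  have "mono_on {- pi<..<pi} p" "mono_on {- pi<..<pi} (\<lambda>t. p t - g t)"
    by (rule mono_on_subset[OF p(1)], force, rule mono_on_subset[OF p(2)], force)
  then have cnt: "countable ({t \<in> {- pi<..<pi}. \<not> isCont p t} \<union> {t \<in> {- pi<..<pi}. \<not> isCont (\<lambda>t. p t - g t) t})"
    by (intro countable_Un mono_on_ctble_discont_open) auto
  have "isCont g t" if "isCont p t" "isCont (\<lambda>t. p t - g t) t" for t
    using isCont_diff[OF that] by simp
  then have sub: "{t \<in> {- pi<..<pi}. \<not> isCont g t}
      \<subseteq> {t \<in> {- pi<..<pi}. \<not> isCont p t} \<union> {t \<in> {- pi<..<pi}. \<not> isCont (\<lambda>t. p t - g t) t}"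
    by blast
  \<comment> \<open>The monotone parts live on \<open>{- pi..pi}\<close> and do not decide
    continuity of the periodic function at \<open>- pi\<close>, so this point is added to the
    exceptional set.\<close>
  have D: "countable (insert (- pi) {t \<in> {- pi<..<pi}. \<not> isCont g t})" (is "countable ?D")
    by (rule countable_insert, rule countable_subset[OF sub cnt])
  have "{t. \<not> isCont g t} \<subseteq> (\<Union>k::int. (\<lambda>t. t - 2 * pi * of_int k) ` ?D)"
  proof
    fix t assume "t \<in> {t. \<not> isCont g t}"
    then have t: "\<not> isCont g t" by simp
    obtain k :: int where k: "- pi \<le> t + 2 * pi * of_int k" "t + 2 * pi * of_int k < - pi + 2 * pi"
      by (rule reduce_mod_2pi)
    have "\<not> isCont g (t + 2 * pi * of_int k)"
    proof
      assume "isCont g (t + 2 * pi * of_int k)"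
      then have "isCont (\<lambda>t. g (t + 2 * pi * of_int k)) t"
        by (rule isCont_o2[where f = "\<lambda>t. t + 2 * pi * of_int k" and g = g, rotated])
          (intro continuous_intros)
      then show False using t periodic2pi_add_int[OF BV_D(1)[OF g]] by simp
    qed
    with k have "t + 2 * pi * of_int k \<in> ?D" by (cases "t + 2 * pi * of_int k = - pi") simp_all
    then show "t \<in> (\<Union>k::int. (\<lambda>t. t - 2 * pi * of_int k) ` ?D)"
      by (intro UN_I[of k] image_eqI[of _ _ "t + 2 * pi * of_int k"]) simp_all
  qed
  moreover have "countable (\<Union>k::int. (\<lambda>t. t - 2 * pi * of_int k) ` ?D)"
    by (intro countable_UN countable_image D) auto
  ultimately show ?thesis by (rule countable_subset)
qed


subsection \<open>Weak* convergence\<close>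

text \<open>Setting the functions and the limit to 0 on \<open>N\<close> leaves all integrals
  unchanged and makes the convergence hold everywhere on \<open>S\<close>.\<close>

lemma dominated_convergence_negligible:
  fixes f :: "nat \<Rightarrow> 'n::euclidean_space \<Rightarrow> 'm::euclidean_space"
  assumes f: "\<And>k. f k integrable_on S" and h: "h integrable_on S"
    and le: "\<And>k x. x \<in> S \<Longrightarrow> norm (f k x) \<le> h x"
    and N: "negligible N" and conv: "\<And>x. x \<in> S - N \<Longrightarrow> (\<lambda>k. f k x) \<longlonglongrightarrow> g x"
  shows "g integrable_on S" "(\<lambda>k. integral S (f k)) \<longlonglongrightarrow> integral S g"
proof -
  define f' where "f' = (\<lambda>k x. if x \<in> N then 0 else f k x)"
  define g' where "g' = (\<lambda>x. if x \<in> N then 0 else g x)"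
  have int: "f' k integrable_on S" for k
    by (rule integrable_spike[OF f[of k] N]) (auto simp: f'_def)
  have "0 \<le> h x" if "x \<in> S" for x
    using le[OF that, of undefined] norm_ge_zero order_trans by blast
  then have le': "norm (f' k x) \<le> h x" if "x \<in> S" for k x
    using that le by (auto simp: f'_def)
  have conv': "(\<lambda>k. f' k x) \<longlonglongrightarrow> g' x" if "x \<in> S" for x
    using that conv by (auto simp: f'_def g'_def)
  note dc = dominated_convergence[OF int h le' conv']
  show "g integrable_on S"
    by (rule integrable_spike[OF dc(1) N]) (auto simp: g'_def)
  have "integral S (f' k) = integral S (f k)" for k
    by (rule integral_spike[OF N]) (auto simp: f'_def)
  moreover have "integral S g' = integral S g"
    by (rule integral_spike[OF N]) (auto simp: g'_def)
  ultimately show "(\<lambda>k. integral S (f k)) \<longlonglongrightarrow> integral S g"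
    using dc(2) by simp
qed

text \<open>A continuous test function is bounded, so a constant dominates, and convergence holds
  off the countable set of discontinuities of \<open>g\<close>. The derivatives of approximating
  polynomials will play the role of \<open>f\<close>.\<close>

lemma poisson_pairing_tendsto_continuous:
  assumes g: "g \<in> BV" and f: "continuous_on {- pi..pi} f"
  shows "((\<lambda>r. integral {- pi..pi} (\<lambda>t. on_circle (poisson g) r t * f t))
    \<longlongrightarrow> integral {- pi..pi} (\<lambda>t. g t * f t)) (at_left 1)"
proof (rule tendsto_at_left_sequentially[of 0])
  fix X :: "nat \<Rightarrow> real"
  assume X: "\<And>n. X n < 1" "\<And>n. 0 < X n" "X \<longlonglongrightarrow> 1"
  then have r: "0 \<le> X n" "X n < 1" for n by (auto intro: less_imp_le)
  have left: "filterlim X (at_left 1) sequentially"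
    using X by (intro tendsto_imp_filterlim_at_left) auto
  define M where "M = \<bar>g 0\<bar> + enn2real (variation g)"
  have M: "\<bar>g t\<bar> \<le> M" for t unfolding M_def by (rule BV_bounded[OF g])
  obtain B where B: "\<And>t. t \<in> {- pi..pi} \<Longrightarrow> \<bar>f t\<bar> \<le> B"
    using compact_imp_bounded[OF compact_continuous_image[OF f]]
    unfolding bounded_iff by (metis compact_Icc image_eqI real_norm_def)
  show "(\<lambda>n. integral {- pi..pi} (\<lambda>t. on_circle (poisson g) (X n) t * f t))
      \<longlonglongrightarrow> integral {- pi..pi} (\<lambda>t. g t * f t)"
  proof (rule dominated_convergence_negligible(2)[where h = "\<lambda>t. M * B"])
    show "(\<lambda>t. on_circle (poisson g) (X n) t * f t) integrable_on {- pi..pi}" for n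
      by (intro bv_mult_continuous_integrable on_circle_poisson_BV g r f)
    show "norm (on_circle (poisson g) (X n) t * f t) \<le> M * B" if "t \<in> {- pi..pi}" for n t
      unfolding real_norm_def abs_mult by (intro mult_mono' abs_poisson_le[OF g r M] B[OF that]) auto
    show "negligible {t. \<not> isCont g t}"
      by (intro negligible_countable countable_discontinuities g)
    show "(\<lambda>n. on_circle (poisson g) (X n) t * f t) \<longlonglongrightarrow> g t * f t"
      if "t \<in> {- pi..pi} - {t. \<not> isCont g t}" for t
      using filterlim_compose[OF poisson_tendsto[OF g, of t] left] that
      by (intro tendsto_mult tendsto_const) auto
  qed auto
qed auto

text \<open>The pairings with \<open>v\<^sub>r\<close> are bounded uniformly in \<open>r\<close> with respect to the Alexiewicz norm, and by
  Weierstrass' theorem applied to a primitive of \<open>f\<close> the polynomials are dense in that norm.\<close>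

lemma poisson_weak_star:
  assumes g: "g \<in> BV"
  shows "weak_star_converges (on_circle (poisson g)) g"
  unfolding weak_star_converges_def
proof (intro ballI conjI)
  fix f assume "f \<in> HK"
  then have f: "f integrable_on {- pi..pi}" by (simp add: HK_def)
  show "(\<lambda>\<theta>. f \<theta> * g \<theta>) integrable_on {- pi..pi}"
    using bv_mult_integrable[OF BV_D(3)[OF g] f] by (simp add: mult.commute)
  show "(\<lambda>\<theta>. f \<theta> * on_circle (poisson g) r \<theta>) integrable_on {- pi..pi}" if "r \<in> {0..<1}" for r
    using bv_mult_integrable[OF BV_D(3)[OF on_circle_poisson_BV[OF g, of r]] f] that
    by (simp add: mult.commute)
  define V where "V = enn2real (variation g)"
  define M where "M = \<bar>g 0\<bar> + V"
  have M: "\<bar>g t\<bar> \<le> M" for t unfolding M_def V_def by (rule BV_bounded[OF g])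
  define C where "C = 6 * V + 3 * M"
  have "0 \<le> C" using M[of 0] by (simp add: C_def V_def)
  show "((\<lambda>r. integral {- pi..pi} (\<lambda>\<theta>. f \<theta> * on_circle (poisson g) r \<theta>))
      \<longlongrightarrow> integral {- pi..pi} (\<lambda>\<theta>. f \<theta> * g \<theta>)) (at_left 1)"
  proof (rule tendstoI)
    fix e :: real assume "0 < e"
    \<comment> \<open>Replacing \<open>f\<close> by a polynomial costs \<open>C * (2 * d)\<close>
      twice, once for \<open>g\<close> and once for its Poisson integral, in total at most
      \<open>e / 2\<close>. The summand 1 keeps the divisor positive when
      \<open>C = 0\<close>.\<close>
    define d where "d = e / 8 / (C + 1)"
    have "d > 0" using \<open>0 < e\<close> \<open>0 \<le> C\<close> by (simp add: d_def)
    \<comment> \<open>The continuous primitive is approximated rather than \<open>f\<close>: uniform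
      closeness of primitives means that \<open>f\<close> and the derivative of \<open>q\<close> are
      close in the Alexiewicz norm.\<close>
    obtain q where q: "real_polynomial_function q"
      "\<And>c. c \<in> {- pi..pi} \<Longrightarrow> \<bar>integral {- pi..c} f - q c\<bar> < d"
      using Stone_Weierstrass_real_polynomial_function[OF compact_Icc indefinite_integral_continuous_1[OF f] \<open>d > 0\<close>]
      by blast
    obtain q' where q': "real_polynomial_function q'" "\<And>t. (q has_real_derivative q' t) (at t)"
      using has_real_derivative_polynomial_function[OF q(1)] by blast
    have q'c: "continuous_on S q'" for S
      using q'(1) continuous_on_polymonial_function real_polynomial_function_eq by blast
    have q'i: "q' integrable_on {- pi..pi}"
      by (intro integrable_continuous_real q'c)
    \<comment> \<open>The second \<open>d\<close> comes from \<open>q (- pi)\<close>, which is only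
      within \<open>d\<close> of 0.\<close>
    have small: "\<bar>integral {- pi..c} (\<lambda>t. f t - q' t)\<bar> \<le> 2 * d" if c: "c \<in> {- pi..pi}" for c
    proof -
      have "(q' has_integral (q c - q (- pi))) {- pi..c}"
        using c q'(2) by (intro fundamental_theorem_of_calculus)
          (auto simp: has_real_derivative_iff_has_vector_derivative[symmetric] intro: has_field_derivative_at_within)
      moreover have "f integrable_on {- pi..c}"
        using f c by (intro integrable_subinterval_real[OF f]) auto
      ultimately have "integral {- pi..c} (\<lambda>t. f t - q' t) = integral {- pi..c} f - (q c - q (- pi))"
        by (simp add: integral_diff has_integral_integrable integral_unique)
      moreover have "\<bar>0 - q (- pi)\<bar> < d" using q(2)[of "- pi"] by simp
      ultimately show ?thesis using q(2)[OF c] by linarith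
    qed
    \<comment> \<open>Stated for all \<open>h\<close> with the same bounds as \<open>g\<close>, the
      estimate covers the restrictions of \<open>poisson g\<close> to all circles uniformly in the
      radius.\<close>
    have approx: "\<bar>integral {- pi..pi} (\<lambda>t. f t * h t) - integral {- pi..pi} (\<lambda>t. h t * q' t)\<bar> \<le> C * (2 * d)"
      if h: "h \<in> BV" "variation h \<le> variation g" "\<And>t. \<bar>h t\<bar> \<le> M" for h
    proof -
      have "integral {- pi..pi} (\<lambda>t. f t * h t) - integral {- pi..pi} (\<lambda>t. h t * q' t)
          = integral {- pi..pi} (\<lambda>t. h t * (f t - q' t))"
        using bv_mult_integrable[OF BV_D(3)[OF h(1)] f] bv_mult_integrable[OF BV_D(3)[OF h(1)] q'i]
        by (subst integral_diff[symmetric]) (auto simp: algebra_simps)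
      also have "\<bar>\<dots>\<bar> \<le> (6 * enn2real (tv h (- pi) pi) + 3 * M) * (2 * d)"
        by (rule bv_pairing_bound) (use h small f q'i BV_D(3)[OF h(1)] in \<open>auto intro: integrable_diff\<close>)
      also have "\<dots> \<le> C * (2 * d)"
        using h(2) BV_D(2)[OF g] \<open>d > 0\<close>
        by (intro mult_right_mono) (auto simp: C_def V_def variation_eq_tv[of h, symmetric] enn2real_mono)
      finally show ?thesis .
    qed
    have lim: "\<forall>\<^sub>F r in at_left 1. dist (integral {- pi..pi} (\<lambda>t. on_circle (poisson g) r t * q' t))
        (integral {- pi..pi} (\<lambda>t. g t * q' t)) < e / 2"
      using \<open>0 < e\<close> by (intro tendstoD[OF poisson_pairing_tendsto_continuous[OF g q'c]]) auto
    have Cd: "C * (2 * d) + C * (2 * d) \<le> e / 2"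
    proof -
      have "C * (2 * d) + C * (2 * d) \<le> 4 * ((C + 1) * d)" using \<open>d > 0\<close> by (simp add: algebra_simps)
      also have "(C + 1) * d = e / 8"
      proof -
        have "C + 1 \<noteq> 0" using \<open>0 \<le> C\<close> by simp
        then show ?thesis
          by (metis d_def nonzero_mult_div_cancel_left times_divide_eq_right)
      qed
      finally show ?thesis by simp
    qed
    have "\<forall>\<^sub>F r in at_left 1. (0::real) \<le> r \<and> r < 1"
      unfolding eventually_at_left_field by (intro exI[of _ 0]) auto
    with lim show "\<forall>\<^sub>F r in at_left 1. dist (integral {- pi..pi} (\<lambda>\<theta>. f \<theta> * on_circle (poisson g) r \<theta>))
        (integral {- pi..pi} (\<lambda>\<theta>. f \<theta> * g \<theta>)) < e"
    proof eventually_elim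
      case (elim r)
      then have r: "0 \<le> r" "r < 1" by auto
      show ?case
        using approx[OF g order_refl M] elim(1) Cd
          approx[OF on_circle_poisson_BV[OF g r] variation_poisson_le[OF g r] abs_poisson_le[OF g r M]]
        unfolding dist_real_def by linarith
    qed
  qed
qed


subsection \<open>Isometry\<close>

lemma bv_scaleR_integrable:
  fixes f :: "real \<Rightarrow> complex"
  assumes g: "g \<in> BV" and f: "continuous_on {- pi..pi} f"
  shows "(\<lambda>\<phi>. g \<phi> *\<^sub>R f \<phi>) integrable_on {- pi..pi}"
proof -
  have "(\<lambda>\<phi>. complex_of_real (g \<phi> * Re (f \<phi>))) integrable_on {- pi..pi}"
    "(\<lambda>\<phi>. complex_of_real (g \<phi> * Im (f \<phi>))) integrable_on {- pi..pi}"
    using integrable_linear[OF bv_mult_continuous_integrable[OF g] bounded_linear_of_real]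
      continuous_on_Re[OF f] continuous_on_Im[OF f] by (auto simp: o_def)
  from integrable_add[OF this(1) integrable_linear[OF this(2) bounded_linear_mult_right[of \<i>]]]
  have "(\<lambda>\<phi>. complex_of_real (g \<phi> * Re (f \<phi>)) + \<i> * complex_of_real (g \<phi> * Im (f \<phi>))) integrable_on {- pi..pi}"
    by (simp add: o_def)
  moreover have "complex_of_real (g \<phi> * Re (f \<phi>)) + \<i> * complex_of_real (g \<phi> * Im (f \<phi>)) = g \<phi> *\<^sub>R f \<phi>" for \<phi>
    by (simp add: complex_eq_iff)
  ultimately show ?thesis by simp
qed

text \<open>The kernel is a geometric series in \<open>z\<close>, and the partial sums times
  \<open>g\<close> are dominated by \<open>M / (1 - cmod z)\<close>. Termwise integration gives a
  power series converging on the whole disc.\<close>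

lemma cauchy_transform_holomorphic:
  assumes g: "g \<in> BV"
  shows "(\<lambda>z. integral {- pi..pi} (\<lambda>\<phi>. g \<phi> *\<^sub>R (1 / (1 - z * cis (- \<phi>))))) holomorphic_on ball 0 1"
proof (rule power_series_holomorphic)
  fix z :: complex assume "z \<in> ball 0 1"
  then have z: "cmod z < 1" by simp
  have nz: "cmod (z * cis (- \<phi>)) = cmod z" for \<phi> by (simp add: norm_mult)
  define M where "M = \<bar>g 0\<bar> + enn2real (variation g)"
  have M: "\<bar>g t\<bar> \<le> M" for t unfolding M_def by (rule BV_bounded[OF g])
  let ?f = "\<lambda>n \<phi>. g \<phi> *\<^sub>R (\<Sum>i<n. (z * cis (- \<phi>)) ^ i)"
  have int: "?f n integrable_on {- pi..pi}" for n
    by (intro bv_scaleR_integrable g continuous_intros)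
  have "(\<lambda>n. integral {- pi..pi} (?f n))
      \<longlonglongrightarrow> integral {- pi..pi} (\<lambda>\<phi>. g \<phi> *\<^sub>R (1 / (1 - z * cis (- \<phi>))))"
  proof (rule dominated_convergence(2)[where h = "\<lambda>\<phi>. M * (1 / (1 - cmod z))"])
    fix n \<phi>
    have "cmod (\<Sum>i<n. (z * cis (- \<phi>)) ^ i) \<le> (\<Sum>i<n. cmod z ^ i)"
      using norm_sum[of "\<lambda>i. (z * cis (- \<phi>)) ^ i" "{..<n}"] by (simp add: norm_power nz)
    also have "\<dots> \<le> (\<Sum>i. cmod z ^ i)"
      using z by (intro sum_le_suminf summable_geometric) auto
    also have "\<dots> = 1 / (1 - cmod z)"
      using z by (intro suminf_geometric) auto
    finally show "norm (?f n \<phi>) \<le> M * (1 / (1 - cmod z))"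
      unfolding norm_scaleR by (intro mult_mono' M) auto
  next
    fix \<phi>
    show "(\<lambda>n. ?f n \<phi>) \<longlonglongrightarrow> g \<phi> *\<^sub>R (1 / (1 - z * cis (- \<phi>)))"
      using geometric_sums[of "z * cis (- \<phi>)"] z unfolding sums_def nz
      by (intro tendsto_scaleR tendsto_const) auto
  qed (use int in auto)
  moreover have "integral {- pi..pi} (?f n)
      = (\<Sum>i<n. integral {- pi..pi} (\<lambda>\<phi>. g \<phi> *\<^sub>R cis (- \<phi>) ^ i) * (z - 0) ^ i)" for n
  proof -
    have "?f n = (\<lambda>\<phi>. \<Sum>i<n. (g \<phi> *\<^sub>R cis (- \<phi>) ^ i) * z ^ i)"
      by (simp add: scaleR_sum_right power_mult_distrib mult_ac)
    moreover have "integral {- pi..pi} (\<lambda>\<phi>. \<Sum>i<n. (g \<phi> *\<^sub>R cis (- \<phi>) ^ i) * z ^ i)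
        = (\<Sum>i<n. integral {- pi..pi} (\<lambda>\<phi>. (g \<phi> *\<^sub>R cis (- \<phi>) ^ i) * z ^ i))"
      by (intro integral_sum integrable_on_mult_left bv_scaleR_integrable g continuous_intros) auto
    ultimately show ?thesis by (simp del: mult_scaleR_left)
  qed
  ultimately show "(\<lambda>i. integral {- pi..pi} (\<lambda>\<phi>. g \<phi> *\<^sub>R cis (- \<phi>) ^ i) * (z - 0) ^ i)
      sums integral {- pi..pi} (\<lambda>\<phi>. g \<phi> *\<^sub>R (1 / (1 - z * cis (- \<phi>))))"
    unfolding sums_def by simp
qed

text \<open>\<open>?F\<close> is the Schwarz integral of \<open>g\<close>: integration of
  \<open>2 / (1 - z * cis (- \<phi>)) - 1\<close> against \<open>g\<close> gives twice the Cauchy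
  transform minus the integral of \<open>g\<close>.\<close>

lemma poisson_Re_holomorphic:
  assumes g: "g \<in> BV"
  obtains F where "F holomorphic_on ball 0 1" "\<And>z. z \<in> ball 0 1 \<Longrightarrow> poisson g z = Re (F z)"
proof
  let ?H = "\<lambda>z. integral {- pi..pi} (\<lambda>\<phi>. g \<phi> *\<^sub>R (1 / (1 - z * cis (- \<phi>))))"
  let ?c = "integral {- pi..pi} (\<lambda>\<phi>. g \<phi> *\<^sub>R (1::complex))"
  let ?F = "\<lambda>z. (2 * ?H z - ?c) / (2 * pi)"
  show "?F holomorphic_on ball 0 1"
    by (intro holomorphic_intros cauchy_transform_holomorphic g) simp
  fix z :: complex assume "z \<in> ball 0 1"
  then have z: "cmod z < 1" by simp
  have ne: "1 - z * cis (- \<phi>) \<noteq> 0" for \<phi>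
  proof
    assume "1 - z * cis (- \<phi>) = 0"
    then have "cmod (z * cis (- \<phi>)) = 1" by simp
    then show False using z by (simp add: norm_mult)
  qed
  have H: "((\<lambda>\<phi>. g \<phi> *\<^sub>R (1 / (1 - z * cis (- \<phi>)))) has_integral ?H z) {- pi..pi}"
    by (intro integrable_integral bv_scaleR_integrable g continuous_intros) (use ne in auto)
  have c: "((\<lambda>\<phi>. g \<phi> *\<^sub>R (1::complex)) has_integral ?c) {- pi..pi}"
    by (intro integrable_integral bv_scaleR_integrable g continuous_intros)
  have "((\<lambda>\<phi>. Re ((2 * (g \<phi> *\<^sub>R (1 / (1 - z * cis (- \<phi>)))) - g \<phi> *\<^sub>R 1) / (2 * pi))) has_integral Re (?F z)) {- pi..pi}"
    using has_integral_linear[OF has_integral_divide[OF has_integral_diff[OF has_integral_mult_right[OF H, of 2] c],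
        of "complex_of_real (2 * pi)"] bounded_linear_Re] unfolding o_def .
  moreover have "Re ((2 * (g \<phi> *\<^sub>R (1 / (1 - z * cis (- \<phi>)))) - g \<phi> *\<^sub>R 1) / (2 * pi))
      = g \<phi> * poisson_kernel (cmod z) (\<phi> - Arg z)" for \<phi>
  proof -
    have "(2 * (g \<phi> *\<^sub>R (1 / (1 - z * cis (- \<phi>)))) - g \<phi> *\<^sub>R 1) / (2 * pi)
        = g \<phi> *\<^sub>R ((2 / (1 - z * cis (- \<phi>)) - 1) / (2 * pi))"
      by (simp add: scaleR_conv_of_real diff_divide_distrib right_diff_distrib)
    then show ?thesis by (simp only: scaleR_complex.sel poisson_kernel_eq_Re[OF z])
  qed
  ultimately show "poisson g z = Re (?F z)"
    by (simp add: poisson_def integral_unique)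
qed

lemma poisson_harmonic:
  assumes "g \<in> BV"
  shows "harmonic_on (poisson g) (ball 0 1)"
  using poisson_Re_holomorphic[OF assms] harmonic_on_Re_holomorphic[OF open_ball] by metis

lemma harmonic_on_isCont: "harmonic_on u S \<Longrightarrow> z \<in> S \<Longrightarrow> isCont u z"
  unfolding harmonic_on_def using has_derivative_continuous by blast

lemma hBV_norm_poisson_le:
  assumes "g \<in> BV"
  shows "hBV_norm (poisson g) \<le> variation g"
  unfolding hBV_norm_def using assms variation_poisson_le by (intro SUP_least) auto

lemma poisson_in_hBV:
  assumes "g \<in> BV"
  shows "poisson g \<in> hBV"
  using hBV_norm_poisson_le[OF assms] BV_D(2)[OF assms] poisson_harmonic[OF assms]
  by (auto simp: hBV_def)

lemma eventually_at_left_unit: "\<forall>\<^sub>F r in at_left 1. r \<in> {0..<1::real}"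
  unfolding eventually_at_left_field by (intro exI[of _ 0]) auto

text \<open>Translating a partition by a small amount moves all its points to continuity points of \<open>g\<close>.\<close>

lemma variation_le_hBV_norm:
  assumes g: "g \<in> NBV"
  shows "variation g \<le> hBV_norm (poisson g)"
  unfolding variation_eq_tv
proof (rule tv_least)
  fix n x assume nx: "(n, x) \<in> chains_between (- pi) pi"
  have BV: "g \<in> BV" by (rule NBV_imp_BV) fact
  define S where "S = (\<lambda>t. chain_sum (\<lambda>y. g (y + t)) n x)"
  have right: "((\<lambda>t. g (y + t)) \<longlongrightarrow> g y) (at_right 0)" for y
  proof -
    have "filterlim (\<lambda>t. y + t) (at_right y) (at_right (0::real))"
      unfolding filterlim_at
      by (auto simp: eventually_at_filter intro!: tendsto_eq_intros)
    moreover have "(g \<longlongrightarrow> g y) (at_right y)"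
      using g by (auto simp: NBV_def continuous_within)
    ultimately show ?thesis by (rule filterlim_compose[rotated])
  qed
  have "(S \<longlongrightarrow> chain_sum g n x) (at_right 0)"
    unfolding S_def chain_sum_def by (intro tendsto_sum tendsto_rabs tendsto_diff right)
  then have lim: "((\<lambda>t. ennreal (S t)) \<longlongrightarrow> ennreal (chain_sum g n x)) (at_right 0)"
    by (rule tendsto_ennrealI)
  show "ennreal (chain_sum g n x) \<le> hBV_norm (poisson g)"
  proof (rule ccontr)
    \<comment> \<open>By right continuity a strict excess of the chain sum would persist for all
      small \<open>t > 0\<close>, hence for some such \<open>t\<close> outside any given countable
      set.\<close>
    assume "\<not> ?thesis"
    then have "\<forall>\<^sub>F t in at_right 0. hBV_norm (poisson g) < ennreal (S t)"
      using order_tendstoD(1)[OF lim] by simp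
    then obtain d where d: "d > 0" "\<And>t. 0 < t \<Longrightarrow> t < d \<Longrightarrow> hBV_norm (poisson g) < ennreal (S t)"
      unfolding eventually_at_right_field by auto
    \<comment> \<open>These are the shifts that take some point of the chain to a discontinuity of
      \<open>g\<close>.\<close>
    define N where "N = (\<Union>i\<in>{..n}. (\<lambda>y. y - x i) ` {y. \<not> isCont g y})"
    have "countable N"
      unfolding N_def by (intro countable_UN countable_image countable_discontinuities BV) auto
    then have "uncountable ({0<..<d} - N)"
      using d(1) by (intro uncountable_minus_countable) (simp add: uncountable_open_interval)
    then obtain t where t: "0 < t" "t < d" "t \<notin> N"
      by (metis Diff_iff countable_empty equals0I greaterThanLessThan_iff)
    have cont: "isCont g (x i + t)" if "i \<le> n" for i
      using t(3) that by (force simp: N_def)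
    have "((\<lambda>r. chain_sum (\<lambda>y. on_circle (poisson g) r (y + t)) n x) \<longlongrightarrow> S t) (at_left 1)"
      unfolding S_def chain_sum_def
      by (intro tendsto_sum tendsto_rabs tendsto_diff poisson_tendsto BV cont) auto
    then have "((\<lambda>r. ennreal (chain_sum (\<lambda>y. on_circle (poisson g) r (y + t)) n x)) \<longlongrightarrow> ennreal (S t)) (at_left 1)"
      by (rule tendsto_ennrealI)
    moreover have "\<forall>\<^sub>F r in at_left 1. ennreal (chain_sum (\<lambda>y. on_circle (poisson g) r (y + t)) n x) \<le> hBV_norm (poisson g)"
      using eventually_at_left_unit
    proof eventually_elim
      case (elim r)
      have "ennreal (chain_sum (\<lambda>y. on_circle (poisson g) r (y + t)) n x)
          \<le> variation (\<lambda>y. on_circle (poisson g) r (y + t))"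
        unfolding variation_eq_tv by (rule chain_sum_le_tv[OF nx])
      \<comment> \<open>The shifted chain leaves \<open>{- pi..pi}\<close>; periodicity makes up for
        this.\<close>
      also have "\<dots> = variation (on_circle (poisson g) r)"
        by (rule variation_shift[OF periodic2pi_on_circle])
      also have "\<dots> \<le> hBV_norm (poisson g)"
        unfolding hBV_norm_def using elim by (rule SUP_upper)
      finally show ?case .
    qed
    ultimately have "ennreal (S t) \<le> hBV_norm (poisson g)"
      by (rule tendsto_upperbound) simp
    with d(2)[OF t(1,2)] show False by simp
  qed
qed

lemma hBV_norm_poisson:
  assumes "g \<in> NBV"
  shows "hBV_norm (poisson g) = variation g"
  using variation_le_hBV_norm[OF assms] hBV_norm_poisson_le[OF NBV_imp_BV[OF assms]] by simp

lemma BV_add: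
  assumes "f \<in> BV" "g \<in> BV"
  shows "(\<lambda>\<theta>. f \<theta> + g \<theta>) \<in> BV"
  using assms tv_triangle[of f g "- pi" pi]
  by (auto simp: BV_def periodic2pi_def variation_eq_tv intro: le_less_trans)

lemma BV_scale:
  assumes "g \<in> BV"
  shows "(\<lambda>\<theta>. a * g \<theta>) \<in> BV"
  using assms
  by (auto simp: BV_def periodic2pi_def variation_eq_tv tv_scale ennreal_mult_less_top)

lemma has_integral_poisson:
  assumes g: "g \<in> BV" and z: "cmod z < 1"
  shows "((\<lambda>\<phi>. g \<phi> * poisson_kernel (cmod z) (\<phi> - Arg z)) has_integral poisson g z) {- pi..pi}"
  unfolding poisson_def
  by (intro integrable_integral bv_mult_continuous_integrable g continuous_on_poisson_kernel z) simp

lemma poisson_add: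
  assumes "f \<in> BV" "g \<in> BV" "cmod z < 1"
  shows "poisson (\<lambda>\<theta>. f \<theta> + g \<theta>) z = poisson f z + poisson g z"
  using has_integral_add[OF has_integral_poisson[OF assms(1,3)] has_integral_poisson[OF assms(2,3)]]
  by (subst poisson_def) (simp add: integral_unique distrib_right)

lemma poisson_scale: "poisson (\<lambda>\<theta>. a * g \<theta>) z = a * poisson g z"
  by (simp add: poisson_def mult.assoc)

lemma poisson_const:
  assumes "cmod z < 1"
  shows "poisson (\<lambda>\<theta>. c) z = c"
proof -
  have "harmonic_on (\<lambda>z. c) (ball 0 1)"
    by (rule harmonic_on_Re_holomorphic[where F = "\<lambda>z. of_real c"]) auto
  from poisson_formula_harmonic[OF this order_refl _ assms] show ?thesis
    by (simp add: on_circle_def[abs_def])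
qed

lemma norm_cis_diff_le: "cmod (cis t - cis s) \<le> \<bar>t - s\<bar>"
proof -
  have "cis t - cis s = cis s * (cis (t - s) - 1)"
    by (simp add: right_diff_distrib cis_mult)
  then have "cmod (cis t - cis s) = 2 * \<bar>sin ((t - s) / 2)\<bar>"
    using dist_exp_i_1[of "t - s"] by (simp add: norm_mult cis_conv_exp)
  then show ?thesis using abs_sin_x_le_abs_x[of "(t - s) / 2"] by simp
qed

text \<open>The derivative of a holomorphic \<open>F\<close> with \<open>u = Re F\<close> is bounded
  on the closed disc of radius \<open>\<rho>\<close>. The result serves to show that the monotone
  parts of the restriction are continuous, as Helly's theorem requires.\<close>

lemma harmonic_on_circle_lipschitz:
  assumes u: "harmonic_on u (ball 0 1)" and \<rho>: "0 \<le> \<rho>" "\<rho> < 1"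
  obtains L where "0 \<le> L" "\<And>s t. \<bar>on_circle u \<rho> t - on_circle u \<rho> s\<bar> \<le> L * \<bar>t - s\<bar>"
proof -
  obtain F where F: "F holomorphic_on ball 0 1" "\<And>w. w \<in> ball 0 1 \<Longrightarrow> u w = Re (F w)"
    using harmonic_on_imp_Re_holomorphic[OF open_ball convex_ball u] by blast
  have sub: "cball 0 \<rho> \<subseteq> ball (0::complex) 1" using \<rho> by auto
  have "continuous_on (cball 0 \<rho>) (deriv F)"
    using holomorphic_deriv[OF F(1) open_ball] sub
    by (meson continuous_on_subset holomorphic_on_imp_continuous_on)
  then have "bounded (deriv F ` cball 0 \<rho>)"
    by (intro compact_imp_bounded compact_continuous_image) auto
  then obtain B where B: "0 < B" "\<And>z. z \<in> cball 0 \<rho> \<Longrightarrow> cmod (deriv F z) \<le> B"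
    unfolding bounded_pos by auto
  have diff: "cmod (F w - F z) \<le> B * cmod (w - z)" if "w \<in> cball 0 \<rho>" "z \<in> cball 0 \<rho>" for w z
  proof (rule field_differentiable_bound[OF convex_cball _ B(2) that])
    show "(F has_field_derivative deriv F y) (at y within cball 0 \<rho>)" if "y \<in> cball 0 \<rho>" for y
      using holomorphic_derivI[OF F(1) open_ball] that sub by (blast intro: has_field_derivative_at_within)
  qed
  show ?thesis
  proof (rule that[of "B * \<rho>"])
    show "0 \<le> B * \<rho>" using B \<rho> by simp
    fix s t
    have mem: "rcis \<rho> t \<in> cball 0 \<rho>" for t using \<rho> by simp
    have "\<bar>on_circle u \<rho> t - on_circle u \<rho> s\<bar> = \<bar>Re (F (rcis \<rho> t) - F (rcis \<rho> s))\<bar>"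
      using F(2)[OF subsetD[OF sub mem]] by (simp add: on_circle_def)
    also have "\<dots> \<le> cmod (F (rcis \<rho> t) - F (rcis \<rho> s))" by (rule abs_Re_le_cmod)
    also have "\<dots> \<le> B * cmod (rcis \<rho> t - rcis \<rho> s)" by (intro diff mem)
    also have "rcis \<rho> t - rcis \<rho> s = of_real \<rho> * (cis t - cis s)"
      by (simp add: rcis_def right_diff_distrib)
    also have "B * cmod \<dots> \<le> B * (\<rho> * \<bar>t - s\<bar>)"
      unfolding norm_mult using B \<rho> by (simp add: mult_left_mono norm_cis_diff_le)
    finally show "\<bar>on_circle u \<rho> t - on_circle u \<rho> s\<bar> \<le> B * \<rho> * \<bar>t - s\<bar>"
      by (simp add: mult.assoc)
  qed
qed


subsection \<open>Surjectivity\<close>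

text \<open>\<open>h\<close> need not take equal values at \<open>- pi\<close> and
  \<open>pi\<close>. Repeating its restriction to the half-open period preserves right continuity,
  and the changed value at \<open>pi\<close> costs only a finite amount of variation.\<close>

lemma nbv_periodic_extension:
  assumes cont: "\<And>t. continuous (at_right t) h" and fin: "tv h (- pi) pi < \<infinity>" and 0: "h (- pi) = 0"
  obtains g where "g \<in> NBV" "\<And>t. t \<in> {- pi..<pi} \<Longrightarrow> g t = h t"
proof -
  define g where "g = (\<lambda>t. h (t - 2 * pi * of_int \<lfloor>(t + pi) / (2 * pi)\<rfloor>))"
  have g_eq: "g t = h (t - 2 * pi * of_int k)" if "- pi \<le> t - 2 * pi * of_int k" "t - 2 * pi * of_int k < pi" for t k
  proof -
    have "\<lfloor>(t + pi) / (2 * pi)\<rfloor> = k"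
      using that by (intro floor_unique) (simp_all add: field_simps)
    then show ?thesis by (simp add: g_def)
  qed
  have eq: "g t = h t" if "t \<in> {- pi..<pi}" for t
    using g_eq[of t 0] that by simp
  have per: "periodic2pi g"
    unfolding periodic2pi_def
  proof
    fix t
    obtain k :: int where k: "- pi \<le> t + 2 * pi * of_int k" "t + 2 * pi * of_int k < - pi + 2 * pi"
      by (rule reduce_mod_2pi)
    show "g (t + 2 * pi) = g t"
      using g_eq[of t "- k"] g_eq[of "t + 2 * pi" "1 - k"] k by (simp add: algebra_simps)
  qed
  have rcont: "continuous (at_right t) g" for t
  proof -
    obtain k :: int where k: "- pi \<le> t + 2 * pi * of_int k" "t + 2 * pi * of_int k < - pi + 2 * pi"
      by (rule reduce_mod_2pi)
    define c where "c = 2 * pi * of_int k"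
    have "filterlim (\<lambda>s. s + c) (at_right (t + c)) (at_right t)"
      unfolding filterlim_at
      by (auto simp: eventually_at_filter intro!: tendsto_eq_intros)
    moreover have "(h \<longlongrightarrow> h (t + c)) (at_right (t + c))"
      using cont[of "t + c"] by (simp add: continuous_within)
    ultimately have "((\<lambda>s. h (s + c)) \<longlongrightarrow> h (t + c)) (at_right t)"
      by (rule filterlim_compose[rotated])
    moreover have "\<forall>\<^sub>F s in at_right t. h (s + c) = g s"
      unfolding eventually_at_right_field
    proof (intro exI[of _ "pi - c"] conjI allI impI)
      show "t < pi - c" using k by (simp add: c_def)
      fix s assume "t < s" "s < pi - c"
      then show "h (s + c) = g s" using g_eq[of s "- k"] k by (simp add: c_def)
    qed
    moreover have "h (t + c) = g t" using g_eq[of t "- k"] k by (simp add: c_def)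
    ultimately have "(g \<longlongrightarrow> g t) (at_right t)"
      by (simp add: tendsto_cong)
    then show ?thesis by (simp add: continuous_within)
  qed
  \<comment> \<open>On the closed period \<open>g\<close> and \<open>h\<close> differ only at
    \<open>pi\<close>; the correction is a multiple of the indicator of \<open>{pi}\<close>, which
    is monotone there.\<close>
  have "tv g (- pi) pi = tv (\<lambda>t. h t + (- h pi) * (if t = pi then 1 else 0)) (- pi) pi"
  proof (rule tv_cong)
    fix t assume t: "t \<in> {- pi..pi}"
    have "g pi = 0" using per 0 eq[of "- pi"] unfolding periodic2pi_def by (auto dest: spec[of _ "- pi"])
    then show "g t = h t + (- h pi) * (if t = pi then 1 else 0)"
      using t eq[of t] by (cases "t = pi") auto
  qed
  also have "\<dots> \<le> tv h (- pi) pi + ennreal \<bar>- h pi\<bar> * tv (\<lambda>t. if t = pi then 1 else 0) (- pi) pi"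
    by (rule order_trans[OF tv_triangle]) (simp only: tv_scale order_refl)
  also have "\<dots> < \<infinity>"
  proof -
    have "tv (\<lambda>t. if t = pi then 1 else 0) (- pi) pi < \<infinity>"
      by (rule le_less_trans[OF tv_mono_on]) (auto intro!: mono_onI)
    then show ?thesis using fin by (simp add: ennreal_mult_less_top)
  qed
  finally have "variation g < \<infinity>" by (simp add: variation_eq_tv)
  moreover have "g (- pi) = 0" using eq[of "- pi"] 0 by simp
  ultimately have "g \<in> NBV" using per rcont by (simp add: NBV_def)
  with eq that show ?thesis by blast
qed

lemma BV_const: "(\<lambda>\<theta>. c) \<in> BV"
  by (simp add: BV_def periodic2pi_def variation_eq_tv)

lemma poisson_kernel_integral_cong:
  assumes "\<And>t. t \<in> {- pi..<pi} \<Longrightarrow> f t = g t"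
  shows "integral {- pi..pi} (\<lambda>t. f t * K t) = integral {- pi..pi} (\<lambda>t. g t * K t)"
  by (rule integral_spike[of "{pi}"]) (use assms in auto)

text \<open>Helly's theorem concerns functions on the whole line; clamping the argument extends a
  function constantly beyond \<open>{- pi..pi}\<close>.\<close>

lemma clamp_lipschitz_continuous:
  fixes p :: "real \<Rightarrow> real"
  assumes "\<And>s t. - pi \<le> s \<Longrightarrow> s \<le> t \<Longrightarrow> t \<le> pi \<Longrightarrow> \<bar>p t - p s\<bar> \<le> L * \<bar>t - s\<bar>" "0 \<le> L"
  shows "isCont (\<lambda>t. p (max (- pi) (min t pi))) x"
proof -
  have "L-lipschitz_on {- pi..pi} p"
    unfolding lipschitz_on_def
  proof (intro conjI ballI assms(2))
    fix s t assume "s \<in> {- pi..pi}" "t \<in> {- pi..pi}"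
    then show "dist (p s) (p t) \<le> L * dist s t"
      using assms(1)[of s t] assms(1)[of t s] by (cases "s \<le> t") (auto simp: dist_real_def abs_minus_commute)
  qed
  then have "continuous_on {- pi..pi} p" by (rule lipschitz_on_continuous_on)
  then have "continuous_on UNIV (\<lambda>t. p (max (- pi) (min t pi)))"
    by (rule continuous_on_compose2) (auto intro!: continuous_intros)
  then show ?thesis by (simp add: continuous_on_eq_continuous_at)
qed

text \<open>Helly's selection theorem, applied to the two monotone parts of the restrictions of \<open>u\<close>
  to circles, produces the boundary function.\<close>

lemma hBV_poisson_representation:
  assumes u: "u \<in> hBV"
  obtains g c where "g \<in> NBV" "\<And>z. z \<in> ball 0 1 \<Longrightarrow> u z = poisson g z + c"
proof -
  have harm: "harmonic_on u (ball 0 1)" and fin: "hBV_norm u < \<infinity>"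
    using u by (auto simp: hBV_def)
  define W where "W = enn2real (hBV_norm u)"
  have W0: "0 \<le> W" by (simp add: W_def)
  define \<rho> where "\<rho> = (\<lambda>n. 1 - inverse (real (Suc n)))"
  have \<rho>: "0 \<le> \<rho> n" "\<rho> n < 1" for n
    by (auto simp: \<rho>_def field_simps)
  have \<rho>lim: "\<rho> \<longlonglongrightarrow> 1"
    unfolding \<rho>_def using tendsto_diff[OF tendsto_const LIMSEQ_inverse_real_of_nat, of 1] by simp
  define v where "v = (\<lambda>n. on_circle u (\<rho> n))"
  have v_le: "variation (v n) \<le> hBV_norm u" for n
    unfolding hBV_norm_def v_def by (rule SUP_upper) (use \<rho> in auto)
  then have v_fin: "tv (v n) (- pi) pi < \<infinity>" for n
    using fin by (metis le_less_trans variation_eq_tv)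
  have vW: "enn2real (tv (v n) (- pi) pi) \<le> W" for n
    unfolding W_def using v_le[of n] fin by (intro enn2real_mono) (auto simp: variation_eq_tv)
  define Q where "Q = (\<lambda>n p. mono_on {- pi..pi} p \<and> mono_on {- pi..pi} (\<lambda>t. p t - v n t) \<and>
      (\<forall>s t. - pi \<le> s \<longrightarrow> s \<le> t \<longrightarrow> t \<le> pi \<longrightarrow> p t - p s = enn2real (tv (v n) s t)) \<and>
      (\<forall>t\<in>{- pi..pi}. 0 \<le> p t \<and> p t \<le> W))"
  have "\<exists>p. Q n p" for n
  proof -
    obtain p where "mono_on {- pi..pi} p" "mono_on {- pi..pi} (\<lambda>t. p t - v n t)"
      "\<And>s t. - pi \<le> s \<Longrightarrow> s \<le> t \<Longrightarrow> t \<le> pi \<Longrightarrow> p t - p s = enn2real (tv (v n) s t)"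
      "\<And>t. t \<in> {- pi..pi} \<Longrightarrow> 0 \<le> p t \<and> p t \<le> enn2real (tv (v n) (- pi) pi)"
      by (rule bv_decomposition[OF v_fin[of n]]) blast
    then show ?thesis using vW[of n] unfolding Q_def by (intro exI[of _ p]) fastforce
  qed
  then obtain p where "\<And>n. Q n (p n)" by metis
  then have p: "\<And>n. mono_on {- pi..pi} (p n)" "\<And>n. mono_on {- pi..pi} (\<lambda>t. p n t - v n t)"
    "\<And>n s t. - pi \<le> s \<Longrightarrow> s \<le> t \<Longrightarrow> t \<le> pi \<Longrightarrow> p n t - p n s = enn2real (tv (v n) s t)"
    "\<And>n t. t \<in> {- pi..pi} \<Longrightarrow> 0 \<le> p n t \<and> p n t \<le> W"
    unfolding Q_def by blast+
  have vbv: "v n \<in> BV" for n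
    using v_fin[of n] unfolding v_def by (simp add: BV_def periodic2pi_on_circle variation_eq_tv)
  \<comment> \<open>The \<open>hBV\<close> norm bounds only the oscillation of \<open>v n\<close>;
    subtracting the value at \<open>- pi\<close> yields a uniform bound. The subtracted constants
    reappear in \<open>clim\<close>.\<close>
  define w where "w = (\<lambda>n t. v n t - v n (- pi))"
  have w_le: "\<bar>w n t\<bar> \<le> W" for n t
    using BV_abs_diff_le[OF vbv[of n], of t "- pi"] vW[of n] by (simp add: w_def variation_eq_tv)
  have cl: "max (- pi) (min t pi) \<in> {- pi..pi}" for t :: real by auto
  \<comment> \<open>\<open>A n\<close> and \<open>B n\<close> are the monotone parts extended to the
    line, with difference \<open>w n\<close> on the period. They share the bound
    \<open>2 * W\<close>, as \<open>p n\<close> and \<open>w n\<close> are both bounded by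
    \<open>W\<close>.\<close>
  define A where "A = (\<lambda>n t. p n (max (- pi) (min t pi)))"
  define B where "B = (\<lambda>n t. A n t - w n (max (- pi) (min t pi)))"
  have Amono: "mono (A n)" for n
    unfolding A_def by (intro monoI mono_onD[OF p(1)] cl) auto
  have Bmono: "mono (B n)" for n
  proof (rule monoI)
    fix s t :: real assume "s \<le> t"
    then have "p n (max (- pi) (min s pi)) - v n (max (- pi) (min s pi))
        \<le> p n (max (- pi) (min t pi)) - v n (max (- pi) (min t pi))"
      by (intro mono_onD[OF p(2)] cl) auto
    then show "B n s \<le> B n t" by (simp add: A_def B_def w_def)
  qed
  have A_le: "\<bar>A n t\<bar> \<le> 2 * W" for n t
    unfolding A_def using p(4)[OF cl[of t], of n] W0 by auto
  have B_le: "\<bar>B n t\<bar> \<le> 2 * W" for n t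
    unfolding B_def A_def using p(4)[OF cl[of t], of n] w_le[of n "max (- pi) (min t pi)"] by linarith
  have cont: "continuous (at_right x) (A n)" "continuous (at_right x) (B n)" for n x
  proof -
    obtain L where L: "0 \<le> L" "\<And>s t. \<bar>v n t - v n s\<bar> \<le> L * \<bar>t - s\<bar>"
      using harmonic_on_circle_lipschitz[OF harm \<rho>(1,2)[of n]] unfolding v_def by metis
    \<comment> \<open>An increment of \<open>p n\<close> is the variation of \<open>v n\<close> over
      the interval and so inherits its Lipschitz constant. That constant may depend on
      \<open>n\<close>, since Helly's theorem asks for continuity of each function only.\<close>
    have "\<bar>p n t - p n s\<bar> \<le> L * \<bar>t - s\<bar>" if st: "- pi \<le> s" "s \<le> t" "t \<le> pi" for s t
    proof -
      have "enn2real (tv (v n) s t) \<le> enn2real (ennreal (L * (t - s)))"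
        using L by (intro enn2real_mono tv_lipschitz) auto
      then show ?thesis using p(3)[OF st, of n] L st by (simp add: mult_nonneg_nonneg)
    qed
    then have 1: "isCont (A n) x"
      unfolding A_def by (rule clamp_lipschitz_continuous[OF _ L(1)])
    have "\<bar>w n t - w n s\<bar> \<le> L * \<bar>t - s\<bar>" for s t
      using L(2) by (simp add: w_def)
    then have "isCont (\<lambda>t. w n (max (- pi) (min t pi))) x"
      by (intro clamp_lipschitz_continuous[OF _ L(1)])
    with 1 have "isCont (B n) x" unfolding B_def by (rule isCont_diff)
    with 1 show "continuous (at_right x) (A n)" "continuous (at_right x) (B n)"
      by (auto intro: continuous_at_imp_continuous_within)
  qed
  obtain s1 FA where s1: "strict_mono (s1 :: nat \<Rightarrow> nat)" "\<forall>x. continuous (at_right x) FA" "mono FA"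
    "\<forall>x. continuous (at x) FA \<longrightarrow> (\<lambda>n. A (s1 n) x) \<longlonglongrightarrow> FA x"
    using Helly_selection[of A "2 * W", OF cont(1) Amono A_le] by auto
  \<comment> \<open>The second selection is made along the first one, so that both parts converge
    along the composite subsequence.\<close>
  obtain s2 FB where s2: "strict_mono (s2 :: nat \<Rightarrow> nat)" "\<forall>x. continuous (at_right x) FB" "mono FB"
    "\<forall>x. continuous (at x) FB \<longrightarrow> (\<lambda>n. B (s1 (s2 n)) x) \<longlonglongrightarrow> FB x"
    using Helly_selection[of "\<lambda>n. B (s1 n)" "2 * W", OF cont(2) Bmono B_le] by auto
  define \<sigma> where "\<sigma> = s1 \<circ> s2"
  have \<sigma>: "strict_mono \<sigma>" unfolding \<sigma>_def using s1(1) s2(1) by (rule strict_mono_o)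
  define h where "h = (\<lambda>t. FA t - FB t)"
  define N where "N = {t. \<not> isCont FA t} \<union> {t. \<not> isCont FB t}"
  have N: "negligible N"
    unfolding N_def by (intro negligible_countable countable_Un mono_ctble_discont s1 s2)
  have wlim: "(\<lambda>n. w (\<sigma> n) t) \<longlonglongrightarrow> h t" if "t \<in> {- pi..pi} - N" for t
  proof -
    have "(\<lambda>n. A (s1 (s2 n)) t) \<longlonglongrightarrow> FA t"
      using LIMSEQ_subseq_LIMSEQ[OF _ s2(1), of "\<lambda>n. A (s1 n) t" "FA t"] s1(4) that
      by (simp add: N_def o_def)
    moreover have "(\<lambda>n. B (s1 (s2 n)) t) \<longlonglongrightarrow> FB t"
      using s2(4) that by (simp add: N_def)
    ultimately have "(\<lambda>n. A (s1 (s2 n)) t - B (s1 (s2 n)) t) \<longlonglongrightarrow> h t"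
      unfolding h_def by (rule tendsto_diff)
    moreover have "max (- pi) (min t pi) = t" using that by auto
    ultimately show ?thesis by (simp add: B_def \<sigma>_def)
  qed
  have wbv: "w n \<in> BV" for n
    using BV_add[OF vbv[of n] BV_const, of "- v n (- pi)"] by (simp add: w_def)
  define I where "I = (\<lambda>z. integral {- pi..pi} (\<lambda>t. h t * poisson_kernel (cmod z) (t - Arg z)))"
  have Ilim: "(\<lambda>n. poisson (w (\<sigma> n)) z) \<longlonglongrightarrow> I z" if z: "z \<in> ball 0 1" for z
  proof -
    have z1: "0 \<le> cmod z" "cmod z < 1" using z by auto
    show ?thesis
      unfolding poisson_def I_def
    proof (rule dominated_convergence_negligible(2)[where h = "\<lambda>t. W * poisson_kernel (cmod z) (t - Arg z)"])
      show "(\<lambda>t. w (\<sigma> n) t * poisson_kernel (cmod z) (t - Arg z)) integrable_on {- pi..pi}" for n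
        by (intro bv_mult_continuous_integrable wbv continuous_on_poisson_kernel z1)
      show "(\<lambda>t. W * poisson_kernel (cmod z) (t - Arg z)) integrable_on {- pi..pi}"
        by (intro integrable_continuous_real continuous_on_mult_left continuous_on_poisson_kernel z1)
      show "norm (w (\<sigma> n) t * poisson_kernel (cmod z) (t - Arg z)) \<le> W * poisson_kernel (cmod z) (t - Arg z)" for n t
        unfolding real_norm_def abs_mult using poisson_kernel_nonneg[OF z1, of "t - Arg z"]
        by (simp add: mult_right_mono w_le)
      show "(\<lambda>n. w (\<sigma> n) t * poisson_kernel (cmod z) (t - Arg z)) \<longlonglongrightarrow> h t * poisson_kernel (cmod z) (t - Arg z)"
        if "t \<in> {- pi..pi} - N" for t
        by (intro tendsto_mult tendsto_const wlim that)
    qed (rule N)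
  qed
  have ulim: "(\<lambda>n. u (of_real (\<rho> (\<sigma> n)) * z)) \<longlonglongrightarrow> u z" if z: "z \<in> ball 0 1" for z
  proof (rule isCont_tendsto_compose[OF harmonic_on_isCont[OF harm z]])
    show "(\<lambda>n. of_real (\<rho> (\<sigma> n)) * z) \<longlonglongrightarrow> z"
      using tendsto_mult[OF tendsto_of_real[OF LIMSEQ_subseq_LIMSEQ[OF \<rho>lim \<sigma>]] tendsto_const, of z]
      by (simp add: o_def)
  qed
  have uw: "u (of_real (\<rho> n) * z) = poisson (w n) z + v n (- pi)" if z: "z \<in> ball 0 1" for n z
  proof -
    have "u (of_real (\<rho> n) * z) = poisson (\<lambda>t. w n t + v n (- pi)) z"
      using poisson_formula_harmonic[OF harm \<rho>, of z] z by (simp add: w_def v_def)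
    also have "\<dots> = poisson (w n) z + poisson (\<lambda>t. v n (- pi)) z"
      using z by (intro poisson_add wbv BV_const) simp
    finally show ?thesis using z by (simp add: poisson_const)
  qed
  \<comment> \<open>At the centre the dilation has no effect, so the constants are the difference of
    two convergent sequences.\<close>
  have clim: "(\<lambda>n. v (\<sigma> n) (- pi)) \<longlonglongrightarrow> u 0 - I 0"
  proof -
    have "v (\<sigma> n) (- pi) = u (of_real (\<rho> (\<sigma> n)) * 0) - poisson (w (\<sigma> n)) 0" for n
      using uw[of 0 "\<sigma> n"] by simp
    then show ?thesis using tendsto_diff[OF ulim[of 0] Ilim[of 0]] by simp
  qed
  have uI: "u z = I z + (u 0 - I 0)" if z: "z \<in> ball 0 1" for z
  proof (rule LIMSEQ_unique)
    show "(\<lambda>n. u (of_real (\<rho> (\<sigma> n)) * z)) \<longlonglongrightarrow> u z" by (rule ulim[OF z])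
    show "(\<lambda>n. u (of_real (\<rho> (\<sigma> n)) * z)) \<longlonglongrightarrow> I z + (u 0 - I 0)"
      unfolding uw[OF z] by (intro tendsto_add Ilim clim z)
  qed
  \<comment> \<open>The normalisation at \<open>- pi\<close> required in \<open>NBV\<close>; the
    removed constant goes into \<open>c\<close>.\<close>
  define h0 where "h0 = (\<lambda>t. h t + - h (- pi))"
  obtain g where g: "g \<in> NBV" "\<And>t. t \<in> {- pi..<pi} \<Longrightarrow> g t = h0 t"
  proof (rule nbv_periodic_extension)
    show "continuous (at_right t) h0" for t
      unfolding h0_def h_def by (intro continuous_add continuous_diff continuous_const s1(2)[rule_format] s2(2)[rule_format])
    have "tv h0 (- pi) pi \<le> tv FA (- pi) pi + tv FB (- pi) pi"
      unfolding h0_def tv_add_const unfolding h_def by (rule tv_diff)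
    also have "\<dots> \<le> ennreal (FA pi - FA (- pi)) + ennreal (FB pi - FB (- pi))"
      by (rule add_mono[OF tv_mono_on[OF mono_imp_mono_on[OF s1(3)]] tv_mono_on[OF mono_imp_mono_on[OF s2(3)]]])
    also have "\<dots> < \<infinity>"
      by (metis ennreal_add_less_top ennreal_less_top infinity_ennreal_def)
    finally show "tv h0 (- pi) pi < \<infinity>" .
    show "h0 (- pi) = 0" by (simp add: h0_def)
  qed auto
  have gI: "I z = poisson g z + h (- pi)" if z: "z \<in> ball 0 1" for z
  proof -
    have "I z = integral {- pi..pi} (\<lambda>t. (g t + h (- pi)) * poisson_kernel (cmod z) (t - Arg z))"
      unfolding I_def by (rule poisson_kernel_integral_cong) (simp add: g(2) h0_def)
    also have "\<dots> = poisson (\<lambda>t. g t + h (- pi)) z" by (simp add: poisson_def)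
    also have "\<dots> = poisson g z + poisson (\<lambda>t. h (- pi)) z"
      using z by (intro poisson_add NBV_imp_BV[OF g(1)] BV_const) simp
    finally show ?thesis using z by (simp add: poisson_const)
  qed
  show ?thesis
  proof (rule that[OF g(1)])
    show "u z = poisson g z + (h (- pi) + (u 0 - I 0))" if "z \<in> ball 0 1" for z
      using uI[OF that] gI[OF that] by linarith
  qed
qed


subsection \<open>The Banach spaces\<close>

lemma variation_add_le: "variation (\<lambda>t. f t + g t) \<le> variation f + variation g"
  by (simp add: variation_eq_tv tv_triangle)

lemma variation_scale: "variation (\<lambda>t. a * g t) = ennreal \<bar>a\<bar> * variation g"
  by (simp add: variation_eq_tv tv_scale)

lemma NBV_add:
  assumes "f \<in> NBV" "g \<in> NBV"
  shows "(\<lambda>\<theta>. f \<theta> + g \<theta>) \<in> NBV"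
  using assms BV_add[OF assms[THEN NBV_imp_BV]]
  by (auto simp: NBV_def BV_def intro!: continuous_add)

lemma NBV_scale:
  assumes "g \<in> NBV"
  shows "(\<lambda>\<theta>. a * g \<theta>) \<in> NBV"
  using assms BV_scale[OF NBV_imp_BV[OF assms], of a]
  by (auto simp: NBV_def BV_def intro!: continuous_mult continuous_const)

lemma NBV_zero: "(\<lambda>\<theta>. 0) \<in> NBV"
  by (simp add: NBV_def periodic2pi_def variation_eq_tv)

lemma NBV_abs_le_variation:
  assumes "g \<in> NBV"
  shows "\<bar>g t\<bar> \<le> enn2real (variation g)"
  using BV_abs_diff_le[OF NBV_imp_BV[OF assms], of t "- pi"] assms by (simp add: NBV_def)

lemma NBV_eq_zero_iff:
  assumes "g \<in> NBV"
  shows "enn2real (variation g) = 0 \<longleftrightarrow> g = (\<lambda>\<theta>. 0)"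
  using NBV_abs_le_variation[OF assms] by (auto simp: variation_eq_tv)

lemma enn2real_variation_add_le:
  assumes "f \<in> NBV" "g \<in> NBV"
  shows "enn2real (variation (\<lambda>\<theta>. f \<theta> + g \<theta>)) \<le> enn2real (variation f) + enn2real (variation g)"
proof -
  have fin: "variation f < top" "variation g < top" using assms by (auto simp: NBV_def)
  then have "enn2real (variation (\<lambda>\<theta>. f \<theta> + g \<theta>)) \<le> enn2real (variation f + variation g)"
    by (intro enn2real_mono variation_add_le) simp
  then show ?thesis using fin by (simp add: enn2real_plus)
qed

text \<open>The difference is written as a sum with \<open>(- 1)\<close> times \<open>g\<close> so
  that it agrees literally with the distance in \<open>banach_structure\<close>.\<close>

definition NBV_dist :: "(real \<Rightarrow> real) \<Rightarrow> (real \<Rightarrow> real) \<Rightarrow> real" where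
  "NBV_dist f g = enn2real (variation (\<lambda>\<theta>. f \<theta> + (- 1) * g \<theta>))"

lemma NBV_diff: "f \<in> NBV \<Longrightarrow> g \<in> NBV \<Longrightarrow> (\<lambda>\<theta>. f \<theta> + (- 1) * g \<theta>) \<in> NBV"
  by (intro NBV_add NBV_scale)

lemma Metric_space_NBV: "Metric_space NBV NBV_dist"
proof
  show "0 \<le> NBV_dist f g" for f g by (simp add: NBV_dist_def)
  show "NBV_dist f g = NBV_dist g f" for f g
  proof -
    have "variation (\<lambda>\<theta>. (- 1) * (f \<theta> + (- 1) * g \<theta>)) = variation (\<lambda>\<theta>. f \<theta> + (- 1) * g \<theta>)"
      unfolding variation_scale by simp
    then show ?thesis by (simp add: NBV_dist_def algebra_simps)
  qed
  show "NBV_dist f g = 0 \<longleftrightarrow> f = g" if "f \<in> NBV" "g \<in> NBV" for f g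
    using NBV_eq_zero_iff[OF NBV_diff[OF that]] by (auto simp: NBV_dist_def fun_eq_iff)
  show "NBV_dist f h \<le> NBV_dist f g + NBV_dist g h" if "f \<in> NBV" "g \<in> NBV" "h \<in> NBV" for f g h
    using enn2real_variation_add_le[OF NBV_diff[OF that(1,2)] NBV_diff[OF that(2,3)]]
    by (simp add: NBV_dist_def)
qed

text \<open>Since elements of \<open>NBV\<close> vanish at \<open>- pi\<close>, the variation
  dominates the supremum norm and a Cauchy sequence has a pointwise limit. Lower semicontinuity
  upgrades this to convergence in variation, and right continuity passes to the limit by uniform
  convergence.\<close>

lemma NBV_complete: "Metric_space.mcomplete NBV NBV_dist"
proof -
  interpret Metric_space NBV NBV_dist by (rule Metric_space_NBV)
  show ?thesis
    unfolding mcomplete_def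
  proof (intro allI impI)
    fix \<sigma> assume "MCauchy \<sigma>"
    then have \<sigma>: "\<sigma> n \<in> NBV" and cauchy: "\<And>e. 0 < e \<Longrightarrow> \<exists>N. \<forall>n n'. N \<le> n \<longrightarrow> N \<le> n' \<longrightarrow> NBV_dist (\<sigma> n) (\<sigma> n') < e" for n
      by (auto simp: MCauchy_def)
    have pt: "\<bar>\<sigma> n t - \<sigma> m t\<bar> \<le> NBV_dist (\<sigma> n) (\<sigma> m)" for n m t
      using NBV_abs_le_variation[OF NBV_diff[OF \<sigma>[of n] \<sigma>[of m]], of t] by (simp add: NBV_dist_def)
    have "Cauchy (\<lambda>n. \<sigma> n t)" for t
    proof (rule metric_CauchyI)
      fix e :: real assume "0 < e"
      then obtain N where "\<forall>n n'. N \<le> n \<longrightarrow> N \<le> n' \<longrightarrow> NBV_dist (\<sigma> n) (\<sigma> n') < e"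
        using cauchy by blast
      then show "\<exists>N. \<forall>m\<ge>N. \<forall>n\<ge>N. dist (\<sigma> m t) (\<sigma> n t) < e"
        unfolding dist_real_def using pt by (meson le_less_trans)
    qed
    then have "\<exists>l. (\<lambda>n. \<sigma> n t) \<longlonglongrightarrow> l" for t
      using Cauchy_convergent_iff convergent_def by blast
    then obtain g where g: "\<And>t. (\<lambda>n. \<sigma> n t) \<longlonglongrightarrow> g t" by metis
    \<comment> \<open>The Cauchy estimate holds for two indices beyond \<open>N\<close>; one is kept
      fixed and the other sent to infinity.\<close>
    have small: "\<exists>N. \<forall>n\<ge>N. variation (\<lambda>\<theta>. \<sigma> n \<theta> + (- 1) * g \<theta>) \<le> ennreal e" if e: "0 < e" for e
    proof -
      obtain N where N: "\<forall>n n'. N \<le> n \<longrightarrow> N \<le> n' \<longrightarrow> NBV_dist (\<sigma> n) (\<sigma> n') < e"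
        using cauchy[OF e] by blast
      have "variation (\<lambda>\<theta>. \<sigma> n \<theta> + (- 1) * g \<theta>) \<le> ennreal e" if n: "n \<ge> N" for n
        unfolding variation_eq_tv
      proof (rule tv_lower_semicontinuous[OF sequentially_bot])
        show "((\<lambda>m. \<sigma> n t + (- 1) * \<sigma> m t) \<longlonglongrightarrow> \<sigma> n t + (- 1) * g t)" for t
          by (intro tendsto_intros g)
        show "\<forall>\<^sub>F m in sequentially. tv (\<lambda>t. \<sigma> n t + (- 1) * \<sigma> m t) (- pi) pi \<le> ennreal e"
          unfolding eventually_sequentially
        proof (intro exI[of _ N] allI impI)
          fix m assume "N \<le> m"
          then have "NBV_dist (\<sigma> n) (\<sigma> m) < e" using N n by blast
          moreover have "variation (\<lambda>\<theta>. \<sigma> n \<theta> + (- 1) * \<sigma> m \<theta>) < top"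
            using NBV_diff[OF \<sigma>[of n] \<sigma>[of m]] by (simp add: NBV_def)
          ultimately show "tv (\<lambda>t. \<sigma> n t + (- 1) * \<sigma> m t) (- pi) pi \<le> ennreal e"
            unfolding NBV_dist_def variation_eq_tv
            by (metis ennreal_enn2real ennreal_leI less_imp_le)
        qed
      qed
      then show ?thesis by blast
    qed
    have per: "periodic2pi g"
      unfolding periodic2pi_def
    proof
      fix t
      have "(\<lambda>n. \<sigma> n (t + 2 * pi)) = (\<lambda>n. \<sigma> n t)"
        using \<sigma> by (auto simp: NBV_def periodic2pi_def)
      then show "g (t + 2 * pi) = g t" using g[of t] g[of "t + 2 * pi"] LIMSEQ_unique by metis
    qed
    have zero: "g (- pi) = 0"
      using g[of "- pi"] \<sigma> by (auto simp: NBV_def LIMSEQ_const_iff)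
    have fin: "variation g < \<infinity>"
    proof -
      obtain N where N: "variation (\<lambda>\<theta>. \<sigma> N \<theta> + (- 1) * g \<theta>) \<le> ennreal 1"
        using small[of 1] by auto
      have "variation g = variation (\<lambda>\<theta>. \<sigma> N \<theta> + (- 1) * (\<sigma> N \<theta> + (- 1) * g \<theta>))"
        by (simp add: algebra_simps)
      also have "\<dots> \<le> variation (\<sigma> N) + variation (\<lambda>\<theta>. (- 1) * (\<sigma> N \<theta> + (- 1) * g \<theta>))"
        by (rule variation_add_le)
      also have "variation (\<lambda>\<theta>. (- 1) * (\<sigma> N \<theta> + (- 1) * g \<theta>)) = variation (\<lambda>\<theta>. \<sigma> N \<theta> + (- 1) * g \<theta>)"
        unfolding variation_scale by simp
      also have "variation (\<sigma> N) + \<dots> < \<infinity>"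
        using N \<sigma>[of N] by (auto simp: NBV_def intro: le_less_trans)
      finally show ?thesis .
    qed
    have unif: "\<bar>\<sigma> n t - g t\<bar> \<le> e" if "variation (\<lambda>\<theta>. \<sigma> n \<theta> + (- 1) * g \<theta>) \<le> ennreal e" "0 < e" for n t e
    proof -
      have "periodic2pi (\<lambda>\<theta>. \<sigma> n \<theta> + (- 1) * g \<theta>)"
        using per \<sigma>[of n] by (simp add: NBV_def periodic2pi_def)
      from order_trans[OF abs_diff_le_variation[OF this, of t "- pi"] that(1)]
      show ?thesis using zero \<sigma>[of n] that(2) by (simp add: NBV_def)
    qed
    have cont: "continuous (at_right t) g" for t
      unfolding continuous_within
    proof (rule tendstoI)
      fix e :: real assume "0 < e"
      then obtain N where N: "variation (\<lambda>\<theta>. \<sigma> N \<theta> + (- 1) * g \<theta>) \<le> ennreal (e / 3)"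
        using small[of "e / 3"] by auto
      have "(\<sigma> N \<longlongrightarrow> \<sigma> N t) (at_right t)"
        using \<sigma>[of N] by (auto simp: NBV_def continuous_within)
      then have "\<forall>\<^sub>F s in at_right t. dist (\<sigma> N s) (\<sigma> N t) < e / 3"
        using \<open>0 < e\<close> by (intro tendstoD) auto
      then show "\<forall>\<^sub>F s in at_right t. dist (g s) (g t) < e"
      proof eventually_elim
        case (elim s)
        have "\<bar>\<sigma> N s - g s\<bar> \<le> e / 3" "\<bar>\<sigma> N t - g t\<bar> \<le> e / 3"
          using unif[OF N] \<open>0 < e\<close> by auto
        with elim show ?case unfolding dist_real_def by linarith
      qed
    qed
    have gN: "g \<in> NBV" using per zero fin cont by (simp add: NBV_def)
    have "limitin mtopology \<sigma> g sequentially"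
      unfolding limit_metric_sequentially
    proof (intro conjI allI impI gN)
      fix e :: real assume "0 < e"
      then obtain N where N: "\<forall>n\<ge>N. variation (\<lambda>\<theta>. \<sigma> n \<theta> + (- 1) * g \<theta>) \<le> ennreal (e / 2)"
        using small[of "e / 2"] by auto
      have "NBV_dist (\<sigma> n) g < e" if "n \<ge> N" for n
      proof -
        have "NBV_dist (\<sigma> n) g \<le> enn2real (ennreal (e / 2))"
          unfolding NBV_dist_def using N that by (intro enn2real_mono) auto
        then show ?thesis using \<open>0 < e\<close> by simp
      qed
      then show "\<exists>N. \<forall>n\<ge>N. \<sigma> n \<in> NBV \<and> NBV_dist (\<sigma> n) g < e" using \<sigma> by blast
    qed
    then show "\<exists>x. limitin mtopology \<sigma> x sequentially" by blast
  qed
qed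

lemma banach_structure_NBV: "banach_structure NBV_space"
proof -
  have "(\<lambda>x y. ns_norm NBV_space (ns_add NBV_space x (ns_scale NBV_space (- 1) y))) = NBV_dist"
    by (simp add: NBV_space_def NBV_dist_def fun_eq_iff)
  moreover have "enn2real (variation (\<lambda>t. a * g t)) = \<bar>a\<bar> * enn2real (variation g)" for a g
    by (simp add: variation_scale enn2real_mult)
  ultimately show ?thesis
    using NBV_complete
    by (auto simp: banach_structure_def real_vector_structure_def NBV_space_def NBV_add NBV_scale NBV_zero
        NBV_eq_zero_iff enn2real_variation_add_le algebra_simps)
qed

section \<open>Transport of Banach space structure along an isometry\<close>

lemma mcomplete_isometric_image:
  assumes M: "Metric_space M d" and M': "Metric_space M' d'"
    and T: "bij_betw T M M'" and iso: "\<And>x y. x \<in> M \<Longrightarrow> y \<in> M \<Longrightarrow> d' (T x) (T y) = d x y"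
    and complete: "Metric_space.mcomplete M d"
  shows "Metric_space.mcomplete M' d'"
proof -
  interpret A: Metric_space M d by (rule M)
  interpret B: Metric_space M' d' by (rule M')
  show ?thesis
    unfolding B.mcomplete_def
  proof (intro allI impI)
    fix \<sigma> assume \<sigma>: "B.MCauchy \<sigma>"
    then have mem: "\<sigma> n \<in> M'" for n by (auto simp: B.MCauchy_def)
    define \<tau> where "\<tau> = (\<lambda>n. inv_into M T (\<sigma> n))"
    have \<tau>: "\<tau> n \<in> M" "T (\<tau> n) = \<sigma> n" for n
      using mem[of n] T by (auto simp: \<tau>_def bij_betw_def inv_into_into f_inv_into_f)
    have "d (\<tau> n) (\<tau> m) = d' (\<sigma> n) (\<sigma> m)" for n m
      using iso[OF \<tau>(1) \<tau>(1), of n m] by (simp add: \<tau>)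
    then have "A.MCauchy \<tau>"
      using \<sigma> \<tau>(1) by (auto simp: A.MCauchy_def B.MCauchy_def)
    then obtain x where x: "limitin A.mtopology \<tau> x sequentially"
      using complete unfolding A.mcomplete_def by blast
    then have xM: "x \<in> M" by (simp add: A.limit_metric_sequentially)
    have "limitin B.mtopology \<sigma> (T x) sequentially"
      using x mem iso[OF \<tau>(1) xM] bij_betwE[OF T] xM
      by (simp add: A.limit_metric_sequentially B.limit_metric_sequentially \<tau>)
    then show "\<exists>x. limitin B.mtopology \<sigma> x sequentially" by blast
  qed
qed

text \<open>Every law in \<open>Y\<close> is an equation between images under \<open>T\<close> and
  follows from the same law in \<open>X\<close>, without recourse to representatives of
  classes.\<close>

lemma real_vector_structure_image:
  assumes X: "real_vector_structure X" and C: "ns_carrier Y = T ` ns_carrier X"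
    and add: "\<And>x y. x \<in> ns_carrier X \<Longrightarrow> y \<in> ns_carrier X \<Longrightarrow> ns_add Y (T x) (T y) = T (ns_add X x y)"
    and scale: "\<And>a x. x \<in> ns_carrier X \<Longrightarrow> ns_scale Y a (T x) = T (ns_scale X a x)"
    and zero: "ns_zero Y = T (ns_zero X)"
  shows "real_vector_structure Y"
  using X unfolding real_vector_structure_def C zero by (auto simp: add scale)

text \<open>The metric axioms are hypotheses of their own because nonnegativity and symmetry are
  demanded for all elements of the type, while \<open>T\<close> gives information on the carriers
  only.\<close>

lemma banach_structure_isometric:
  fixes X :: "'a normed_structure" and Y :: "'b normed_structure"
  defines "d \<equiv> \<lambda>x y. ns_norm X (ns_add X x (ns_scale X (- 1) y))"
    and "d' \<equiv> \<lambda>x y. ns_norm Y (ns_add Y x (ns_scale Y (- 1) y))"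
  assumes X: "banach_structure X" and T: "isometric_isomorphism T X Y"
    and zero: "T (ns_zero X) = ns_zero Y"
    and MX: "Metric_space (ns_carrier X) d" and MY: "Metric_space (ns_carrier Y) d'"
  shows "banach_structure Y"
proof -
  have bij: "bij_betw T (ns_carrier X) (ns_carrier Y)"
    and add: "\<And>x y. x \<in> ns_carrier X \<Longrightarrow> y \<in> ns_carrier X \<Longrightarrow> ns_add Y (T x) (T y) = T (ns_add X x y)"
    and scale: "\<And>a x. x \<in> ns_carrier X \<Longrightarrow> ns_scale Y a (T x) = T (ns_scale X a x)"
    and norm: "\<And>x. x \<in> ns_carrier X \<Longrightarrow> ns_norm Y (T x) = ns_norm X x"
    using T by (auto simp: isometric_isomorphism_def)
  have C: "ns_carrier Y = T ` ns_carrier X" and inj: "inj_on T (ns_carrier X)"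
    using bij by (auto simp: bij_betw_def)
  have vX: "real_vector_structure X" using X by (simp add: banach_structure_def)
  have addC: "ns_add X x y \<in> ns_carrier X" if "x \<in> ns_carrier X" "y \<in> ns_carrier X" for x y
    using vX that by (simp add: real_vector_structure_def)
  have scaleC: "ns_scale X a x \<in> ns_carrier X" if "x \<in> ns_carrier X" for a x
    using vX that by (simp add: real_vector_structure_def)
  have zeroC: "ns_zero X \<in> ns_carrier X" using vX by (simp add: real_vector_structure_def)
  have complete: "Metric_space.mcomplete (ns_carrier Y) d'"
  proof (rule mcomplete_isometric_image[OF MX MY bij])
    show "d' (T x) (T y) = d x y" if "x \<in> ns_carrier X" "y \<in> ns_carrier X" for x y
      using that by (simp add: d_def d'_def add scale norm addC scaleC)
    show "Metric_space.mcomplete (ns_carrier X) d"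
      using X by (simp add: banach_structure_def d_def)
  qed
  have zero_iff: "T x = ns_zero Y \<longleftrightarrow> x = ns_zero X" if "x \<in> ns_carrier X" for x
    using inj_on_eq_iff[OF inj that zeroC] zero by simp
  show ?thesis
    unfolding banach_structure_def
  proof (intro conjI complete[unfolded d'_def])
    show "real_vector_structure Y"
      by (rule real_vector_structure_image[OF vX C add scale zero[symmetric]])
  qed (use X in \<open>auto simp: banach_structure_def C norm scale add addC scaleC zero_iff\<close>)
qed


section \<open>The quotient of \<open>hBV\<close> by the constants\<close>

lemma on_circle_add: "on_circle (\<lambda>z. u z + w z) r = (\<lambda>\<theta>. on_circle u r \<theta> + on_circle w r \<theta>)"
  by (simp add: on_circle_def fun_eq_iff)

lemma on_circle_scale: "on_circle (\<lambda>z. a * u z) r = (\<lambda>\<theta>. a * on_circle u r \<theta>)"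
  by (simp add: on_circle_def fun_eq_iff)

text \<open>Passing to holomorphic functions with real parts \<open>u\<close> and \<open>w\<close>
  replaces the bookkeeping of six partial derivatives.\<close>

lemma harmonic_on_ball_add:
  assumes "harmonic_on u (ball 0 1)" "harmonic_on w (ball 0 1)"
  shows "harmonic_on (\<lambda>z. u z + w z) (ball 0 1)"
proof -
  obtain F where F: "F holomorphic_on ball 0 1" "\<And>z. z \<in> ball 0 1 \<Longrightarrow> u z = Re (F z)"
    using harmonic_on_imp_Re_holomorphic[OF open_ball convex_ball assms(1)] by blast
  obtain G where G: "G holomorphic_on ball 0 1" "\<And>z. z \<in> ball 0 1 \<Longrightarrow> w z = Re (G z)"
    using harmonic_on_imp_Re_holomorphic[OF open_ball convex_ball assms(2)] by blast
  show ?thesis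
    by (rule harmonic_on_Re_holomorphic[OF open_ball holomorphic_on_add[OF F(1) G(1)]])
      (simp add: F(2) G(2))
qed

lemma harmonic_on_ball_scale:
  assumes "harmonic_on u (ball 0 1)"
  shows "harmonic_on (\<lambda>z. a * u z) (ball 0 1)"
proof -
  obtain F where F: "F holomorphic_on ball 0 1" "\<And>z. z \<in> ball 0 1 \<Longrightarrow> u z = Re (F z)"
    using harmonic_on_imp_Re_holomorphic[OF open_ball convex_ball assms] by blast
  have "(\<lambda>z. of_real a * F z) holomorphic_on ball 0 1"
    by (intro holomorphic_intros F)
  then show ?thesis
    by (rule harmonic_on_Re_holomorphic[OF open_ball]) (simp add: F(2))
qed

lemma hBV_norm_add_le: "hBV_norm (\<lambda>z. u z + w z) \<le> hBV_norm u + hBV_norm w"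
  unfolding hBV_norm_def
proof (rule SUP_least)
  fix r :: real assume r: "r \<in> {0..<1}"
  have "variation (on_circle (\<lambda>z. u z + w z) r) \<le> variation (on_circle u r) + variation (on_circle w r)"
    unfolding on_circle_add by (rule variation_add_le)
  also have "\<dots> \<le> (SUP r\<in>{0..<1}. variation (on_circle u r)) + (SUP r\<in>{0..<1}. variation (on_circle w r))"
    by (intro add_mono SUP_upper r)
  finally show "variation (on_circle (\<lambda>z. u z + w z) r)
      \<le> (SUP r\<in>{0..<1}. variation (on_circle u r)) + (SUP r\<in>{0..<1}. variation (on_circle w r))" .
qed

lemma hBV_norm_scale: "hBV_norm (\<lambda>z. a * u z) = ennreal \<bar>a\<bar> * hBV_norm u"
  by (simp add: hBV_norm_def on_circle_scale variation_scale SUP_mult_left_ennreal)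

lemma hBV_add: "u \<in> hBV \<Longrightarrow> w \<in> hBV \<Longrightarrow> (\<lambda>z. u z + w z) \<in> hBV"
  using hBV_norm_add_le[of u w] harmonic_on_ball_add[of u w]
  by (auto simp: hBV_def intro: le_less_trans)

lemma hBV_scale: "u \<in> hBV \<Longrightarrow> (\<lambda>z. a * u z) \<in> hBV"
  using harmonic_on_ball_scale[of u a]
  by (auto simp: hBV_def hBV_norm_scale ennreal_mult_less_top)

lemma hBV_zero: "(\<lambda>z. 0) \<in> hBV"
  using hBV_scale[OF poisson_in_hBV[OF NBV_imp_BV[OF NBV_zero]], of 0] by simp

lemma hBV_norm_cong:
  assumes "(u, w) \<in> hBV_rel"
  shows "hBV_norm u = hBV_norm w"
proof -
  obtain c where c: "\<And>z. z \<in> ball 0 1 \<Longrightarrow> u z = w z + c"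
    using assms by (auto simp: hBV_rel_def)
  show ?thesis
    unfolding hBV_norm_def
  proof (rule SUP_cong[OF refl])
    fix r :: real assume "r \<in> {0..<1}"
    then have "on_circle u r = (\<lambda>\<theta>. on_circle w r \<theta> + c)"
      by (auto simp: on_circle_def c)
    then show "variation (on_circle u r) = variation (on_circle w r)"
      by (simp add: variation_eq_tv tv_add_const)
  qed
qed

lemma hBV_relI:
  assumes "u \<in> hBV" "w \<in> hBV" "\<And>z. z \<in> ball 0 1 \<Longrightarrow> u z = w z + c"
  shows "(u, w) \<in> hBV_rel"
  using assms by (auto simp: hBV_rel_def)

lemma equiv_hBV_rel: "equiv hBV hBV_rel"
proof (rule equivI)
  show "hBV_rel \<subseteq> hBV \<times> hBV" by (auto simp: hBV_rel_def)
  show "refl_on hBV hBV_rel" by (auto simp: refl_on_def intro: hBV_relI[where c = 0])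
  show "sym hBV_rel"
  proof (rule symI)
    fix u w assume "(u, w) \<in> hBV_rel"
    then obtain c where "u \<in> hBV" "w \<in> hBV" "\<forall>z\<in>ball 0 1. u z = w z + c" by (auto simp: hBV_rel_def)
    then show "(w, u) \<in> hBV_rel" by (intro hBV_relI[where c = "- c"]) auto
  qed
  show "trans hBV_rel"
  proof (rule transI)
    fix u w y assume uw: "(u, w) \<in> hBV_rel" and wy: "(w, y) \<in> hBV_rel"
    obtain c where "u \<in> hBV" "\<forall>z\<in>ball 0 1. u z = w z + c"
      using uw by (auto simp: hBV_rel_def)
    moreover obtain c' where "y \<in> hBV" "\<forall>z\<in>ball 0 1. w z = y z + c'"
      using wy by (auto simp: hBV_rel_def)
    ultimately show "(u, y) \<in> hBV_rel" by (intro hBV_relI[where c = "c + c'"]) auto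
  qed
qed

lemma hBV_rel_add:
  assumes "(u, u') \<in> hBV_rel" "(w, w') \<in> hBV_rel"
  shows "(\<lambda>z. u z + w z, \<lambda>z. u' z + w' z) \<in> hBV_rel"
proof -
  obtain c c' where "\<forall>z\<in>ball 0 1. u z = u' z + c" "\<forall>z\<in>ball 0 1. w z = w' z + c'"
    using assms by (auto simp: hBV_rel_def)
  then show ?thesis
    using assms by (intro hBV_relI[where c = "c + c'"] hBV_add) (auto simp: hBV_rel_def)
qed

lemma hBV_rel_scale:
  assumes "(u, u') \<in> hBV_rel"
  shows "(\<lambda>z. a * u z, \<lambda>z. a * u' z) \<in> hBV_rel"
proof -
  obtain c where "\<forall>z\<in>ball 0 1. u z = u' z + c"
    using assms by (auto simp: hBV_rel_def)
  then show ?thesis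
    using assms by (intro hBV_relI[where c = "a * c"] hBV_scale) (auto simp: hBV_rel_def distrib_left)
qed

lemma hBV_class_eq: "(u, w) \<in> hBV_rel \<Longrightarrow> hBV_rel `` {u} = hBV_rel `` {w}"
  by (rule equiv_class_eq[OF equiv_hBV_rel])

text \<open>The sum respects the relation, so the union over all pairs of representatives collapses
  to a single class.\<close>

lemma hBV_space_add:
  assumes "u \<in> hBV" "w \<in> hBV"
  shows "ns_add hBV_space (hBV_rel `` {u}) (hBV_rel `` {w}) = hBV_rel `` {\<lambda>z. u z + w z}"
proof -
  have "congruent2 hBV_rel hBV_rel (\<lambda>u w. hBV_rel `` {\<lambda>z. u z + w z})"
    by (rule congruent2I') (intro hBV_class_eq hBV_rel_add)
  from UN_equiv_class2[OF equiv_hBV_rel equiv_hBV_rel this assms] show ?thesis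
    by (simp add: hBV_space_def)
qed

lemma hBV_space_scale:
  assumes "u \<in> hBV"
  shows "ns_scale hBV_space a (hBV_rel `` {u}) = hBV_rel `` {\<lambda>z. a * u z}"
proof -
  have "congruent hBV_rel (\<lambda>u. hBV_rel `` {\<lambda>z. a * u z})"
    by (rule congruentI) (intro hBV_class_eq hBV_rel_scale)
  from UN_equiv_class[OF equiv_hBV_rel this assms] show ?thesis
    by (simp add: hBV_space_def)
qed

text \<open>Adding a constant does not change the variation on circles, so the infimum runs over a
  constant family.\<close>

lemma hBV_space_norm:
  assumes "u \<in> hBV"
  shows "ns_norm hBV_space (hBV_rel `` {u}) = enn2real (hBV_norm u)"
proof -
  have "u \<in> hBV_rel `` {u}" using assms equiv_class_self[OF equiv_hBV_rel] by blast
  moreover have "hBV_norm w = hBV_norm u" if "w \<in> hBV_rel `` {u}" for w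
    using that hBV_norm_cong by auto
  ultimately have "(INF w\<in>hBV_rel `` {u}. hBV_norm w) = hBV_norm u"
    by (metis (mono_tags, lifting) INF_eq_const empty_iff)
  then show ?thesis by (simp add: hBV_space_def)
qed

lemma hBV_norm_diff_commute: "hBV_norm (\<lambda>z. u z + - 1 * w z) = hBV_norm (\<lambda>z. w z + - 1 * u z)"
proof -
  have "(\<lambda>z. w z + - 1 * u z) = (\<lambda>z. - 1 * (u z + - 1 * w z))" by auto
  then show ?thesis using hBV_norm_scale[of "- 1" "\<lambda>z. u z + - 1 * w z"] by simp
qed

text \<open>The locale of metric spaces requires symmetry of the distance also outside the carrier.\<close>

lemma hBV_space_diff_norm_commute:
  "ns_norm hBV_space (ns_add hBV_space A (ns_scale hBV_space (- 1) B))
    = ns_norm hBV_space (ns_add hBV_space B (ns_scale hBV_space (- 1) A))"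
proof -
  have le: "(INF v \<in> ns_add hBV_space A (ns_scale hBV_space (- 1) B). hBV_norm v)
      \<le> (INF v \<in> ns_add hBV_space B (ns_scale hBV_space (- 1) A). hBV_norm v)" for A B
  proof (rule INF_greatest)
    fix v assume "v \<in> ns_add hBV_space B (ns_scale hBV_space (- 1) A)"
    then obtain u w w' where uw: "u \<in> B" "w \<in> A" "(\<lambda>z. - 1 * w z, w') \<in> hBV_rel" "(\<lambda>z. u z + w' z, v) \<in> hBV_rel"
      by (auto simp: hBV_space_def)
    \<comment> \<open>\<open>A\<close> and \<open>B\<close> are arbitrary sets, so membership in
      \<open>hBV\<close> has to be recovered from \<open>hBV_rel\<close>, which relates only its
      elements: \<open>u\<close> is the difference of \<open>u + w'\<close> and \<open>w'\<close>,
      and \<open>w\<close> is the negative of \<open>- 1 * w\<close>.\<close>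
    have "w' \<in> hBV" "(\<lambda>z. u z + w' z) \<in> hBV" and mw: "(\<lambda>z. - 1 * w z) \<in> hBV"
      using uw by (auto simp: hBV_rel_def)
    from hBV_add[OF this(2) hBV_scale[OF this(1), of "- 1"]] have u: "u \<in> hBV" by simp
    from hBV_scale[OF mw, of "- 1"] have w: "w \<in> hBV" by simp
    have "(\<lambda>z. w z + - 1 * u z) \<in> ns_add hBV_space A (ns_scale hBV_space (- 1) B)"
    proof -
      have "(\<lambda>z. - 1 * u z, \<lambda>z. - 1 * u z) \<in> hBV_rel"
        using hBV_scale[OF u, of "- 1"] by (intro hBV_relI[where c = 0]) auto
      then have "(\<lambda>z. - 1 * u z) \<in> ns_scale hBV_space (- 1) B"
        using uw(1) by (auto simp: hBV_space_def)
      moreover have "(\<lambda>z. w z + - 1 * u z, \<lambda>z. w z + - 1 * u z) \<in> hBV_rel"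
        using hBV_add[OF w hBV_scale[OF u, of "- 1"]] by (intro hBV_relI[where c = 0]) auto
      moreover have "ns_add hBV_space S S' = (\<Union>u\<in>S. \<Union>w\<in>S'. hBV_rel `` {\<lambda>z. u z + w z})" for S S'
        by (simp add: hBV_space_def)
      ultimately show ?thesis using uw(2) by blast
    qed
    then have "(INF v \<in> ns_add hBV_space A (ns_scale hBV_space (- 1) B). hBV_norm v)
        \<le> hBV_norm (\<lambda>z. w z + - 1 * u z)"
      by (rule INF_lower)
    also have "\<dots> = hBV_norm (\<lambda>z. u z + - 1 * w z)" by (rule hBV_norm_diff_commute)
    also have "\<dots> = hBV_norm v"
    proof -
      have "(\<lambda>z. u z + - 1 * w z, \<lambda>z. u z + w' z) \<in> hBV_rel"
        using hBV_rel_add[OF hBV_relI[where c = 0, OF u u] uw(3)] by simp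
      then show ?thesis using hBV_norm_cong uw(4) by metis
    qed
    finally show "(INF v \<in> ns_add hBV_space A (ns_scale hBV_space (- 1) B). hBV_norm v) \<le> hBV_norm v" .
  qed
  have "(INF v \<in> ns_add hBV_space A (ns_scale hBV_space (- 1) B). hBV_norm v)
      = (INF v \<in> ns_add hBV_space B (ns_scale hBV_space (- 1) A). hBV_norm v)"
    by (intro antisym le)
  moreover have "ns_norm hBV_space S = enn2real (INF v \<in> S. hBV_norm v)" for S
    by (simp add: hBV_space_def)
  ultimately show ?thesis by simp
qed

lemma poisson_add_rel:
  assumes "f \<in> BV" "g \<in> BV"
  shows "(poisson (\<lambda>\<theta>. f \<theta> + g \<theta>), \<lambda>z. poisson f z + poisson g z) \<in> hBV_rel"
  using assms by (intro hBV_relI[where c = 0] poisson_in_hBV BV_add hBV_add) (auto simp: poisson_add)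

text \<open>The Poisson integral of \<open>f - g\<close> is constant on the disc, so its norm is 0;
  by the isometry \<open>f - g\<close> has variation 0, and the normalisation at \<open>- pi\<close>
  makes it vanish.\<close>

lemma poisson_rel_imp_eq:
  assumes f: "f \<in> NBV" and g: "g \<in> NBV" and "(poisson f, poisson g) \<in> hBV_rel"
  shows "f = g"
proof -
  obtain c where c: "\<And>z. z \<in> ball 0 1 \<Longrightarrow> poisson f z = poisson g z + c"
    using assms(3) by (auto simp: hBV_rel_def)
  define h where "h = (\<lambda>\<theta>. f \<theta> + - 1 * g \<theta>)"
  have h: "h \<in> NBV" unfolding h_def by (rule NBV_diff[OF f g])
  have "poisson h z = 0 + c" if "z \<in> ball 0 1" for z
    using that c[OF that] poisson_add[OF NBV_imp_BV[OF f] BV_scale[OF NBV_imp_BV[OF g], of "- 1"], of z]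
      poisson_scale[of "- 1" g z] by (simp add: h_def)
  then have "(poisson h, \<lambda>z. 0) \<in> hBV_rel"
    using poisson_in_hBV[OF NBV_imp_BV[OF h]] hBV_zero by (intro hBV_relI[where c = c]) auto
  then have "variation h = hBV_norm (\<lambda>z. 0)"
    using hBV_norm_cong hBV_norm_poisson[OF h] by metis
  also have "\<dots> = 0" using hBV_norm_scale[of 0 "\<lambda>z. 0"] by simp
  finally have "h = (\<lambda>\<theta>. 0)" using NBV_eq_zero_iff[OF h] by simp
  then show ?thesis by (auto simp: h_def fun_eq_iff)
qed

text \<open>The constant left over in the representation of an \<open>hBV\<close> function is
  exactly what \<open>hBV_rel\<close> ignores, which gives surjectivity onto the classes.\<close>

lemma poisson_isometric_isomorphism:
  "isometric_isomorphism (\<lambda>g. hBV_rel `` {poisson g}) NBV_space hBV_space"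
proof -
  have carriers: "ns_carrier NBV_space = NBV" "ns_carrier hBV_space = hBV // hBV_rel"
    by (simp_all add: NBV_space_def hBV_space_def)
  have ops: "ns_add NBV_space f g = (\<lambda>\<theta>. f \<theta> + g \<theta>)" "ns_scale NBV_space a g = (\<lambda>\<theta>. a * g \<theta>)"
    "ns_norm NBV_space g = enn2real (variation g)" for f g a
    by (simp_all add: NBV_space_def)
  have mem: "poisson g \<in> hBV" if "g \<in> NBV" for g
    using that by (intro poisson_in_hBV NBV_imp_BV)
  have "bij_betw (\<lambda>g. hBV_rel `` {poisson g}) NBV (hBV // hBV_rel)"
  proof (rule bij_betw_imageI)
    show "inj_on (\<lambda>g. hBV_rel `` {poisson g}) NBV"
    proof (rule inj_onI)
      fix f g assume fg: "f \<in> NBV" "g \<in> NBV" "hBV_rel `` {poisson f} = hBV_rel `` {poisson g}"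
      then have "(poisson f, poisson g) \<in> hBV_rel"
        using eq_equiv_class[OF _ equiv_hBV_rel] mem by metis
      with fg(1,2) show "f = g" by (rule poisson_rel_imp_eq)
    qed
    show "(\<lambda>g. hBV_rel `` {poisson g}) ` NBV = hBV // hBV_rel"
    proof
      show "(\<lambda>g. hBV_rel `` {poisson g}) ` NBV \<subseteq> hBV // hBV_rel"
        using mem by (auto intro: quotientI)
      show "hBV // hBV_rel \<subseteq> (\<lambda>g. hBV_rel `` {poisson g}) ` NBV"
      proof
        fix U assume "U \<in> hBV // hBV_rel"
        then obtain u where u: "u \<in> hBV" "U = hBV_rel `` {u}" by (auto elim: quotientE)
        obtain g c where g: "g \<in> NBV" "\<And>z. z \<in> ball 0 1 \<Longrightarrow> u z = poisson g z + c"
          using hBV_poisson_representation[OF u(1)] by blast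
        have "(u, poisson g) \<in> hBV_rel"
          by (rule hBV_relI[OF u(1) mem[OF g(1)] g(2)])
        then show "U \<in> (\<lambda>g. hBV_rel `` {poisson g}) ` NBV"
          using g(1) u(2) hBV_class_eq by blast
      qed
    qed
  qed
  moreover have "hBV_rel `` {poisson (\<lambda>\<theta>. f \<theta> + g \<theta>)}
      = ns_add hBV_space (hBV_rel `` {poisson f}) (hBV_rel `` {poisson g})" if "f \<in> NBV" "g \<in> NBV" for f g
    using that by (simp add: hBV_space_add mem hBV_class_eq[OF poisson_add_rel] NBV_imp_BV)
  moreover have "hBV_rel `` {poisson (\<lambda>\<theta>. a * g \<theta>)} = ns_scale hBV_space a (hBV_rel `` {poisson g})" if "g \<in> NBV" for a g
    using that by (simp add: hBV_space_scale mem poisson_scale[abs_def])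
  moreover have "ns_norm hBV_space (hBV_rel `` {poisson g}) = enn2real (variation g)" if "g \<in> NBV" for g
    using that by (simp add: hBV_space_norm mem hBV_norm_poisson)
  ultimately show ?thesis
    by (simp add: isometric_isomorphism_def carriers ops)
qed

text \<open>On the carrier each class comes from some \<open>NBV\<close> function and the distance
  is \<open>NBV_dist\<close>, so separation and the triangle inequality are inherited. Nonnegativity
  and symmetry are shown for arbitrary sets.\<close>

lemma Metric_space_hBV:
  "Metric_space (ns_carrier hBV_space) (\<lambda>x y. ns_norm hBV_space (ns_add hBV_space x (ns_scale hBV_space (- 1) y)))"
    (is "Metric_space _ ?d")
proof
  interpret N: Metric_space NBV NBV_dist by (rule Metric_space_NBV)
  note iso = poisson_isometric_isomorphism
  let ?T = "\<lambda>g. hBV_rel `` {poisson g}"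
  have add: "?T (\<lambda>\<theta>. f \<theta> + g \<theta>) = ns_add hBV_space (?T f) (?T g)" if "f \<in> NBV" "g \<in> NBV" for f g
    using iso that by (simp add: isometric_isomorphism_def NBV_space_def)
  have scale: "?T (\<lambda>\<theta>. a * g \<theta>) = ns_scale hBV_space a (?T g)" if "g \<in> NBV" for a g
    using iso that by (simp add: isometric_isomorphism_def NBV_space_def)
  have norm: "ns_norm hBV_space (?T g) = enn2real (variation g)" if "g \<in> NBV" for g
    using iso that by (simp add: isometric_isomorphism_def NBV_space_def)
  have d: "?d (?T f) (?T g) = NBV_dist f g" if "f \<in> NBV" "g \<in> NBV" for f g
    using add[OF that(1) NBV_scale[OF that(2), of "- 1"]] scale[OF that(2), of "- 1"] norm[OF NBV_diff[OF that]]
    by (simp only: NBV_dist_def)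
  have carrier: "ns_carrier hBV_space = ?T ` NBV" and inj: "inj_on ?T NBV"
    using iso by (auto simp: isometric_isomorphism_def bij_betw_def NBV_space_def)
  have rep: "\<exists>f\<in>NBV. x = ?T f" if "x \<in> ns_carrier hBV_space" for x
    using that unfolding carrier by (simp add: image_iff)
  show "0 \<le> ?d x y" for x y by (simp add: hBV_space_def)
  show "?d x y = ?d y x" for x y by (rule hBV_space_diff_norm_commute)
  show "?d x y = 0 \<longleftrightarrow> x = y" if xy: "x \<in> ns_carrier hBV_space" "y \<in> ns_carrier hBV_space" for x y
  proof -
    obtain f g where fg: "f \<in> NBV" "g \<in> NBV" "x = ?T f" "y = ?T g"
      using rep[OF xy(1)] rep[OF xy(2)] by blast
    show ?thesis unfolding fg(3,4) d[OF fg(1,2)] inj_on_eq_iff[OF inj fg(1,2)] using fg(1,2) by (rule N.zero)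
  qed
  show "?d x z \<le> ?d x y + ?d y z"
    if xyz: "x \<in> ns_carrier hBV_space" "y \<in> ns_carrier hBV_space" "z \<in> ns_carrier hBV_space" for x y z
  proof -
    obtain f g h where fgh: "f \<in> NBV" "g \<in> NBV" "h \<in> NBV" "x = ?T f" "y = ?T g" "z = ?T h"
      using rep[OF xyz(1)] rep[OF xyz(2)] rep[OF xyz(3)] by blast
    show ?thesis
      unfolding fgh(4-6) d[OF fgh(1,2)] d[OF fgh(2,3)] d[OF fgh(1,3)] using fgh(1-3) by (rule N.triangle)
  qed
qed

lemma banach_structure_hBV: "banach_structure hBV_space"
proof (rule banach_structure_isometric[OF banach_structure_NBV poisson_isometric_isomorphism])
  have "poisson (\<lambda>\<theta>. 0) = (\<lambda>z. 0)" by (simp add: poisson_def fun_eq_iff)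
  then show "hBV_rel `` {poisson (ns_zero NBV_space)} = ns_zero hBV_space"
    by (simp add: NBV_space_def hBV_space_def)
  have "(\<lambda>x y. ns_norm NBV_space (ns_add NBV_space x (ns_scale NBV_space (- 1) y))) = NBV_dist"
    by (simp add: NBV_space_def NBV_dist_def fun_eq_iff)
  then show "Metric_space (ns_carrier NBV_space)
      (\<lambda>x y. ns_norm NBV_space (ns_add NBV_space x (ns_scale NBV_space (- 1) y)))"
    using Metric_space_NBV by (simp add: NBV_space_def)
qed (rule Metric_space_hBV)

subsection \<open>Failure of norm convergence\<close>

lemma isCont_on_circle:
  assumes "harmonic_on u (ball 0 1)" "0 \<le> r" "r < 1"
  shows "isCont (on_circle u r) \<theta>"
proof -
  have "isCont (\<lambda>\<theta>. rcis r \<theta>) \<theta>"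
    unfolding rcis_def cis_conv_exp by (intro continuous_intros)
  moreover have "isCont u (rcis r \<theta>)"
    using assms by (intro harmonic_on_isCont[OF assms(1)]) simp
  ultimately show ?thesis
    unfolding on_circle_def[abs_def] by (rule isCont_o2)
qed

text \<open>The restrictions to circles are continuous, so a jump of \<open>g\<close> survives in the difference.\<close>

lemma poisson_not_tendsto_variation:
  assumes g: "g \<in> BV" and L: "(g \<longlongrightarrow> L) (at_left 0)" and R: "(g \<longlongrightarrow> R) (at_right 0)" and "L \<noteq> R"
  shows "\<not> ((\<lambda>r. variation (\<lambda>\<theta>. on_circle (poisson g) r \<theta> - g \<theta>)) \<longlongrightarrow> 0) (at_left 1)"
proof
  assume "((\<lambda>r. variation (\<lambda>\<theta>. on_circle (poisson g) r \<theta> - g \<theta>)) \<longlongrightarrow> 0) (at_left 1)"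
  moreover have "0 < ennreal \<bar>R - L\<bar>" using \<open>L \<noteq> R\<close> by simp
  ultimately have "\<forall>\<^sub>F r in at_left 1. variation (\<lambda>\<theta>. on_circle (poisson g) r \<theta> - g \<theta>) < ennreal \<bar>R - L\<bar>"
    by (rule order_tendstoD(2))
  with eventually_at_left_unit
  have "\<forall>\<^sub>F r in at_left (1::real). False"
  proof eventually_elim
    case (elim r)
    then have r: "0 \<le> r" "r < 1" by auto
    define D where "D = (\<lambda>\<theta>. on_circle (poisson g) r \<theta> - g \<theta>)"
    have per: "periodic2pi D"
      using periodic2pi_on_circle[of "poisson g" r] BV_D(1)[OF g] by (simp add: D_def periodic2pi_def)
    have cont: "(on_circle (poisson g) r \<longlongrightarrow> on_circle (poisson g) r 0) (at 0)"
      using isCont_on_circle[OF poisson_harmonic[OF g] r, of 0] by (simp add: isCont_def)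
    have "filterlim (\<lambda>t. - t) (at_left 0) (at_right (0::real))"
      unfolding filterlim_at by (auto simp: eventually_at_filter intro!: tendsto_eq_intros)
    moreover have "(D \<longlongrightarrow> on_circle (poisson g) r 0 - L) (at_left 0)"
      unfolding D_def by (intro tendsto_diff L tendsto_mono[OF at_le cont]) simp
    ultimately have "((\<lambda>t. D (- t)) \<longlongrightarrow> on_circle (poisson g) r 0 - L) (at_right 0)"
      by (rule filterlim_compose[rotated])
    moreover have "(D \<longlongrightarrow> on_circle (poisson g) r 0 - R) (at_right 0)"
      unfolding D_def by (intro tendsto_diff R tendsto_mono[OF at_le cont]) simp
    \<comment> \<open>The value of the continuous function at 0 cancels, so the increments of
      \<open>D\<close> across 0 tend to \<open>R - L\<close> in absolute value; each is at most the
      variation of \<open>D\<close>, whatever the radius.\<close>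
    ultimately have "((\<lambda>t. ennreal \<bar>D (- t) - D t\<bar>) \<longlongrightarrow>
        ennreal \<bar>(on_circle (poisson g) r 0 - L) - (on_circle (poisson g) r 0 - R)\<bar>) (at_right 0)"
      by (intro tendsto_ennrealI tendsto_rabs tendsto_diff)
    then have "ennreal \<bar>(on_circle (poisson g) r 0 - L) - (on_circle (poisson g) r 0 - R)\<bar> \<le> variation D"
      by (rule tendsto_upperbound) (intro always_eventually allI abs_diff_le_variation per, simp)
    then have "ennreal \<bar>R - L\<bar> \<le> variation D" by simp
    with elim show False unfolding D_def by simp
  qed
  then show False by simp
qed

lemma continuous_at_right_floor_div:
  fixes c :: real
  assumes "0 < c"
  shows "continuous (at_right t) (\<lambda>t. real_of_int \<lfloor>(t + a) / c\<rfloor>)"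
proof -
  define k where "k = \<lfloor>(t + a) / c\<rfloor>"
  have k: "of_int k \<le> (t + a) / c" "(t + a) / c < of_int k + 1"
    unfolding k_def by linarith+
  have "\<forall>\<^sub>F s in at_right t. real_of_int \<lfloor>(s + a) / c\<rfloor> = real_of_int k"
    unfolding eventually_at_right_field
  proof (intro exI[of _ "c * (of_int k + 1) - a"] conjI allI impI)
    show "t < c * (of_int k + 1) - a" using k assms by (simp add: field_simps)
    fix s assume s: "t < s" "s < c * (of_int k + 1) - a"
    then have "of_int k \<le> (s + a) / c" "(s + a) / c < of_int k + 1"
      using k assms by (simp_all add: field_simps)
    then show "real_of_int \<lfloor>(s + a) / c\<rfloor> = real_of_int k" by (simp add: floor_unique)
  qed
  then show ?thesis
    unfolding continuous_within k_def[symmetric] by (rule tendsto_eventually)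
qed

text \<open>\<open>\<sigma>\<close> is the periodic extension of the function that is 0 on
  \<open>[- pi, 0)\<close> and 1 on \<open>[0, pi)\<close>. The floor formula makes periodicity,
  right continuity and finite variation properties of monotone step functions.\<close>

lemma NBV_jump_example:
  "\<exists>\<sigma>\<in>NBV. \<not> ((\<lambda>r. variation (\<lambda>\<theta>. on_circle (poisson \<sigma>) r \<theta> - \<sigma> \<theta>)) \<longlongrightarrow> 0) (at_left 1)"
proof -
  define \<sigma> :: "real \<Rightarrow> real" where "\<sigma> = (\<lambda>t. of_int \<lfloor>(t + pi) / pi\<rfloor> - 2 * of_int \<lfloor>(t + pi) / (2 * pi)\<rfloor>)"
  have floor_add_2: "\<lfloor>x + 2\<rfloor> = \<lfloor>x\<rfloor> + 2" and floor_add_1: "\<lfloor>x + 1\<rfloor> = \<lfloor>x\<rfloor> + 1" for x :: real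
    by linarith+
  have per: "periodic2pi \<sigma>"
    unfolding periodic2pi_def
  proof
    fix t
    have "(t + 2 * pi + pi) / pi = (t + pi) / pi + 2" "(t + 2 * pi + pi) / (2 * pi) = (t + pi) / (2 * pi) + 1"
      by (simp_all add: field_simps)
    then show "\<sigma> (t + 2 * pi) = \<sigma> t"
      unfolding \<sigma>_def by (simp only: floor_add_2 floor_add_1) simp
  qed
  have cont: "continuous (at_right t) \<sigma>" for t
    unfolding \<sigma>_def by (intro continuous_intros continuous_at_right_floor_div) auto
  have mono: "mono_on {- pi..pi} (\<lambda>t. real_of_int \<lfloor>(t + pi) / c\<rfloor>)" if "c > 0" for c
    using that by (intro mono_onI) (simp add: floor_mono divide_right_mono)
  have fin: "tv (\<lambda>t. real_of_int \<lfloor>(t + pi) / c\<rfloor>) (- pi) pi < \<infinity>" if "c > 0" for c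
    by (rule le_less_trans[OF tv_mono_on[OF mono[OF that]]]) simp
  have "variation \<sigma> \<le> tv (\<lambda>t. real_of_int \<lfloor>(t + pi) / pi\<rfloor>) (- pi) pi
      + ennreal \<bar>2\<bar> * tv (\<lambda>t. real_of_int \<lfloor>(t + pi) / (2 * pi)\<rfloor>) (- pi) pi"
    unfolding variation_eq_tv \<sigma>_def tv_scale[symmetric] by (rule tv_diff)
  also have "\<dots> < \<infinity>"
    using fin[of pi] fin[of "2 * pi"] by (simp add: ennreal_mult_less_top)
  finally have NBV: "\<sigma> \<in> NBV"
    using per cont by (simp add: NBV_def \<sigma>_def)
  have "\<forall>\<^sub>F t in at_left 0. \<sigma> t = 0"
    unfolding eventually_at_left_field
  proof (intro exI[of _ "- pi"] conjI allI impI)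
    fix t :: real assume t: "- pi < t" "t < 0"
    have "\<lfloor>(t + pi) / pi\<rfloor> = 0" "\<lfloor>(t + pi) / (2 * pi)\<rfloor> = 0"
      using t by (intro floor_unique; simp add: field_simps)+
    then show "\<sigma> t = 0" by (simp add: \<sigma>_def)
  qed simp
  then have L: "(\<sigma> \<longlongrightarrow> 0) (at_left 0)" by (rule tendsto_eventually)
  have "\<lfloor>1 / 2 :: real\<rfloor> = 0" by (intro floor_unique) auto
  then have "\<sigma> 0 = 1" by (simp add: \<sigma>_def)
  then have R: "(\<sigma> \<longlongrightarrow> 1) (at_right 0)"
    using cont[of 0] by (simp add: continuous_within)
  show ?thesis
    using NBV poisson_not_tendsto_variation[OF NBV_imp_BV[OF NBV] L R] by auto
qed

text \<open>The square wave \<open>sgn (sin t)\<close> takes the value 0, the mean of its one-sided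
  limits, at each of its jumps.\<close>

lemma BV_balanced_jump_example:
  "\<exists>\<tau>\<in>BV.
      (\<forall>\<theta>\<in>{- pi..pi}. \<exists>L R. (\<tau> \<longlongrightarrow> L) (at_left \<theta>) \<and> (\<tau> \<longlongrightarrow> R) (at_right \<theta>) \<and> \<tau> \<theta> = (R + L) / 2) \<and>
      \<not> ((\<lambda>r. variation (\<lambda>\<theta>. on_circle (poisson \<tau>) r \<theta> - \<tau> \<theta>)) \<longlongrightarrow> 0) (at_left 1)"
proof -
  define \<tau> :: "real \<Rightarrow> real" where "\<tau> = (\<lambda>t. sgn (sin t))"
  have pos: "\<tau> t = 1" if "0 < t" "t < pi" for t
    using sin_gt_zero[OF that] by (simp add: \<tau>_def)
  have per: "\<tau> (t + 2 * pi) = \<tau> t" for t by (simp add: \<tau>_def)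
  have odd: "\<tau> (- t) = - \<tau> t" for t by (simp add: \<tau>_def sgn_minus)
  have neg: "\<tau> t = - 1" if "- pi < t" "t < 0" for t
    using odd[of "- t"] pos[of "- t"] that by simp
  \<comment> \<open>On the closed period the square wave is \<open>sgn\<close> except at the
    endpoints, where it is 0. The subtracted correction is itself monotone, so the variation is
    finite as that of a difference of monotone functions.\<close>
  have "tv \<tau> (- pi) pi = tv (\<lambda>t. sgn t - (if t = pi then 1 else if t = - pi then - 1 else 0)) (- pi) pi"
  proof (rule tv_cong)
    fix t assume "t \<in> {- pi..pi}"
    then consider "t = - pi" | "t = pi" | "t = 0" | "- pi < t" "t < 0" | "0 < t" "t < pi" by force
    then show "\<tau> t = sgn t - (if t = pi then 1 else if t = - pi then - 1 else 0)"
      by cases (auto simp: pos neg, auto simp: \<tau>_def)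
  qed
  also have "\<dots> \<le> tv sgn (- pi) pi + tv (\<lambda>t. if t = pi then 1 else if t = - pi then - 1 else 0) (- pi) pi"
    by (rule tv_diff)
  also have "\<dots> \<le> ennreal (sgn pi - sgn (- pi)) + ennreal ((if pi = pi then 1 else if pi = - pi then - 1 else 0)
      - (if - pi = pi then 1 else if - pi = - pi then - 1 else 0))"
    by (intro add_mono tv_mono_on mono_onI) (auto simp: sgn_real_def)
  also have "\<dots> < \<infinity>" by simp
  finally have BV: "\<tau> \<in> BV"
    by (simp add: BV_def periodic2pi_def per variation_eq_tv)
  have R0: "(\<tau> \<longlongrightarrow> 1) (at_right 0)"
    by (rule tendsto_eventually) (auto simp: eventually_at_right_field pos intro!: exI[of _ pi])
  have L0: "(\<tau> \<longlongrightarrow> - 1) (at_left 0)"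
    by (rule tendsto_eventually) (auto simp: eventually_at_left_field neg intro!: exI[of _ "- pi"])
  have Lpi: "(\<tau> \<longlongrightarrow> 1) (at_left pi)"
    by (rule tendsto_eventually) (auto simp: eventually_at_left_field pos intro!: exI[of _ 0])
  have Rpi: "(\<tau> \<longlongrightarrow> - 1) (at_right pi)"
  proof (rule tendsto_eventually)
    have "\<tau> t = - 1" if "pi < t" "t < 2 * pi" for t
      using neg[of "t - 2 * pi"] per[of "t - 2 * pi"] that by simp
    then show "\<forall>\<^sub>F t in at_right pi. \<tau> t = - 1"
      by (auto simp: eventually_at_right_field intro!: exI[of _ "2 * pi"])
  qed
  have Rmpi: "(\<tau> \<longlongrightarrow> - 1) (at_right (- pi))"
    by (rule tendsto_eventually) (auto simp: eventually_at_right_field neg intro!: exI[of _ 0])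
  have Lmpi: "(\<tau> \<longlongrightarrow> 1) (at_left (- pi))"
  proof (rule tendsto_eventually)
    have "\<tau> t = 1" if "- (2 * pi) < t" "t < - pi" for t
      using pos[of "t + 2 * pi"] per[of t] that by simp
    then show "\<forall>\<^sub>F t in at_left (- pi). \<tau> t = 1"
      by (auto simp: eventually_at_left_field intro!: exI[of _ "- (2 * pi)"])
  qed
  have balanced: "\<exists>L R. (\<tau> \<longlongrightarrow> L) (at_left \<theta>) \<and> (\<tau> \<longlongrightarrow> R) (at_right \<theta>) \<and> \<tau> \<theta> = (R + L) / 2"
    if "\<theta> \<in> {- pi..pi}" for \<theta>
  proof -
    consider "\<theta> = - pi" | "\<theta> = pi" | "\<theta> = 0" | "\<theta> \<noteq> - pi" "\<theta> \<noteq> pi" "\<theta> \<noteq> 0" by blast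
    then show ?thesis
    proof cases
      case 1
      then show ?thesis using Lmpi Rmpi
        by (intro exI[of _ 1] exI[of _ "- 1"]) (simp add: \<tau>_def)
    next
      case 2
      then show ?thesis using Lpi Rpi
        by (intro exI[of _ 1] exI[of _ "- 1"]) (simp add: \<tau>_def)
    next
      case 3
      have "\<exists>R. (\<tau> \<longlongrightarrow> - 1) (at_left \<theta>) \<and> (\<tau> \<longlongrightarrow> R) (at_right \<theta>) \<and> \<tau> \<theta> = (R + - 1) / 2"
        using 3 L0 R0 by (intro exI[of _ 1]) (simp add: \<tau>_def)
      then show ?thesis by blast
    next
      case 4
      have "sin \<theta> \<noteq> 0"
        using 4 that pos[of \<theta>] neg[of \<theta>] by (cases "\<theta> < 0") (auto simp: \<tau>_def)
      then have "(\<tau> \<longlongrightarrow> \<tau> \<theta>) (at \<theta>)"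
        unfolding \<tau>_def by (intro tendsto_intros)
      then have "(\<tau> \<longlongrightarrow> \<tau> \<theta>) (at_left \<theta>)" "(\<tau> \<longlongrightarrow> \<tau> \<theta>) (at_right \<theta>)"
        by (auto intro: tendsto_mono[OF at_le])
      then show ?thesis by (intro exI[of _ "\<tau> \<theta>"]) simp
    qed
  qed
  have "\<not> ((\<lambda>r. variation (\<lambda>\<theta>. on_circle (poisson \<tau>) r \<theta> - \<tau> \<theta>)) \<longlongrightarrow> 0) (at_left 1)"
    by (rule poisson_not_tendsto_variation[OF BV L0 R0]) simp
  with balanced show ?thesis by (intro bexI[OF _ BV] conjI ballI)
qed

theorem theorem9:
  shows
    "(\<forall>g\<in>BV.
        (g \<in> NBV \<longrightarrow> weak_star_converges (on_circle (poisson g)) g) \<and>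
        (\<forall>r\<in>{0..<1}.
           sup_norm (on_circle (poisson g) r) \<le> (INF \<theta>. ennreal \<bar>g \<theta>\<bar>) + variation g) \<and>
        (g \<in> NBV \<longrightarrow>
           (\<forall>r\<in>{0..<1}. sup_norm (on_circle (poisson g) r) \<le> variation g)) \<and>
        (\<forall>r\<in>{0..<1}. variation (on_circle (poisson g) r) \<le> variation g)) \<and>
     (\<exists>\<sigma>\<in>NBV.
        \<not> ((\<lambda>r. variation (\<lambda>\<theta>. on_circle (poisson \<sigma>) r \<theta> - \<sigma> \<theta>)) \<longlongrightarrow> 0) (at_left 1)) \<and>
     (\<exists>\<tau>\<in>BV.
        (\<forall>\<theta>\<in>{- pi..pi}. \<exists>L R. (\<tau> \<longlongrightarrow> L) (at_left \<theta>) \<and> (\<tau> \<longlongrightarrow> R) (at_right \<theta>) \<and>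
                             \<tau> \<theta> = (R + L) / 2) \<and>
        \<not> ((\<lambda>r. variation (\<lambda>\<theta>. on_circle (poisson \<tau>) r \<theta> - \<tau> \<theta>)) \<longlongrightarrow> 0) (at_left 1)) \<and>
     poisson ` NBV \<subseteq> hBV \<and>
     (\<forall>g\<in>NBV. hBV_norm (poisson g) = variation g) \<and>
     banach_structure NBV_space \<and>
     banach_structure hBV_space \<and>
     isometric_isomorphism (\<lambda>g. hBV_rel `` {poisson g}) NBV_space hBV_space"
proof (intro conjI ballI impI)
  fix g r assume g: "g \<in> BV" and r: "r \<in> {0..<1::real}"
  show "sup_norm (on_circle (poisson g) r) \<le> (INF \<theta>. ennreal \<bar>g \<theta>\<bar>) + variation g"
    using g r by (intro sup_norm_poisson_le_INF) auto
  show "variation (on_circle (poisson g) r) \<le> variation g"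
    using g r by (intro variation_poisson_le) auto
  \<comment> \<open>The reference point is \<open>- pi\<close>, where elements of \<open>NBV\<close>
    vanish.\<close>
  show "sup_norm (on_circle (poisson g) r) \<le> variation g" if "g \<in> NBV"
    using sup_norm_poisson_le[OF g, of r "- pi"] r that by (simp add: NBV_def)
next
  show "poisson ` NBV \<subseteq> hBV"
    using poisson_in_hBV NBV_imp_BV by blast
qed (use poisson_weak_star NBV_jump_example BV_balanced_jump_example hBV_norm_poisson
      banach_structure_NBV banach_structure_hBV poisson_isometric_isomorphism in blast)+

end
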